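(* Let $\rho$ be a Borel probability measure on $\mathbb{R}$ having an exponential moment and a positive drift $\lambda=\int_{\mathbb{R}}y\,d\rho(y)>0$. If $\rho$ is $0$-weakly-diophantine, then there is $\gamma_0>0$ such that for every $\gamma\in(0,\gamma_0)$, the operator $f\mapsto(G-T_\lambda)\star f$ is a continuous Fourier multiplier from $\mathcal{C}^2_\gamma(\mathbb{R})$ to $\mathcal{C}^0_\gamma(\mathbb{R})$ and from $\{f\in\mathrm{L}^2(\mathbb{R}) : e^{\gamma|x|}f(x)\in\mathrm{L}^2(\mathbb{R})\}$ to itself.
   Context: $\rho$ has an exponential moment if $\int_{\mathbb{R}} e^{\eta|y|}\,d\rho(y)<+\infty$ for some $\eta>0$. $\widehat\rho(ib)=\int_{\mathbb{R}} e^{-iby}\,d\rho(y)$ for real $b$. $\rho$ is $0$-weakly-diophantine if $\liminf_{b\to\pm\infty}|1-\widehat\rho(ib)|>0$. $G=\sum_{n=0}^{+\infty}\tilde\rho^{\star n}$, where $\tilde\rho(A)=\int_{\mathbb{R}}\mathbf{1}_A(-y)\,d\rho(y)$, so that $G\star f(x)=\sum_{n\ge 0}\int_{\mathbb{R}} f(x+y)\,d\rho^{\star n}(y)$. $T_\lambda$ is the measure with density $\frac1\lambda\mathbf{1}_{\mathbb{R}_-}$ with respect to Lebesgue measure, so that $T_\lambda\star f(x)=\frac1\lambda\int_x^{+\infty}f(t)\,dt$. For $\gamma>0$ and $M\in\mathbb{N}$, $\mathcal{C}^M_\gamma(\mathbb{R})=\{f\in\mathcal{C}^M(\mathbb{R})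 : \sup_{x}e^{\gamma|x|}|f^{(k)}(x)|<\infty \text{ for } 0\le k\le M\}$, with norm $\max_{0\le k\le M}\sup_x e^{\gamma|x|}|f^{(k)}(x)|$. The weighted $\mathrm{L}^2$ space has norm $\|e^{\gamma|x|}f\|_{\mathrm{L}^2}$. A continuous Fourier multiplier is a continuous operator given by convolution with a distribution (here $G-T_\lambda$). *)

theory Defs
  imports "HOL-Probability.Probability"
begin

section \<open>Assumptions on the law \<open>\<rho>\<close>\<close>

definition exponential_moment :: "real measure \<Rightarrow> bool" where
  "exponential_moment \<rho> \<longleftrightarrow> (\<exists>\<eta>>0. integrable \<rho> (\<lambda>y. exp (\<eta> * \<bar>y\<bar>)))"

definition rho_hat :: "real measure \<Rightarrow> complex \<Rightarrow> complex" where
  "rho_hat \<rho> z = (CLINT y|\<rho>. exp (- z * complex_of_real y))"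

text \<open>On the reals, \<^const>\<open>at_infinity\<close> is the filter of \<open>\<bar>b\<bar> \<rightarrow> \<infinity>\<close>, so this is the
  lower limit for \<open>b \<rightarrow> \<plusminus>\<infinity>\<close>.\<close>

definition weakly_diophantine_0 :: "real measure \<Rightarrow> bool" where
  "weakly_diophantine_0 \<rho> \<longleftrightarrow>
     Liminf at_infinity (\<lambda>b::real. ereal (cmod (1 - rho_hat \<rho> (\<i> * complex_of_real b)))) > 0"

section \<open>The measures \<open>G\<close> and \<open>T\<^sub>\<lambda>\<close>\<close>

definition reflect :: "real measure \<Rightarrow> real measure" where
  "reflect \<rho> = distr \<rho> borel uminus"

primrec conv_power :: "real measure \<Rightarrow> nat \<Rightarrow> real measure" where
  "conv_power \<mu> 0 = return borel 0"
| "conv_power \<mu> (Suc n) = convolution \<mu> (conv_power \<mu> n)"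

definition renewal_measure :: "real measure \<Rightarrow> real measure" where
  "renewal_measure \<rho> = measure_of UNIV (sets borel)
     (\<lambda>A. \<Sum>n. emeasure (conv_power (reflect \<rho>) n) A)"

definition T_measure :: "real \<Rightarrow> real measure" where
  "T_measure l = density lborel (\<lambda>x. ennreal (1 / l) * indicator {..0} x)"

lemma sets_conv_power [simp]: "sets (conv_power \<mu> n) = sets borel"
  by (cases n) auto

text \<open>The set function in the definition of \<open>G\<close> is countably additive, so \<^const>\<open>measure_of\<close>
  does not collapse to the zero measure.\<close>

lemma sets_renewal_measure [simp]: "sets (renewal_measure \<rho>) = sets borel"
  unfolding renewal_measure_def by (metis sets.sets_measure_of_eq space_borel)

lemma emeasure_renewal_measure:
  assumes "A \<in> sets borel"
  shows "emeasure (renewal_measure \<rho>) A = (\<Sum>n. emeasure (conv_power (reflect \<rho>) n) A)"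
proof -
  let ?f = "\<lambda>A. \<Sum>n. emeasure (conv_power (reflect \<rho>) n) A"
  have "countably_additive (sets (borel :: real measure)) ?f"
  proof (rule countably_additiveI)
    fix B :: "nat \<Rightarrow> real set"
    assume B: "range B \<subseteq> sets borel" "disjoint_family B"
    have "(\<Sum>i. ?f (B i)) = (\<Sum>n. \<Sum>i. emeasure (conv_power (reflect \<rho>) n) (B i))"
      using nn_integral_suminf[of "\<lambda>n i. emeasure (conv_power (reflect \<rho>) n) (B i)"
          "count_space UNIV"]
      by (simp add: nn_integral_count_space_nat)
    also have "\<dots> = ?f (\<Union>i. B i)"
      using B by (intro suminf_cong suminf_emeasure) auto
    finally show "(\<Sum>i. ?f (B i)) = ?f (\<Union>i. B i)" .
  qed
  then show ?thesis
    using assms unfolding renewal_measure_def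
    by (intro emeasure_measure_of_sigma) 
       (auto simp: positive_def intro: sets.sigma_algebra_axioms[of borel, simplified])
qed

section \<open>Convolution\<close>

definition convolvable_at :: "real measure \<Rightarrow> (real \<Rightarrow> complex) \<Rightarrow> real \<Rightarrow> bool" where
  "convolvable_at \<mu> f x \<longleftrightarrow> integrable \<mu> (\<lambda>y. f (x - y))"

definition convolve :: "real measure \<Rightarrow> (real \<Rightarrow> complex) \<Rightarrow> real \<Rightarrow> complex" where
  "convolve \<mu> f x = (CLINT y|\<mu>. f (x - y))"

text \<open>Convolution with the distribution \<open>\<mu> - \<nu>\<close>. It is split because \<open>\<mu>\<close> and \<open>\<nu>\<close> may both be
  infinite measures.\<close>

definition convolve_diff ::
    "real measure \<Rightarrow> real measure \<Rightarrow> (real \<Rightarrow> complex) \<Rightarrow> real \<Rightarrow> complex" where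
  "convolve_diff \<mu> \<nu> f x = convolve \<mu> f x - convolve \<nu> f x"

section \<open>Function spaces\<close>

definition nth_derivative :: "nat \<Rightarrow> (real \<Rightarrow> complex) \<Rightarrow> real \<Rightarrow> complex" where
  "nth_derivative k f = ((\<lambda>g x. vector_derivative g (at x)) ^^ k) f"

definition C_class :: "nat \<Rightarrow> (real \<Rightarrow> complex) set" where
  "C_class M = {f. (\<forall>k<M. \<forall>x. nth_derivative k f differentiable (at x)) \<and>
                   continuous_on UNIV (nth_derivative M f)}"

definition C_weighted :: "nat \<Rightarrow> real \<Rightarrow> (real \<Rightarrow> complex) set" where
  "C_weighted M \<gamma> = {f \<in> C_class M.
     \<forall>k\<le>M. bdd_above (range (\<lambda>x. exp (\<gamma> * \<bar>x\<bar>) * cmod (nth_derivative k f x)))}"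

definition C_weighted_norm :: "nat \<Rightarrow> real \<Rightarrow> (real \<Rightarrow> complex) \<Rightarrow> real" where
  "C_weighted_norm M \<gamma> f =
     (MAX k\<in>{..M}. SUP x. exp (\<gamma> * \<bar>x\<bar>) * cmod (nth_derivative k f x))"

text \<open>Elements of \<open>L\<^sup>2\<close> are represented by Borel functions, without passing to the quotient by
  almost everywhere equality. Borel (not just Lebesgue) measurability is needed because \<open>\<rho>\<close>
  may be singular.\<close>

definition L2 :: "(real \<Rightarrow> complex) set" where
  "L2 = {f \<in> borel_measurable borel. integrable lborel (\<lambda>x. (cmod (f x))\<^sup>2)}"

definition L2_norm :: "(real \<Rightarrow> complex) \<Rightarrow> real" where
  "L2_norm f = sqrt (LINT x|lborel. (cmod (f x))\<^sup>2)"

definition exp_weight :: "real \<Rightarrow> (real \<Rightarrow> complex) \<Rightarrow> real \<Rightarrow> complex" where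
  "exp_weight \<gamma> f x = complex_of_real (exp (\<gamma> * \<bar>x\<bar>)) * f x"

definition L2_weighted :: "real \<Rightarrow> (real \<Rightarrow> complex) set" where
  "L2_weighted \<gamma> = {f \<in> L2. exp_weight \<gamma> f \<in> L2}"

definition L2_weighted_norm :: "real \<Rightarrow> (real \<Rightarrow> complex) \<Rightarrow> real" where
  "L2_weighted_norm \<gamma> f = L2_norm (exp_weight \<gamma> f)"

section \<open>Continuous Fourier multipliers\<close>

text \<open>The target carries a seminorm \<open>q\<close>, and linearity is required up to functions of seminorm
  zero: this is linearity almost everywhere for \<open>L\<^sup>2\<close> and exact linearity for continuous
  functions with the weighted supremum norm. Together with continuity it implies that the
  operator descends to almost everywhere classes.\<close>

definition continuous_linear_operator ::
    "(real \<Rightarrow> complex) set \<Rightarrow> ((real \<Rightarrow> complex) \<Rightarrow> real) \<Rightarrow>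
     (real \<Rightarrow> complex) set \<Rightarrow> ((real \<Rightarrow> complex) \<Rightarrow> real) \<Rightarrow>
     ((real \<Rightarrow> complex) \<Rightarrow> real \<Rightarrow> complex) \<Rightarrow> bool" where
  "continuous_linear_operator X p Y q T \<longleftrightarrow>
     (\<forall>f\<in>X. T f \<in> Y) \<and>
     (\<forall>f\<in>X. \<forall>g\<in>X. q (\<lambda>x. T (\<lambda>t. f t + g t) x - (T f x + T g x)) = 0) \<and>
     (\<forall>f\<in>X. \<forall>c. q (\<lambda>x. T (\<lambda>t. c * f t) x - c * T f x) = 0) \<and>
     (\<forall>f\<in>X. \<forall>\<epsilon>>0. \<exists>\<delta>>0. \<forall>g\<in>X.
        p (\<lambda>x. g x - f x) < \<delta> \<longrightarrow> q (\<lambda>x. T g x - T f x) < \<epsilon>)"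

definition locally_finite :: "real measure \<Rightarrow> bool" where
  "locally_finite \<mu> \<longleftrightarrow> sets \<mu> = sets borel \<and> (\<forall>K. compact K \<longrightarrow> emeasure \<mu> K < \<infinity>)"

text \<open>Local finiteness makes \<open>\<mu> - \<nu>\<close> a distribution; convolvability ensures that the integrals
  are not the default value of a non-integrable function.\<close>

definition continuous_fourier_multiplier ::
    "real measure \<Rightarrow> real measure \<Rightarrow>
     (real \<Rightarrow> complex) set \<Rightarrow> ((real \<Rightarrow> complex) \<Rightarrow> real) \<Rightarrow>
     (real \<Rightarrow> complex) set \<Rightarrow> ((real \<Rightarrow> complex) \<Rightarrow> real) \<Rightarrow> bool" where
  "continuous_fourier_multiplier \<mu> \<nu> X p Y q \<longleftrightarrow>
     locally_finite \<mu> \<and> locally_finite \<nu> \<and>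
     (\<forall>f\<in>X. AE x in lborel. convolvable_at \<mu> f x \<and> convolvable_at \<nu> f x) \<and>
     continuous_linear_operator X p Y q (convolve_diff \<mu> \<nu>)"

end

theory Submission
  imports Defs
begin

text \<open>
  Write \<open>\<zeta> = s + ib\<close>. The operator \<open>W = (G - T\<^sub>\<lambda>) \<star> _\<close> has the symbol \<open>1 / (1 - \<rho>(\<zeta>)) - 1 / (\<lambda> \<zeta>)\<close>,
  but for \<open>s < 0\<close> neither of its two terms is an absolutely convergent kernel. For \<open>s > 0\<close> both are,
  and \<open>W\<close> is bounded on \<open>L\<^sup>2(e\<^bsup>2sx\<^esup>dx)\<close>. To reach the weight \<open>e\<^bsup>-2sx\<^esup>\<close> without analytic continuation, let \<open>P\<close>
  be the transition operator of \<open>\<rho>\<close>, \<open>R = (I - P) T\<^sub>\<lambda>\<close> the convolution with its integrated tail and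
  \<open>Q = T\<^sub>\<lambda> (I - R)\<close>; these are convolutions with exponentially decaying finite kernels, and
  \<open>(I - P) W = I - R\<close>, \<open>R W = Q\<close>. The operator \<open>A = (I - P)\<^sup>* (I - P) + R\<^sup>* R\<close> has a symbol close to
  \<open>|1 - \<rho>|\<^sup>2 + |r|\<^sup>2\<close>, which is bounded below: by the diophantine condition at high frequencies, and since
  \<open>r(0) = 1\<close> at low ones. Hence \<open>I - A / K\<close> contracts both weighted spaces by Plancherel, and the Neumann
  series solving \<open>A W f = (I - P)\<^sup>* (I - R) f + R\<^sup>* Q f\<close> converges in both of them, to the same function.

  For \<open>f \<in> C\<^sup>2\<^sub>\<gamma>\<close> write \<open>f = e \<star> g\<close> with \<open>e(x) = exp (- a x)\<close> on \<open>x > 0\<close> and \<open>g = f' + a f\<close>. Then \<open>W f = (W e) \<star> g\<close>, and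
  \<open>e\<^bsup>\<gamma>|x|\<^esup> W e\<close> is integrable by the \<open>L\<^sup>2\<close> bound for a larger weight.
\<close>

section \<open>Plancherel's identity\<close>

text \<open>Adjoints are taken by reflecting kernels, so A is a convolution and its symbol
  \<open>psi\<close> has a value at -z where |1 - \<rho>|^2 would have a conjugate. The two agree on
  the imaginary axis and differ little in a thin strip, so one and the same A serves both weights.
  At intermediate frequencies the lower bound rests on a lattice argument: a zero of 1 - \<rho>
  there would recur at arbitrarily high frequencies. The identities for W are used only on the line
  of positive real part, where dividing by 1 - \<rho> and by \<lambda> z is legitimate; what crosses
  to the other weight is the equation for W f, whose remaining terms involve finite kernels only.
  The Neumann sums for the two weights are the same functions and the weights are comparable on
  bounded intervals, which identifies the limits. Plancherel's identity is proved for integrable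
  functions, whose transforms are pointwise integrals; the resulting bounds are extended to weighted
  L2 functions by truncation.\<close>

definition fourier :: "(real \<Rightarrow> complex) \<Rightarrow> real \<Rightarrow> complex" where
  "fourier h b = (CLINT x|lborel. iexp (b * x) * h x)"

abbreviation cx :: "real \<Rightarrow> complex" where "cx \<equiv> complex_of_real"

abbreviation "\<phi> \<equiv> std_normal_density"

lemma borel_measurable_cnj_comp [measurable (raw)]:
  assumes "f \<in> borel_measurable M"
  shows "(\<lambda>x. cnj (f x)) \<in> borel_measurable M"
  using assms by (rule measurable_compose) (intro borel_measurable_continuous_onI continuous_intros)

text \<open>Fatou's lemma; it is how regularisations and truncations are removed throughout.\<close>

lemma nn_integral_le_tendsto:
  fixes f :: "nat \<Rightarrow> 'a \<Rightarrow> ennreal"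
  assumes [measurable]: "\<And>n. f n \<in> borel_measurable M"
    and lim: "AE x in M. (\<lambda>n. f n x) \<longlonglongrightarrow> g x" and le: "\<And>n. (\<integral>\<^sup>+x. f n x \<partial>M) \<le> C"
  shows "(\<integral>\<^sup>+x. g x \<partial>M) \<le> C"
proof -
  have "(\<integral>\<^sup>+x. g x \<partial>M) = (\<integral>\<^sup>+x. liminf (\<lambda>n. f n x) \<partial>M)"
    using lim by (intro nn_integral_cong_AE) (auto elim!: eventually_mono simp: lim_imp_Liminf)
  also have "\<dots> \<le> liminf (\<lambda>n. \<integral>\<^sup>+x. f n x \<partial>M)"
    by (rule nn_integral_liminf) measurable
  also have "\<dots> \<le> liminf (\<lambda>n::nat. C)"
    by (intro Liminf_mono always_eventually allI le)
  also have "\<dots> = C"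
    by (rule Liminf_const) simp
  finally show ?thesis .
qed

lemma eventually_abs_le_nat: "\<forall>\<^sub>F n in sequentially. \<bar>x\<bar> \<le> real n"
  by (rule eventually_sequentiallyI[of "nat \<lceil>\<bar>x\<bar>\<rceil>"]) linarith

lemma nn_integral_lborel_shift:
  fixes f :: "real \<Rightarrow> ennreal"
  assumes "f \<in> borel_measurable borel"
  shows "(\<integral>\<^sup>+x. f (x + y) \<partial>lborel) = (\<integral>\<^sup>+x. f x \<partial>lborel)"
  using nn_integral_real_affine[OF assms, of 1 y] by (simp add: add.commute)

lemma cmod_fourier_le: "cmod (fourier h b) \<le> (LINT x|lborel. cmod (h x))"
  unfolding fourier_def
  by (rule order_trans[OF integral_norm_bound]) (simp add: norm_mult)

lemma borel_measurable_fourier [measurable]: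
  assumes [measurable]: "h \<in> borel_measurable borel"
  shows "fourier h \<in> borel_measurable borel"
  unfolding fourier_def by measurable

section \<open>Gaussian regularisation of the inner product of two transforms\<close>

lemma std_normal_density_pos [simp]: "0 < \<phi> x"
  by (simp add: normal_density_pos)

lemma std_normal_density_le: "\<phi> x \<le> 1 / sqrt (2 * pi)"
  by (simp add: std_normal_density_def divide_right_mono)

lemma integrable_std_normal_scaled:
  assumes "d > 0"
  shows "integrable lborel (\<lambda>b. \<phi> (d * b))"
  using lborel_integrable_real_affine[of \<phi> d 0] assms
  by (simp add: integrable_normal_density)

text \<open>The characteristic function of the standard normal law is again Gaussian; rescaling by
  \<open>d\<close> turns the summation weight in \<open>b\<close> into a Gaussian of width
  \<open>d\<close> in \<open>u\<close>.\<close>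

lemma fourier_std_normal:
  assumes "d > 0"
  shows "(CLINT b|lborel. cx (\<phi> (d * b)) * iexp (b * u))
    = cx (sqrt (2 * pi) / d * \<phi> (u / d))"
proof -
  have "(CLINT x|lborel. \<phi> x *\<^sub>R iexp (u / d * x)) = char std_normal_distribution (u / d)"
    unfolding char_def by (subst integral_density) auto
  also have "\<dots> = exp (- ((u/d)\<^sup>2) / 2)"
    by (simp only: char_std_normal_distribution)
  finally have 1: "(CLINT x|lborel. \<phi> x *\<^sub>R iexp (u / d * x)) = exp (- ((u/d)\<^sup>2) / 2)" .
  have "(CLINT x|lborel. \<phi> x *\<^sub>R iexp (u / d * x))
      = \<bar>d\<bar> *\<^sub>R (CLINT b|lborel. \<phi> (0 + d * b) *\<^sub>R iexp (u / d * (0 + d * b)))"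
    using assms by (intro lborel_integral_real_affine) auto
  then show ?thesis
    using assms unfolding 1
    by (simp add: scaleR_conv_of_real std_normal_density_def field_simps)
qed

lemma integrable_pair_bounded_weight:
  assumes h: "integrable lborel h" and k: "integrable lborel k"
    and W[measurable]: "W \<in> borel_measurable (lborel \<Otimes>\<^sub>M lborel)" and bW: "\<And>z. \<bar>W z\<bar> \<le> C"
  shows "integrable (lborel \<Otimes>\<^sub>M lborel) (\<lambda>z. cx (W z) * (h (fst z :: real) * cnj (k (snd z :: real))))"
proof -
  note [measurable] = borel_measurable_integrable[OF h] borel_measurable_integrable[OF k]
  have "integrable (lborel \<Otimes>\<^sub>M lborel) (\<lambda>z. h (fst z) * cnj (k (snd z)))"
  proof (rule lborel_pair.Fubini_integrable)
    show "(\<lambda>z. h (fst z) * cnj (k (snd z))) \<in> borel_measurable (lborel \<Otimes>\<^sub>M lborel)"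
      by measurable
  qed (use h k in \<open>auto simp: norm_mult\<close>)
  then have "integrable (lborel \<Otimes>\<^sub>M lborel) (\<lambda>z. C *\<^sub>R (h (fst z) * cnj (k (snd z))))"
    by (rule integrable_scaleR_right)
  then show ?thesis
  proof (rule Bochner_Integration.integrable_bound)
    show "(\<lambda>z. cx (W z) * (h (fst z) * cnj (k (snd z)))) \<in> borel_measurable (lborel \<Otimes>\<^sub>M lborel)"
      by measurable
    have "\<bar>W z\<bar> \<le> \<bar>C\<bar>" for z using bW[of z] by linarith
    then show "AE z in lborel \<Otimes>\<^sub>M lborel. norm (cx (W z) * (h (fst z) * cnj (k (snd z))))
        \<le> norm (C *\<^sub>R (h (fst z) * cnj (k (snd z))))"
      by (auto simp: norm_mult intro!: mult_right_mono)
  qed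
qed

text \<open>The Gaussian weight makes the triple integral over \<open>b\<close> and the two space
  variables absolutely convergent, so Fubini allows the \<open>b\<close>-integral to be evaluated
  inside.\<close>

lemma fourier_gauss_product:
  assumes [simp]: "integrable lborel h" "integrable lborel k" and d: "d > 0"
  shows "(CLINT b|lborel. cx (\<phi> (d * b)) * (fourier h b * cnj (fourier k b)))
    = (CLINT z|(lborel \<Otimes>\<^sub>M lborel).
        cx (sqrt (2 * pi) / d * \<phi> ((fst z - snd z) / d)) * (h (fst z) * cnj (k (snd z))))"
proof -
  note [measurable] = borel_measurable_integrable[OF assms(1)] borel_measurable_integrable[OF assms(2)]
  let ?P = "lborel \<Otimes>\<^sub>M lborel :: (real \<times> real) measure"
  interpret P: sigma_finite_measure ?P
    by (metis lborel_prod sigma_finite_lborel)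
  interpret pair_sigma_finite ?P lborel ..
  have hk: "integrable ?P (\<lambda>z. h (fst z) * cnj (k (snd z)))"
    using integrable_pair_bounded_weight[OF assms(1,2), of "\<lambda>_. 1" 1] by simp
  let ?F = "\<lambda>z b. cx (\<phi> (d * b)) * (iexp (b * (fst z - snd z)) * (h (fst z) * cnj (k (snd z))))"
  have F: "integrable (?P \<Otimes>\<^sub>M lborel) (case_prod ?F)"
  proof (rule Fubini_integrable)
    show "case_prod ?F \<in> borel_measurable (?P \<Otimes>\<^sub>M lborel)"
      by measurable
    have "(\<integral>b. norm (?F z b) \<partial>lborel) = (\<integral>b. \<phi> (d*b) \<partial>lborel) * norm (h (fst z) * cnj (k (snd z)))" for z
      by (simp add: norm_mult less_imp_le)
    then show "integrable ?P (\<lambda>z. \<integral>b. norm (case_prod ?F (z, b)) \<partial>lborel)"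
      using hk by simp
    show "AE z in ?P. integrable lborel (\<lambda>b. case_prod ?F (z, b))"
    proof (rule AE_I2)
      fix z
      show "integrable lborel (\<lambda>b. case_prod ?F (z, b))"
        by (rule Bochner_Integration.integrable_bound[OF integrable_mult_left[OF integrable_std_normal_scaled[OF d], of "cmod (h (fst z) * cnj (k (snd z)))"]])
          (auto simp: norm_mult less_imp_le)
    qed
  qed
  have prod: "fourier h b * cnj (fourier k b) = (\<integral>z. iexp (b * (fst z - snd z)) * (h (fst z) * cnj (k (snd z))) \<partial>?P)" for b
  proof -
    have "integrable ?P (\<lambda>z. iexp (b * (fst z - snd z)) * (h (fst z) * cnj (k (snd z))))"
      by (rule Bochner_Integration.integrable_bound[OF hk]) (auto simp: norm_mult)
    then have "(\<integral>z. iexp (b * (fst z - snd z)) * (h (fst z) * cnj (k (snd z))) \<partial>?P)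
      = (\<integral>x. \<integral>y. iexp (b * (x - y)) * (h x * cnj (k y)) \<partial>lborel \<partial>lborel)"
      by (subst lborel_pair.integral_fst'[symmetric]) auto
    also have "\<dots> = (\<integral>x. \<integral>y. (iexp (b * x) * h x) * cnj (iexp (b * y) * k y) \<partial>lborel \<partial>lborel)"
      by (intro Bochner_Integration.integral_cong) (auto simp: exp_cnj exp_diff exp_minus ring_distribs divide_simps)
    also have "\<dots> = fourier h b * cnj (fourier k b)"
      by (simp add: fourier_def del: complex_cnj_mult)
    finally show ?thesis by simp
  qed
  have "(CLINT b|lborel. cx (\<phi> (d * b)) * (fourier h b * cnj (fourier k b)))
     = (\<integral>b. \<integral>z. ?F z b \<partial>?P \<partial>lborel)"
    unfolding prod by simp
  also have "\<dots> = (\<integral>z. \<integral>b. ?F z b \<partial>lborel \<partial>?P)"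
    by (rule Fubini_integral[OF F])
  also have "\<dots> = (\<integral>z. (\<integral>b. cx (\<phi> (d * b)) * iexp (b * (fst z - snd z)) \<partial>lborel)
        * (h (fst z) * cnj (k (snd z))) \<partial>?P)"
    by (simp add: mult.assoc flip: integral_mult_left_zero)
  finally show ?thesis
    unfolding fourier_std_normal[OF d] .
qed

lemma ennreal_norm_integral_le:
  fixes f :: "'a \<Rightarrow> 'b :: {banach, second_countable_topology}"
  shows "ennreal (norm (integral\<^sup>L M f)) \<le> (\<integral>\<^sup>+x. ennreal (norm (f x)) \<partial>M)"
  by (cases "integrable M f") (auto simp: not_integrable_integral_eq intro: integral_norm_bound_ennreal)

lemma integrable_gauss_fourier:
  assumes h: "integrable lborel h" and k: "integrable lborel k" and d: "d > 0"
  shows "integrable lborel (\<lambda>b. cx (\<phi> (d * b)) * (fourier h b * cnj (fourier k b)))"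
proof -
  note [measurable] = borel_measurable_integrable[OF h] borel_measurable_integrable[OF k]
  let ?C = "(LINT x|lborel. cmod (h x)) * (LINT x|lborel. cmod (k x))"
  show ?thesis
  proof (rule Bochner_Integration.integrable_bound[OF integrable_mult_left[OF integrable_std_normal_scaled[OF d], of "?C"]])
    show "AE b in lborel. norm (cx (\<phi> (d * b)) * (fourier h b * cnj (fourier k b)))
       \<le> norm (\<phi> (d * b) * ?C)"
      by (auto simp: norm_mult abs_mult less_imp_le intro!: mult_left_mono mult_mono cmod_fourier_le)
  qed measurable
qed

text \<open>Substituting \<open>y = x - d * v\<close> exhibits the Gaussian kernel as an average
  over shifts of size \<open>d\<close>, which disappear as \<open>d\<close> tends to 0.\<close>

lemma gauss_fourier_eq:
  assumes h: "integrable lborel h" and k: "integrable lborel k" and d: "d > 0"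
  shows "(CLINT b|lborel. cx (\<phi> (d * b)) * (fourier h b * cnj (fourier k b)))
    = cx (sqrt (2 * pi)) * (CLINT x|lborel. h x * (CLINT v|lborel. cx (\<phi> v) * cnj (k (x - d * v))))"
proof -
  note [measurable] = borel_measurable_integrable[OF h] borel_measurable_integrable[OF k]
  let ?G = "\<lambda>z. cx (sqrt (2 * pi) / d * \<phi> ((fst z - snd z) / d)) * (h (fst z) * cnj (k (snd z)))"
  have G: "integrable (lborel \<Otimes>\<^sub>M lborel) ?G"
  proof (rule integrable_pair_bounded_weight[OF h k])
    show "\<bar>sqrt (2 * pi) / d * \<phi> ((fst z - snd z) / d)\<bar> \<le> sqrt (2 * pi) / d * (1 / sqrt (2 * pi))" for z
      unfolding abs_mult using d
      by (intro mult_mono) (auto simp del: real_sqrt_mult intro: std_normal_density_le simp: less_imp_le)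
  qed measurable
  have "(CLINT b|lborel. cx (\<phi> (d * b)) * (fourier h b * cnj (fourier k b)))
      = (CLINT z|(lborel \<Otimes>\<^sub>M lborel). ?G z)"
    by (rule fourier_gauss_product[OF h k d])
  also have "\<dots> = (CLINT x|lborel. (CLINT y|lborel. ?G (x, y)))"
    by (rule lborel_pair.integral_fst'[OF G, symmetric])
  also have "\<dots> = (CLINT x|lborel. cx (sqrt (2 * pi)) * (h x * (CLINT v|lborel. cx (\<phi> v) * cnj (k (x - d * v)))))"
  proof (rule Bochner_Integration.integral_cong[OF refl])
    fix x
    have "(CLINT y|lborel. ?G (x, y)) = \<bar>-d\<bar> *\<^sub>R (CLINT v|lborel. ?G (x, x + (-d) * v))"
      using d by (intro lborel_integral_real_affine) auto
    also have "(CLINT v|lborel. ?G (x, x + (-d) * v))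
       = (CLINT v|lborel. (cx (sqrt (2 * pi)) * h x / d) * (cx (\<phi> v) * cnj (k (x - d * v))))"
      using d by (intro Bochner_Integration.integral_cong) auto
    finally show "(CLINT y|lborel. ?G (x, y)) = cx (sqrt (2 * pi)) * (h x * (CLINT v|lborel. cx (\<phi> v) * cnj (k (x - d * v))))"
      using d by (simp add: scaleR_conv_of_real)
  qed
  finally show ?thesis by simp
qed

text \<open>The shifts are put on \<open>k\<close>, whose continuity gives the pointwise limit and
  whose bound gives domination; \<open>h\<close> stays merely integrable.\<close>

lemma gauss_fourier_tendsto:
  assumes h: "integrable lborel h" and k: "integrable lborel k"
    and cont: "continuous_on UNIV k" and bd: "\<And>x. cmod (k x) \<le> R"
  shows "(\<lambda>n. CLINT b|lborel. cx (\<phi> (1 / Suc n * b)) * (fourier h b * cnj (fourier k b)))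
     \<longlonglongrightarrow> cx (sqrt (2 * pi)) * (CLINT x|lborel. h x * cnj (k x))"
proof -
  note [measurable] = borel_measurable_integrable[OF h] borel_measurable_integrable[OF k]
  have R: "R \<ge> 0" using bd[of 0] norm_ge_zero[of "k 0"] by linarith
  define I where "I d x = (CLINT v|lborel. cx (\<phi> v) * cnj (k (x - d * v)))" for d x :: real
  have [measurable]: "I d \<in> borel_measurable borel" for d
    unfolding I_def by measurable
  have nd: "integrable lborel (\<lambda>v. \<phi> v * R)"
    by auto
  have I_le: "cmod (I d x) \<le> R" for d x
  proof -
    have "cmod (I d x) \<le> (LINT v|lborel. norm (cx (\<phi> v) * cnj (k (x - d * v))))"
      unfolding I_def by (rule integral_norm_bound)
    also have "\<dots> \<le> (LINT v|lborel. \<phi> v * R)"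
    proof (rule integral_mono_AE'[OF nd])
      show "AE v in lborel. norm (cx (\<phi> v) * cnj (k (x - d * v))) \<le> \<phi> v * R"
        using bd by (auto simp: norm_mult less_imp_le intro!: mult_left_mono)
    qed (use R in \<open>auto simp: less_imp_le\<close>)
    also have "\<dots> = R" by simp
    finally show ?thesis .
  qed
  have I_lim: "(\<lambda>n. I (1 / Suc n) x) \<longlonglongrightarrow> cnj (k x)" for x
  proof -
    have "(\<lambda>n. I (1 / Suc n) x) \<longlonglongrightarrow> (CLINT v|lborel. cx (\<phi> v) * cnj (k x))"
      unfolding I_def
    proof (rule integral_dominated_convergence[OF _ _ nd])
      show "AE v in lborel. (\<lambda>n. cx (\<phi> v) * cnj (k (x - 1 / Suc n * v)))
         \<longlonglongrightarrow> cx (\<phi> v) * cnj (k x)"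
      proof (intro AE_I2 tendsto_intros)
        fix v
        have "(\<lambda>n. x - 1 / Suc n * v) \<longlonglongrightarrow> x - 0 * v"
          by (intro tendsto_intros LIMSEQ_inverse_real_of_nat[unfolded inverse_eq_divide])
        then show "(\<lambda>n. k (x - 1 / Suc n * v)) \<longlonglongrightarrow> k x"
          using cont by (auto intro!: isCont_tendsto_compose[of x k] simp: continuous_on_eq_continuous_at)
      qed
      show "AE v in lborel. norm (cx (\<phi> v) * cnj (k (x - 1 / Suc n * v))) \<le> \<phi> v * R" for n
        using bd by (auto simp: norm_mult less_imp_le intro!: mult_left_mono)
    qed measurable
    moreover have "(CLINT v|lborel. cx (\<phi> v) * cnj (k x)) = cnj (k x)"
      using integral_normal_density[of 1 0] by (simp del: integral_normal_density)
    ultimately show ?thesis by simp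
  qed
  have "(\<lambda>n. CLINT x|lborel. h x * I (1 / Suc n) x) \<longlonglongrightarrow> (CLINT x|lborel. h x * cnj (k x))"
  proof (rule integral_dominated_convergence)
    show "integrable lborel (\<lambda>x. cmod (h x) * R)" using h by auto
    show "AE x in lborel. norm (h x * I (1 / Suc n) x) \<le> cmod (h x) * R" for n
      using I_le by (auto simp: norm_mult intro!: mult_left_mono)
    show "AE x in lborel. (\<lambda>n. h x * I (1 / Suc n) x) \<longlonglongrightarrow> h x * cnj (k x)"
      by (intro AE_I2 tendsto_intros I_lim)
  qed measurable
  then have "(\<lambda>n. cx (sqrt (2 * pi)) * (CLINT x|lborel. h x * I (1 / Suc n) x))
      \<longlonglongrightarrow> cx (sqrt (2 * pi)) * (CLINT x|lborel. h x * cnj (k x))"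
    by (intro tendsto_intros)
  moreover have "(CLINT b|lborel. cx (\<phi> (1 / Suc n * b)) * (fourier h b * cnj (fourier k b)))
      = cx (sqrt (2 * pi)) * (CLINT x|lborel. h x * I (1 / Suc n) x)" for n
    unfolding I_def by (rule gauss_fourier_eq[OF h k]) simp
  ultimately show ?thesis by (simp only:)
qed

text \<open>With \<open>k = h\<close>, the inequality 2 a b \<le> a^2 + b^2 bounds the averaged
  product by the mean of two copies of the squared L2 norm, one of them shifted. Extended
  nonnegative integrals let that norm be infinite.\<close>

lemma gauss_fourier_upper:
  assumes h: "integrable lborel h" and d: "d > 0"
  shows "(\<integral>\<^sup>+b. ennreal (\<phi> (d * b) * (cmod (fourier h b))\<^sup>2) \<partial>lborel)
     \<le> ennreal (sqrt (2 * pi)) * (\<integral>\<^sup>+x. ennreal ((cmod (h x))\<^sup>2) \<partial>lborel)"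
proof -
  note [measurable] = borel_measurable_integrable[OF h]
  let ?H = "\<lambda>x. ennreal ((cmod (h x))\<^sup>2)" and ?w = "\<lambda>v. ennreal (\<phi> v)"
  let ?N = "\<integral>\<^sup>+x. ?H x \<partial>lborel"
  let ?F = "\<lambda>x v. h x * (cx (\<phi> v) * cnj (h (x - d * v)))"
  have w1: "(\<integral>\<^sup>+v. ?w v \<partial>lborel) = 1"
    by (subst nn_integral_eq_integral) auto
  have sq: "cx (\<phi> (d * b)) * (fourier h b * cnj (fourier h b))
      = cx (\<phi> (d * b) * (cmod (fourier h b))\<^sup>2)" for b
    by (simp only: of_real_mult complex_norm_square)
  have int: "integrable lborel (\<lambda>b. \<phi> (d * b) * (cmod (fourier h b))\<^sup>2)"
    using integrable_gauss_fourier[OF h h d] unfolding sq complex_of_real_integrable_eq .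
  have "ennreal (\<integral>b. \<phi> (d * b) * (cmod (fourier h b))\<^sup>2 \<partial>lborel)
     = ennreal (cmod (CLINT b|lborel. cx (\<phi> (d * b) * (cmod (fourier h b))\<^sup>2)))"
    by (simp add: integral_complex_of_real less_imp_le del: of_real_mult of_real_power)
  also have "\<dots> = ennreal (sqrt (2 * pi)) * ennreal (cmod (\<integral>x. \<integral>v. ?F x v \<partial>lborel \<partial>lborel))"
    unfolding sq[symmetric] gauss_fourier_eq[OF h h d] norm_mult
    by (subst ennreal_mult[symmetric]) auto
  also have "ennreal (cmod (\<integral>x. \<integral>v. ?F x v \<partial>lborel \<partial>lborel)) \<le> (\<integral>\<^sup>+x. \<integral>\<^sup>+v. ennreal (cmod (?F x v)) \<partial>lborel \<partial>lborel)"
    by (rule order_trans[OF ennreal_norm_integral_le]) (intro nn_integral_mono ennreal_norm_integral_le)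
  also have "\<dots> \<le> (\<integral>\<^sup>+x. \<integral>\<^sup>+v. (?H x * ?w v + ?H (x - d * v) * ?w v) / 2 \<partial>lborel \<partial>lborel)"
  proof (intro nn_integral_mono)
    fix x v
    let ?a = "cmod (h x)" and ?b = "cmod (h (x - d * v))" and ?f = "\<phi> v"
    have "2 * (a * b) \<le> a\<^sup>2 + b\<^sup>2" for a b :: real
      using zero_le_power2[of "a - b"] by (simp add: power2_diff)
    from mult_left_mono[OF this[of ?a ?b] less_imp_le[OF std_normal_density_pos[of v]]]
    have "ennreal (?a * (?f * ?b)) \<le> ennreal ((?a\<^sup>2 * ?f + ?b\<^sup>2 * ?f) / 2)"
      by (intro ennreal_leI) (simp add: algebra_simps add_divide_distrib)
    also have "\<dots> = ennreal (?a\<^sup>2 * ?f + ?b\<^sup>2 * ?f) / 2"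
      by (subst divide_ennreal[symmetric]) (auto simp: less_imp_le)
    finally show "ennreal (cmod (?F x v)) \<le> (?H x * ?w v + ?H (x - d * v) * ?w v) / 2"
      by (simp add: norm_mult ennreal_mult' ennreal_plus less_imp_le)
  qed
  also have "\<dots> = ((\<integral>\<^sup>+x. \<integral>\<^sup>+v. ?H x * ?w v \<partial>lborel \<partial>lborel) + (\<integral>\<^sup>+x. \<integral>\<^sup>+v. ?H (x - d * v) * ?w v \<partial>lborel \<partial>lborel)) / 2"
    by (simp add: nn_integral_divide nn_integral_add)
  also have "(\<integral>\<^sup>+x. \<integral>\<^sup>+v. ?H x * ?w v \<partial>lborel \<partial>lborel) = ?N"
    by (simp add: nn_integral_cmult w1)
  also have "(\<integral>\<^sup>+x. \<integral>\<^sup>+v. ?H (x - d * v) * ?w v \<partial>lborel \<partial>lborel) = (\<integral>\<^sup>+v. \<integral>\<^sup>+x. ?H (x - d * v) * ?w v \<partial>lborel \<partial>lborel)"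
    by (rule lborel_pair.Fubini'[symmetric]) measurable
  also have "\<dots> = (\<integral>\<^sup>+v. ?N * ?w v \<partial>lborel)"
  proof (rule nn_integral_cong)
    show "(\<integral>\<^sup>+x. ?H (x - d * v) * ?w v \<partial>lborel) = ?N * ?w v" for v
      using nn_integral_lborel_shift[of ?H "- (d * v)"] by (simp add: nn_integral_multc)
  qed
  also have "\<dots> = ?N"
    by (simp add: nn_integral_cmult w1)
  also have "(?N + ?N) / 2 = ?N"
    by (subst mult_2_right[symmetric], subst ennreal_mult_divide_eq) auto
  finally show ?thesis
    by (subst nn_integral_eq_integral[OF int]) (auto simp: less_imp_le mult_left_mono)
qed

text \<open>As \<open>d\<close> tends to 0 the weight \<open>\<phi> (d * b)\<close> tends to 1 /
  sqrt (2 pi), and Fatou applies; this factor and the one of the regularised bound combine to 2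
  pi.\<close>

lemma plancherel_upper:
  assumes h: "integrable lborel h"
  shows "(\<integral>\<^sup>+b. ennreal ((cmod (fourier h b))\<^sup>2) \<partial>lborel) \<le> ennreal (2 * pi) * (\<integral>\<^sup>+x. ennreal ((cmod (h x))\<^sup>2) \<partial>lborel)"
proof -
  note [measurable] = borel_measurable_integrable[OF h]
  let ?N = "\<integral>\<^sup>+x. ennreal ((cmod (h x))\<^sup>2) \<partial>lborel"
  let ?s = "sqrt (2 * pi)"
  have lim: "(\<lambda>n. ennreal (\<phi> (1 / Suc n * b) * (cmod (fourier h b))\<^sup>2))
      \<longlonglongrightarrow> ennreal (1 / ?s * (cmod (fourier h b))\<^sup>2)" for b
  proof -
    have "(\<lambda>n. 1 / Suc n * b) \<longlonglongrightarrow> 0 * b"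
      by (intro tendsto_intros LIMSEQ_inverse_real_of_nat[unfolded inverse_eq_divide])
    then have "(\<lambda>n. \<phi> (1 / Suc n * b)) \<longlonglongrightarrow> 1 / ?s * exp (- 0\<^sup>2 / 2)"
      unfolding std_normal_density_def by (intro tendsto_intros) auto
    then show ?thesis
      by (intro tendsto_ennrealI tendsto_intros) auto
  qed
  have "(\<integral>\<^sup>+b. ennreal ((cmod (fourier h b))\<^sup>2) \<partial>lborel)
      = (\<integral>\<^sup>+b. ennreal ?s * ennreal (1 / ?s * (cmod (fourier h b))\<^sup>2) \<partial>lborel)"
    by (intro nn_integral_cong) (simp flip: ennreal_mult')
  also have "\<dots> = ennreal ?s * (\<integral>\<^sup>+b. ennreal (1 / ?s * (cmod (fourier h b))\<^sup>2) \<partial>lborel)"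
    by (rule nn_integral_cmult) measurable
  also have "\<dots> \<le> ennreal ?s * (ennreal ?s * ?N)"
    by (intro mult_left_mono nn_integral_le_tendsto[OF _ AE_I2[OF lim]] gauss_fourier_upper[OF h]) auto
  also have "\<dots> = ennreal (2 * pi) * ?N"
    by (subst mult.assoc[symmetric], subst ennreal_mult[symmetric]) auto
  finally show ?thesis .
qed

text \<open>Expanding |a - c|^2 \<ge> 0 for the transforms a and c of \<open>h\<close> and
  \<open>k\<close> gives 2 Re (a cnj c) - |c|^2 \<le> |a|^2, and the regularised inner products
  compute the left side in the limit. A good choice of \<open>k\<close> then yields the lower half
  of Plancherel's identity.\<close>

lemma plancherel_test:
  assumes h: "integrable lborel h" and fh: "integrable lborel (\<lambda>b. (cmod (fourier h b))\<^sup>2)"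
    and k: "integrable lborel k" and cont: "continuous_on UNIV k" and bd: "\<And>x. cmod (k x) \<le> R"
  shows "2 * pi * (2 * Re (CLINT x|lborel. h x * cnj (k x)) - Re (CLINT x|lborel. k x * cnj (k x)))
    \<le> (LINT b|lborel. (cmod (fourier h b))\<^sup>2)"
proof -
  note [measurable] = borel_measurable_integrable[OF h] borel_measurable_integrable[OF k]
  let ?s = "sqrt (2 * pi)"
  define E where "E h k n = (CLINT b|lborel. cx (\<phi> (1 / Suc n * b)) * (fourier h b * cnj (fourier k b)))"
    for h k and n :: nat
  let ?D = "LINT b|lborel. (cmod (fourier h b))\<^sup>2"
  have le: "2 * Re (E h k n) - Re (E k k n) \<le> 1 / ?s * ?D" for n
  proof -
    let ?w = "\<lambda>b. \<phi> (1 / Suc n * b)"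
    have i1: "integrable lborel (\<lambda>b. cx (?w b) * (fourier h b * cnj (fourier k b)))"
      and i2: "integrable lborel (\<lambda>b. cx (?w b) * (fourier k b * cnj (fourier k b)))"
      by (intro integrable_gauss_fourier h k; simp)+
    have "2 * Re (E h k n) - Re (E k k n) = (LINT b|lborel. 2 * Re (cx (?w b) * (fourier h b * cnj (fourier k b)))
        - Re (cx (?w b) * (fourier k b * cnj (fourier k b))))"
      unfolding E_def using i1 i2
      by (subst Bochner_Integration.integral_diff) (auto simp only: integral_Re integrable_Re integral_mult_right_zero integrable_mult_right)
    also have "\<dots> \<le> (LINT b|lborel. 1 / ?s * (cmod (fourier h b))\<^sup>2)"
    proof (rule integral_mono_AE)
      show "AE b in lborel. 2 * Re (cx (?w b) * (fourier h b * cnj (fourier k b)))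
        - Re (cx (?w b) * (fourier k b * cnj (fourier k b))) \<le> 1 / ?s * (cmod (fourier h b))\<^sup>2"
      proof (rule AE_I2)
        fix b
        let ?a = "fourier h b" and ?c = "fourier k b"
        have "0 \<le> (cmod (?a - ?c))\<^sup>2" by simp
        also have "(cmod (?a - ?c))\<^sup>2 = (cmod ?a)\<^sup>2 - (2 * Re (?a * cnj ?c) - Re (?c * cnj ?c))"
          unfolding cmod_power2 by (simp add: power2_eq_square algebra_simps)
        finally have "2 * Re (?a * cnj ?c) - Re (?c * cnj ?c) \<le> (cmod ?a)\<^sup>2" by simp
        then have "?w b * (2 * Re (?a * cnj ?c) - Re (?c * cnj ?c)) \<le> ?w b * (cmod ?a)\<^sup>2"
          by (intro mult_left_mono) (auto simp: less_imp_le)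
        also have "\<dots> \<le> 1 / ?s * (cmod ?a)\<^sup>2"
          by (intro mult_right_mono std_normal_density_le) auto
        finally show "2 * Re (cx (?w b) * (?a * cnj ?c)) - Re (cx (?w b) * (?c * cnj ?c))
            \<le> 1 / ?s * (cmod ?a)\<^sup>2"
          by (simp add: algebra_simps)
      qed
    qed (use i1 i2 fh in \<open>auto simp only: intro!: Bochner_Integration.integrable_diff integrable_mult_right integrable_Re\<close>)
    also have "\<dots> = 1 / ?s * ?D" by simp
    finally show ?thesis .
  qed
  have "(\<lambda>n. 2 * Re (E h k n) - Re (E k k n)) \<longlonglongrightarrow>
      2 * Re (?s * (CLINT x|lborel. h x * cnj (k x))) - Re (?s * (CLINT x|lborel. k x * cnj (k x)))"
    unfolding E_def
    by (intro tendsto_intros gauss_fourier_tendsto[OF _ k cont bd] h k)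
  from LIMSEQ_le_const2[OF this] le
  have "2 * Re (?s * (CLINT x|lborel. h x * cnj (k x))) - Re (?s * (CLINT x|lborel. k x * cnj (k x))) \<le> 1 / ?s * ?D"
    by blast
  then have "?s * (2 * Re (?s * (CLINT x|lborel. h x * cnj (k x))) - Re (?s * (CLINT x|lborel. k x * cnj (k x)))) \<le> ?s * (1 / ?s * ?D)"
    by (intro mult_left_mono) auto
  moreover have "?s * (2 * Re (?s * a) - Re (?s * b)) = (?s * ?s) * (2 * Re a - Re b)" for a b
    by (simp add: algebra_simps del: real_sqrt_mult_self)
  ultimately show ?thesis
    by (simp only: real_sqrt_mult_self) simp
qed

section \<open>Lower Plancherel bound from continuous truncations\<close>

lemma continuous_approx:
  fixes h :: "real \<Rightarrow> complex"
  assumes "h \<in> borel_measurable borel"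
  obtains g where "\<And>n::nat. continuous_on UNIV (g n)" "AE x in lborel. (\<lambda>n. g n x) \<longlonglongrightarrow> h x"
proof -
  have "h \<in> borel_measurable lebesgue"
    using assms by (intro measurable_completion) simp
  then have "h measurable_on UNIV"
    by (rule lebesgue_measurable_imp_measurable_on) auto
  then obtain N g where N: "negligible N" and g: "\<And>n::nat. continuous_on UNIV (g n)"
    "\<And>x. x \<notin> N \<Longrightarrow> (\<lambda>n. g n x) \<longlonglongrightarrow> h x"
    unfolding measurable_on_def by auto
  have "AE x in lebesgue. (\<lambda>n. g n x) \<longlonglongrightarrow> h x"
    using N g(2) by (intro AE_I'[of N]) (auto simp: negligible_iff_null_sets)
  then have "AE x in lborel. (\<lambda>n. g n x) \<longlonglongrightarrow> h x"
    by (simp add: AE_completion_iff)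
  with g that show ?thesis by blast
qed

text \<open>Cuts the modulus off at \<open>R\<close> and multiplies by a trapezoid equal to 1 for
  |x| \<le> R and to 0 for |x| \<ge> R + 1. Both operations are continuous, so continuous functions
  converging to \<open>h\<close> have continuous truncations converging to
  \<open>clip R h\<close>.\<close>

definition clip :: "real \<Rightarrow> (real \<Rightarrow> complex) \<Rightarrow> real \<Rightarrow> complex" where
  "clip R h x = cx (R / max R (cmod (h x)) * max 0 (min 1 (R + 1 - \<bar>x\<bar>))) * h x"

lemma clip_bound:
  assumes "R > 0"
  shows "cmod (clip R h x) \<le> R * indicator {-R-1..R+1} x"
    "\<exists>t. 0 \<le> t \<and> t \<le> 1 \<and> clip R h x = cx t * h x"
proof -
  have a: "R / max R (cmod (h x)) * cmod (h x) \<le> R" "0 \<le> R / max R (cmod (h x))" "R / max R (cmod (h x)) \<le> 1"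
    using assms by (auto simp: divide_simps max_def)
  have m: "0 \<le> max 0 (min 1 (R + 1 - \<bar>x\<bar>))" "max 0 (min 1 (R + 1 - \<bar>x\<bar>)) \<le> indicator {-R-1..R+1} x" 
    by (auto simp: indicator_def)
  have "cmod (clip R h x) = (R / max R (cmod (h x)) * cmod (h x)) * max 0 (min 1 (R + 1 - \<bar>x\<bar>))"
    using assms m unfolding clip_def norm_mult norm_of_real abs_mult by (simp add: max_def mult_ac)
  also have "\<dots> \<le> R * indicator {-R-1..R+1} x"
    using a m assms by (intro mult_mono) auto
  finally show "cmod (clip R h x) \<le> R * indicator {-R-1..R+1} x" .
  have "R / max R (cmod (h x)) * max 0 (min 1 (R + 1 - \<bar>x\<bar>)) \<le> 1 * 1"
    using a m by (intro mult_mono) auto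
  then show "\<exists>t. 0 \<le> t \<and> t \<le> 1 \<and> clip R h x = cx t * h x"
    unfolding clip_def using a m by (metis mult_nonneg_nonneg mult_1)
qed

lemma integrable_clip:
  assumes "R > 0" and [measurable]: "h \<in> borel_measurable borel"
  shows "integrable lborel (clip R h)"
proof (rule Bochner_Integration.integrable_bound)
  show "integrable lborel (\<lambda>x. R * indicator {-R-1..R+1} x)"
    by (intro integrable_mult_right integrable_real_indicator) (auto simp: emeasure_lborel_Icc_eq)
  show "clip R h \<in> borel_measurable lborel"
    unfolding clip_def by measurable
  show "AE x in lborel. norm (clip R h x) \<le> norm (R * indicator {-R-1..R+1} x)"
    using clip_bound(1)[OF assms(1), of h] by (auto intro!: order_trans[OF _ abs_ge_self])
qed

text \<open>The desired test function \<open>clip R h\<close> need not be continuous; it is reached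
  through truncations of continuous approximants. Since \<open>clip R h = t * h\<close> pointwise
  with 0 \<le> t \<le> 1, the quadratic expression of the test inequality is at least the squared
  norm of \<open>clip R h\<close>.\<close>

lemma plancherel_clip:
  assumes h: "integrable lborel h" and fh: "integrable lborel (\<lambda>b. (cmod (fourier h b))\<^sup>2)" and R: "R > 0"
  shows "2 * pi * (LINT x|lborel. (cmod (clip R h x))\<^sup>2) \<le> (LINT b|lborel. (cmod (fourier h b))\<^sup>2)"
proof -
  note [measurable] = borel_measurable_integrable[OF h]
  obtain g where g: "\<And>n::nat. continuous_on UNIV (g n)" "AE x in lborel. (\<lambda>n. g n x) \<longlonglongrightarrow> h x"
    using continuous_approx[of h] by auto
  have [measurable]: "g n \<in> borel_measurable borel" for n
    by (rule borel_measurable_continuous_onI[OF g(1)])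
  have cont: "continuous_on UNIV (clip R (g n))" for n
    unfolding clip_def using R by (intro continuous_intros g(1)) auto
  have [measurable]: "clip R h \<in> borel_measurable borel" "clip R (g n) \<in> borel_measurable borel" for n
    unfolding clip_def by measurable
  have lim: "AE x in lborel. (\<lambda>n. clip R (g n) x) \<longlonglongrightarrow> clip R h x"
    using g(2)
  proof eventually_elim
    case (elim x)
    then show ?case
      unfolding clip_def using R by (intro tendsto_intros) auto
  qed
  let ?b = "\<lambda>x. R * indicator {-R-1..R+1} x :: real"
  have le: "cmod (clip R k x) \<le> ?b x" for k x by (rule clip_bound(1)[OF R])
  have b: "?b x \<le> R" for x using R by (auto simp: indicator_def)
  have intb: "integrable lborel ?b"
    by (intro integrable_mult_right integrable_real_indicator) (auto simp: emeasure_lborel_Icc_eq)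
  have l1: "(\<lambda>n. CLINT x|lborel. h x * cnj (clip R (g n) x)) \<longlonglongrightarrow> (CLINT x|lborel. h x * cnj (clip R h x))"
  proof (rule integral_dominated_convergence)
    show "integrable lborel (\<lambda>x. cmod (h x) * R)" using h by auto
    show "AE x in lborel. norm (h x * cnj (clip R (g n) x)) \<le> cmod (h x) * R" for n
      using order_trans[OF le b] by (auto simp: norm_mult intro!: mult_left_mono)
    show "AE x in lborel. (\<lambda>n. h x * cnj (clip R (g n) x)) \<longlonglongrightarrow> h x * cnj (clip R h x)"
      using lim by eventually_elim (intro tendsto_intros)
  qed measurable
  have l2: "(\<lambda>n. CLINT x|lborel. clip R (g n) x * cnj (clip R (g n) x)) \<longlonglongrightarrow> (CLINT x|lborel. clip R h x * cnj (clip R h x))"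
  proof (rule integral_dominated_convergence)
    show "integrable lborel (\<lambda>x. ?b x * R)" using intb by (rule integrable_mult_left)
    show "AE x in lborel. norm (clip R (g n) x * cnj (clip R (g n) x)) \<le> ?b x * R" for n
    proof (rule AE_I2)
      fix x
      show "norm (clip R (g n) x * cnj (clip R (g n) x)) \<le> ?b x * R"
        unfolding norm_mult complex_mod_cnj
        by (rule mult_mono[OF le order_trans[OF le b]]) (use R in auto)
    qed
    show "AE x in lborel. (\<lambda>n. clip R (g n) x * cnj (clip R (g n) x)) \<longlonglongrightarrow> clip R h x * cnj (clip R h x)"
      using lim by eventually_elim (intro tendsto_intros)
  qed measurable
  have "2 * pi * (2 * Re (CLINT x|lborel. h x * cnj (clip R h x)) - Re (CLINT x|lborel. clip R h x * cnj (clip R h x)))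
    \<le> (LINT b|lborel. (cmod (fourier h b))\<^sup>2)"
    by (rule LIMSEQ_le_const2[OF tendsto_mult[OF tendsto_const tendsto_diff[OF tendsto_mult[OF tendsto_const tendsto_Re[OF l1]] tendsto_Re[OF l2]]]])
       (intro exI allI impI plancherel_test[OF h fh _ cont order_trans[OF le b]] integrable_clip R; measurable)
  moreover have sq: "(cmod z)\<^sup>2 = Re (z * cnj z)" for z
    by (simp only: complex_norm_square[symmetric] Re_complex_of_real)
  have i1: "integrable lborel (\<lambda>x. h x * cnj (clip R h x))"
    by (rule Bochner_Integration.integrable_bound[where f="\<lambda>x. cmod (h x) * R"])
      (use h order_trans[OF le b] R in \<open>auto simp: norm_mult intro!: mult_left_mono\<close>)
  have i2: "integrable lborel (\<lambda>x. clip R h x * cnj (clip R h x))"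
  proof (rule Bochner_Integration.integrable_bound[OF i1])
    show "AE x in lborel. norm (clip R h x * cnj (clip R h x)) \<le> norm (h x * cnj (clip R h x))"
    proof (rule AE_I2)
      fix x
      obtain t where t: "0 \<le> t" "t \<le> 1" "clip R h x = cx t * h x"
        using clip_bound(2)[OF R] by blast
      have "cmod (clip R h x) \<le> cmod (h x)"
        unfolding t(3) norm_mult using t(1,2) by (simp add: mult_left_le_one_le)
      then show "norm (clip R h x * cnj (clip R h x)) \<le> norm (h x * cnj (clip R h x))"
        unfolding norm_mult complex_mod_cnj by (intro mult_right_mono) auto
    qed
  qed measurable
  have "(LINT x|lborel. Re (clip R h x * cnj (clip R h x))) \<le> (LINT x|lborel. Re (h x * cnj (clip R h x)))"
  proof (rule integral_mono_AE)
    show "AE x in lborel. Re (clip R h x * cnj (clip R h x)) \<le> Re (h x * cnj (clip R h x))"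
    proof (rule AE_I2)
      fix x
      obtain t where t: "0 \<le> t" "t \<le> 1" "clip R h x = cx t * h x"
        using clip_bound(2)[OF R] by blast
      have "t * t * (cmod (h x))\<^sup>2 \<le> t * (cmod (h x))\<^sup>2"
        using t by (intro mult_right_mono) (auto simp: mult_left_le_one_le)
      then show "Re (clip R h x * cnj (clip R h x)) \<le> Re (h x * cnj (clip R h x))"
        unfolding t(3) cmod_power2 by (simp add: power2_eq_square algebra_simps)
    qed
  qed (use i1 i2 in \<open>auto simp only: integrable_Re\<close>)
  then have "(LINT x|lborel. (cmod (clip R h x))\<^sup>2)
     \<le> 2 * Re (CLINT x|lborel. h x * cnj (clip R h x)) - Re (CLINT x|lborel. clip R h x * cnj (clip R h x))"
    unfolding sq integral_Re[OF i1, symmetric] integral_Re[OF i2, symmetric] by linarith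
  then have "2 * pi * (LINT x|lborel. (cmod (clip R h x))\<^sup>2)
     \<le> 2 * pi * (2 * Re (CLINT x|lborel. h x * cnj (clip R h x)) - Re (CLINT x|lborel. clip R h x * cnj (clip R h x)))"
    by (intro mult_left_mono) auto
  ultimately show ?thesis by linarith
qed

theorem plancherel:
  assumes h: "integrable lborel h"
  shows "(\<integral>\<^sup>+b. ennreal ((cmod (fourier h b))\<^sup>2) \<partial>lborel) = ennreal (2 * pi) * (\<integral>\<^sup>+x. ennreal ((cmod (h x))\<^sup>2) \<partial>lborel)"
proof (rule antisym[OF plancherel_upper[OF h]])
  note [measurable] = borel_measurable_integrable[OF h]
  let ?X = "\<integral>\<^sup>+b. ennreal ((cmod (fourier h b))\<^sup>2) \<partial>lborel"
  show "ennreal (2 * pi) * (\<integral>\<^sup>+x. ennreal ((cmod (h x))\<^sup>2) \<partial>lborel) \<le> ?X"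
  proof (cases "?X = \<infinity>")
    case False
    then have fh: "integrable lborel (\<lambda>b. (cmod (fourier h b))\<^sup>2)"
      by (intro integrableI_nonneg) (auto simp: top.not_eq_extremum)
    have X: "?X = ennreal (LINT b|lborel. (cmod (fourier h b))\<^sup>2)"
      by (rule nn_integral_eq_integral[OF fh]) auto
    have [measurable]: "clip R h \<in> borel_measurable borel" for R
      unfolding clip_def by measurable
    have "ennreal (2 * pi) * (\<integral>\<^sup>+x. ennreal ((cmod (h x))\<^sup>2) \<partial>lborel)
      = (\<integral>\<^sup>+x. ennreal (2 * pi) * ennreal ((cmod (h x))\<^sup>2) \<partial>lborel)"
      by (rule nn_integral_cmult[symmetric]) measurable
    also have "\<dots> \<le> ?X"
    \<comment> \<open>\<open>Suc n\<close> keeps the truncation level positive; at each point the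
      truncation is inactive from some \<open>n\<close> on.\<close>
    proof (rule nn_integral_le_tendsto[where f="\<lambda>n x. ennreal (2 * pi * (cmod (clip (Suc n) h x))\<^sup>2)"])
      have "(\<lambda>n. ennreal (2 * pi * (cmod (clip (Suc n) h x))\<^sup>2)) \<longlonglongrightarrow> ennreal (2 * pi) * ennreal ((cmod (h x))\<^sup>2)" for x
      proof (rule tendsto_eventually)
        show "\<forall>\<^sub>F n in sequentially. ennreal (2 * pi * (cmod (clip (Suc n) h x))\<^sup>2) = ennreal (2 * pi) * ennreal ((cmod (h x))\<^sup>2)"
          using eventually_abs_le_nat[of "cmod (h x)"] eventually_abs_le_nat[of x]
        proof eventually_elim
          case (elim n)
          then have "max (real (Suc n)) (cmod (h x)) = Suc n" "max 0 (min 1 (real (Suc n) + 1 - \<bar>x\<bar>)) = 1"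
            by auto
          then have "clip (Suc n) h x = h x" unfolding clip_def by simp
          then show ?case by (simp add: ennreal_mult')
        qed
      qed
      then show "AE x in lborel. (\<lambda>n. ennreal (2 * pi * (cmod (clip (Suc n) h x))\<^sup>2)) \<longlonglongrightarrow> ennreal (2 * pi) * ennreal ((cmod (h x))\<^sup>2)"
        by simp
      fix n
      let ?R = "real (Suc n)"
      have "integrable lborel (\<lambda>x. (cmod (clip ?R h x))\<^sup>2)"
      proof (rule Bochner_Integration.integrable_bound)
        show "integrable lborel (\<lambda>x. ?R * cmod (clip ?R h x))"
          by (intro integrable_mult_right integrable_norm integrable_clip) auto
        have "cmod (clip ?R h x) \<le> ?R" for x
          using order_trans[OF clip_bound(1)[of ?R h x], of ?R] by (auto simp: indicator_def)
        then show "AE x in lborel. norm ((cmod (clip ?R h x))\<^sup>2) \<le> norm (?R * cmod (clip ?R h x))"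
          unfolding power2_eq_square by (auto simp del: of_nat_Suc intro!: mult_right_mono)
      qed measurable
      then have "(\<integral>\<^sup>+x. ennreal (2 * pi * (cmod (clip ?R h x))\<^sup>2) \<partial>lborel) = ennreal (2 * pi * (LINT x|lborel. (cmod (clip ?R h x))\<^sup>2))"
        by (subst nn_integral_eq_integral) auto
      also have "\<dots> \<le> ?X"
        unfolding X by (intro ennreal_leI plancherel_clip h fh) auto
      finally show "(\<integral>\<^sup>+x. ennreal (2 * pi * (cmod (clip ?R h x))\<^sup>2) \<partial>lborel) \<le> ?X" .
    qed measurable
    finally show ?thesis .
  qed simp
qed

section \<open>Kernel operators and their symbols on weighted spaces\<close>

text \<open>Two-sided transform with the sign exp (+ z x): on the line Re z = s it is the Fourier
  transform of exp (s x) h x, which matches the weight in \<open>wn1\<close> and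
  \<open>wn2\<close>.\<close>

definition laplace :: "(real \<Rightarrow> complex) \<Rightarrow> complex \<Rightarrow> complex" where
  "laplace h z = (CLINT x|lborel. exp (z * cx x) * h x)"

definition wn1 :: "real \<Rightarrow> (real \<Rightarrow> complex) \<Rightarrow> ennreal" where
  "wn1 s h = (\<integral>\<^sup>+x. ennreal (exp (s * x) * cmod (h x)) \<partial>lborel)"

text \<open>A squared norm, valued in \<open>ennreal\<close> so that it can be bounded before it is
  known to be finite.\<close>

definition wn2 :: "real \<Rightarrow> (real \<Rightarrow> complex) \<Rightarrow> ennreal" where
  "wn2 s h = (\<integral>\<^sup>+x. ennreal ((exp (s * x) * cmod (h x))\<^sup>2) \<partial>lborel)"

text \<open>Integrability makes the transform a pointwise integral, square-integrability makes
  Plancherel's identity finite; both refer to the same weight.\<close>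

definition L1L2 :: "real \<Rightarrow> (real \<Rightarrow> complex) set" where
  "L1L2 s = {h \<in> borel_measurable borel. wn1 s h < \<infinity> \<and> wn2 s h < \<infinity>}"

lemma L1L2_borel [measurable_dest]: "h \<in> L1L2 s \<Longrightarrow> h \<in> borel_measurable borel"
  by (simp add: L1L2_def)

lemma exp_Complex_mult: "exp (Complex s b * cx x) = cx (exp (s * x)) * iexp (b * x)"
proof -
  have "Complex s b * cx x = cx (s * x) + \<i> * cx (b * x)"
    by (simp add: complex_eq_iff)
  then show ?thesis by (simp only: exp_add exp_of_real)
qed

lemma laplace_eq_fourier: "laplace h (Complex s b) = fourier (\<lambda>x. cx (exp (s * x)) * h x) b"
  unfolding laplace_def fourier_def exp_Complex_mult by (simp only: mult_ac)

lemma L1L2_integrable_weight: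
  assumes "h \<in> L1L2 s"
  shows "integrable lborel (\<lambda>x. cx (exp (s * x)) * h x)"
  using assms unfolding L1L2_def wn1_def
  by (intro integrableI_bounded) (auto simp: norm_mult)

lemma L1L2_integrable:
  assumes "h \<in> L1L2 (Re z)"
  shows "integrable lborel (\<lambda>x. exp (z * cx x) * h x)"
  by (rule Bochner_Integration.integrable_bound[OF L1L2_integrable_weight[OF assms]])
     (use assms in \<open>auto simp: norm_mult\<close>)

lemma plancherel_laplace:
  assumes "h \<in> L1L2 s"
  shows "(\<integral>\<^sup>+b. ennreal ((cmod (laplace h (Complex s b)))\<^sup>2) \<partial>lborel) = ennreal (2 * pi) * wn2 s h"
  unfolding laplace_eq_fourier wn2_def
  by (subst plancherel[OF L1L2_integrable_weight[OF assms]]) (simp add: norm_mult)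

lemma laplace_add:
  assumes "f \<in> L1L2 s" "g \<in> L1L2 s"
  shows "laplace (\<lambda>x. f x + g x) (Complex s b) = laplace f (Complex s b) + laplace g (Complex s b)"
  using L1L2_integrable[of f "Complex s b"] L1L2_integrable[of g "Complex s b"] assms
  by (simp add: laplace_def ring_distribs)

lemma laplace_diff:
  assumes "f \<in> L1L2 s" "g \<in> L1L2 s"
  shows "laplace (\<lambda>x. f x - g x) (Complex s b) = laplace f (Complex s b) - laplace g (Complex s b)"
  using L1L2_integrable[of f "Complex s b"] L1L2_integrable[of g "Complex s b"] assms
  by (simp add: laplace_def ring_distribs)

lemma laplace_scale: "laplace (\<lambda>x. c * f x) z = c * laplace f z"
  by (simp add: laplace_def mult.left_commute[of _ c])

text \<open>A triangle inequality that stays with squared norms, from 2 a b \<le> e a^2 + b^2 / e.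
  The free parameter \<open>e\<close> is tuned when a contraction is iterated.\<close>

lemma wn2_add_weighted:
  assumes [measurable]: "f \<in> borel_measurable borel" "g \<in> borel_measurable borel" and e: "e > 0"
  shows "wn2 s (\<lambda>x. f x + g x) \<le> ennreal (1 + e) * wn2 s f + ennreal (1 + 1 / e) * wn2 s g"
proof -
  have "wn2 s (\<lambda>x. f x + g x) \<le> (\<integral>\<^sup>+x. ennreal (1 + e) * ennreal ((exp (s * x) * cmod (f x))\<^sup>2)
      + ennreal (1 + 1 / e) * ennreal ((exp (s * x) * cmod (g x))\<^sup>2) \<partial>lborel)"
    unfolding wn2_def
  proof (rule nn_integral_mono)
    fix x
    let ?a = "exp (s * x) * cmod (f x)" and ?b = "exp (s * x) * cmod (g x)"
    have "(exp (s * x) * cmod (f x + g x))\<^sup>2 \<le> (?a + ?b)\<^sup>2"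
      by (intro power_mono) (auto simp: norm_triangle_ineq simp flip: distrib_left)
    also have "\<dots> \<le> (1 + e) * ?a\<^sup>2 + (1 + 1 / e) * ?b\<^sup>2"
    proof -
      have "0 \<le> (sqrt e * ?a - ?b / sqrt e)\<^sup>2" by simp
      also have "\<dots> = e * ?a\<^sup>2 + ?b\<^sup>2 / e - 2 * (?a * ?b)"
        using e by (simp add: power2_diff power_mult_distrib power_divide)
      finally show ?thesis by (simp add: power2_sum algebra_simps)
    qed
    finally show "ennreal ((exp (s * x) * cmod (f x + g x))\<^sup>2) \<le> ennreal (1 + e) * ennreal (?a\<^sup>2) + ennreal (1 + 1 / e) * ennreal (?b\<^sup>2)"
      using e by (subst (1 2) ennreal_mult[symmetric]) (auto simp flip: ennreal_plus intro!: ennreal_leI)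
  qed
  also have "\<dots> = ennreal (1 + e) * wn2 s f + ennreal (1 + 1 / e) * wn2 s g"
    unfolding wn2_def by (subst nn_integral_add) (auto simp: nn_integral_cmult)
  finally show ?thesis .
qed

lemma wn2_scale:
  assumes [measurable]: "f \<in> borel_measurable borel"
  shows "wn2 s (\<lambda>x. c * f x) = ennreal ((cmod c)\<^sup>2) * wn2 s f"
  unfolding wn2_def
  by (subst nn_integral_cmult[symmetric]) (auto simp: norm_mult power_mult_distrib mult_ac simp flip: ennreal_mult')

lemma wn1_scale:
  assumes [measurable]: "f \<in> borel_measurable borel"
  shows "wn1 s (\<lambda>x. c * f x) = ennreal (cmod c) * wn1 s f"
  unfolding wn1_def
  by (subst nn_integral_cmult[symmetric]) (auto simp: norm_mult mult_ac simp flip: ennreal_mult')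

lemma wn1_add:
  assumes [measurable]: "f \<in> borel_measurable borel" "g \<in> borel_measurable borel"
  shows "wn1 s (\<lambda>x. f x + g x) \<le> wn1 s f + wn1 s g"
  unfolding wn1_def
  by (subst nn_integral_add[symmetric])
    (auto intro!: nn_integral_mono ennreal_leI norm_triangle_ineq simp flip: ennreal_plus distrib_left)

lemma L1L2_add: "f \<in> L1L2 s \<Longrightarrow> g \<in> L1L2 s \<Longrightarrow> (\<lambda>x. f x + g x) \<in> L1L2 s"
  unfolding L1L2_def
  by (auto simp: ennreal_mult_less_top intro!: le_less_trans[OF wn1_add] le_less_trans[OF wn2_add_weighted[of f g 1]])

lemma L1L2_scale: "f \<in> L1L2 s \<Longrightarrow> (\<lambda>x. c * f x) \<in> L1L2 s"
  by (auto simp: L1L2_def wn1_scale wn2_scale ennreal_mult_less_top)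

lemma L1L2_diff: "f \<in> L1L2 s \<Longrightarrow> g \<in> L1L2 s \<Longrightarrow> (\<lambda>x. f x - g x) \<in> L1L2 s"
  using L1L2_add[of f s "\<lambda>x. -1 * g x"] L1L2_scale[of g s "-1"] by simp

text \<open>The symbol is a function of the complex variable and not of the line, so one
  \<open>m\<close> can describe the same operator at several weights \<open>s\<close>.\<close>

definition multiplier :: "real \<Rightarrow> ((real \<Rightarrow> complex) \<Rightarrow> real \<Rightarrow> complex) \<Rightarrow> (complex \<Rightarrow> complex) \<Rightarrow> bool" where
  "multiplier s T m \<longleftrightarrow> (\<forall>h\<in>L1L2 s. T h \<in> L1L2 s \<and> (\<forall>b. laplace (T h) (Complex s b) = m (Complex s b) * laplace h (Complex s b)))"

lemma multiplierD:
  assumes "multiplier s T m" "h \<in> L1L2 s"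
  shows "T h \<in> L1L2 s" "laplace (T h) (Complex s b) = m (Complex s b) * laplace h (Complex s b)"
  using assms by (auto simp: multiplier_def)

lemma multiplier_id: "multiplier s (\<lambda>h. h) (\<lambda>z. 1)"
  by (simp add: multiplier_def)

lemma multiplier_comp:
  "multiplier s S m \<Longrightarrow> multiplier s T k \<Longrightarrow> multiplier s (\<lambda>h. S (T h)) (\<lambda>z. m z * k z)"
  by (simp add: multiplier_def)

lemma multiplier_add:
  "multiplier s S m \<Longrightarrow> multiplier s T k \<Longrightarrow> multiplier s (\<lambda>h x. S h x + T h x) (\<lambda>z. m z + k z)"
  by (simp add: multiplier_def L1L2_add laplace_add ring_distribs)

lemma multiplier_diff:
  "multiplier s S m \<Longrightarrow> multiplier s T k \<Longrightarrow> multiplier s (\<lambda>h x. S h x - T h x) (\<lambda>z. m z - k z)"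
  by (simp add: multiplier_def L1L2_diff laplace_diff ring_distribs)

lemma multiplier_scale:
  "multiplier s S m \<Longrightarrow> multiplier s (\<lambda>h x. c * S h x) (\<lambda>z. c * m z)"
  by (simp add: multiplier_def L1L2_scale laplace_scale)

text \<open>Plancherel's identity is read in one direction for \<open>f\<close> and in the other for
  \<open>h\<close>, so both halves of it are used.\<close>

lemma wn2_le_of_laplace:
  assumes f: "f \<in> L1L2 s" and h: "h \<in> L1L2 s"
    and le: "\<And>b. cmod (laplace f (Complex s b)) \<le> K * cmod (laplace h (Complex s b))"
  shows "wn2 s f \<le> ennreal (K\<^sup>2) * wn2 s h"
proof -
  note [measurable] = L1L2_borel[OF h]
  have "ennreal (2 * pi) * wn2 s f = (\<integral>\<^sup>+b. ennreal ((cmod (laplace f (Complex s b)))\<^sup>2) \<partial>lborel)"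
    using plancherel_laplace[OF f] by simp
  also have "\<dots> \<le> (\<integral>\<^sup>+b. ennreal (K\<^sup>2) * ennreal ((cmod (laplace h (Complex s b)))\<^sup>2) \<partial>lborel)"
  proof (rule nn_integral_mono)
    fix b
    have "(cmod (laplace f (Complex s b)))\<^sup>2 \<le> K\<^sup>2 * (cmod (laplace h (Complex s b)))\<^sup>2"
      unfolding power_mult_distrib[symmetric] by (intro power_mono le) simp
    then show "ennreal ((cmod (laplace f (Complex s b)))\<^sup>2) \<le> ennreal (K\<^sup>2) * ennreal ((cmod (laplace h (Complex s b)))\<^sup>2)"
      by (subst ennreal_mult[symmetric]) (auto intro!: ennreal_leI)
  qed
  also have "\<dots> = ennreal (K\<^sup>2) * (\<integral>\<^sup>+b. ennreal ((cmod (laplace h (Complex s b)))\<^sup>2) \<partial>lborel)"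
    unfolding laplace_eq_fourier by (intro nn_integral_cmult) measurable
  also have "\<dots> = ennreal (2 * pi) * (ennreal (K\<^sup>2) * wn2 s h)"
    unfolding plancherel_laplace[OF h] by (simp add: mult_ac)
  finally have "ennreal (inverse (2 * pi)) * (ennreal (2 * pi) * wn2 s f) \<le> ennreal (inverse (2 * pi)) * (ennreal (2 * pi) * (ennreal (K\<^sup>2) * wn2 s h))"
    by (rule mult_left_mono) simp
  then show ?thesis
    by (subst (asm) (1 2) mult.assoc[symmetric], subst (asm) (1 2) ennreal_mult[symmetric]) auto
qed

lemma multiplier_wn2_le:
  assumes T: "multiplier s T m" and h: "h \<in> L1L2 s" and m: "\<And>b. cmod (m (Complex s b)) \<le> K"
  shows "wn2 s (T h) \<le> ennreal (K\<^sup>2) * wn2 s h"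
  by (rule wn2_le_of_laplace[OF multiplierD(1)[OF T h] h])
     (auto simp: multiplierD(2)[OF T h] norm_mult intro!: mult_right_mono m)

section \<open>Operators averaging weighted translations\<close>

definition kop :: "'a measure \<Rightarrow> ('a \<Rightarrow> real) \<Rightarrow> ('a \<Rightarrow> real) \<Rightarrow> (real \<Rightarrow> complex) \<Rightarrow> real \<Rightarrow> complex" where
  "kop M c Y h x = (CLINT w|M. cx (c w) * h (x + Y w))"

definition akop :: "'a measure \<Rightarrow> ('a \<Rightarrow> real) \<Rightarrow> ('a \<Rightarrow> real) \<Rightarrow> (real \<Rightarrow> complex) \<Rightarrow> real \<Rightarrow> ennreal" where
  "akop M c Y h x = (\<integral>\<^sup>+w. ennreal (cmod (cx (c w) * h (x + Y w))) \<partial>M)"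

definition kmass :: "real \<Rightarrow> 'a measure \<Rightarrow> ('a \<Rightarrow> real) \<Rightarrow> ('a \<Rightarrow> real) \<Rightarrow> ennreal" where
  "kmass s M c Y = (\<integral>\<^sup>+w. ennreal (exp (- (s * Y w)) * \<bar>c w\<bar>) \<partial>M)"

definition ksymb :: "'a measure \<Rightarrow> ('a \<Rightarrow> real) \<Rightarrow> ('a \<Rightarrow> real) \<Rightarrow> complex \<Rightarrow> complex" where
  "ksymb M c Y z = (CLINT w|M. cx (c w) * exp (- z * cx (Y w)))"

lemma lborel_integral_shift:
  fixes f :: "real \<Rightarrow> complex"
  shows "(\<integral>x. f (x + y) \<partial>lborel) = (\<integral>x. f x \<partial>lborel)"
  using lborel_integral_real_affine[of 1 f y] by (simp add: add.commute)

text \<open>The kernel is any weighted family of translations indexed by a sigma-finite space. This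
  covers \<rho>, its product with the uniform law on [0,1], and the renewal measure and
  \<open>T_measure\<close>, which are not finite measures in general.\<close>

locale kernel = sigma_finite_measure M for M :: "'a measure" +
  fixes c Y :: "'a \<Rightarrow> real"
  assumes c_measurable [measurable]: "c \<in> borel_measurable M"
    and Y_measurable [measurable]: "Y \<in> borel_measurable M"
begin

lemma borel_measurable_kop [measurable]:
  assumes [measurable]: "h \<in> borel_measurable borel"
  shows "kop M c Y h \<in> borel_measurable borel"
  unfolding kop_def by measurable

lemma borel_measurable_akop [measurable]:
  assumes [measurable]: "h \<in> borel_measurable borel"
  shows "akop M c Y h \<in> borel_measurable borel"
  unfolding akop_def by measurable

lemma akop_wn1:
  assumes [measurable]: "h \<in> borel_measurable borel"
  shows "(\<integral>\<^sup>+x. ennreal (exp (s * x)) * akop M c Y h x \<partial>lborel) = kmass s M c Y * wn1 s h"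
proof -
  interpret P: pair_sigma_finite lborel M ..
  have "(\<integral>\<^sup>+x. ennreal (exp (s * x)) * akop M c Y h x \<partial>lborel)
     = (\<integral>\<^sup>+x. \<integral>\<^sup>+w. ennreal (exp (s * x) * cmod (cx (c w) * h (x + Y w))) \<partial>M \<partial>lborel)"
    unfolding akop_def by (subst nn_integral_cmult[symmetric]) (auto simp: ennreal_mult')
  also have "\<dots> = (\<integral>\<^sup>+w. \<integral>\<^sup>+x. ennreal (exp (s * x) * cmod (cx (c w) * h (x + Y w))) \<partial>lborel \<partial>M)"
    by (rule P.Fubini'[symmetric]) measurable
  also have "\<dots> = (\<integral>\<^sup>+w. ennreal (exp (- (s * Y w)) * \<bar>c w\<bar>) * wn1 s h \<partial>M)"
  proof (rule nn_integral_cong)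
    fix w
    have "(\<integral>\<^sup>+x. ennreal (exp (s * x) * cmod (cx (c w) * h (x + Y w))) \<partial>lborel)
      = (\<integral>\<^sup>+x. ennreal (exp (- (s * Y w)) * \<bar>c w\<bar>) * ennreal (exp (s * (x + Y w)) * cmod (h (x + Y w))) \<partial>lborel)"
    proof (rule nn_integral_cong)
      fix x
      have "exp (s * x) * cmod (cx (c w) * h (x + Y w)) = (exp (- (s * Y w)) * \<bar>c w\<bar>) * (exp (s * (x + Y w)) * cmod (h (x + Y w)))"
        by (simp add: norm_mult exp_minus distrib_left exp_add)
      then show "ennreal (exp (s * x) * cmod (cx (c w) * h (x + Y w)))
          = ennreal (exp (- (s * Y w)) * \<bar>c w\<bar>) * ennreal (exp (s * (x + Y w)) * cmod (h (x + Y w)))"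
        by (simp only:) (subst ennreal_mult, auto)
    qed
    also have "\<dots> = ennreal (exp (- (s * Y w)) * \<bar>c w\<bar>) * wn1 s h"
      unfolding wn1_def by (subst nn_integral_cmult) (auto simp: nn_integral_lborel_shift[of "\<lambda>x. ennreal (exp (s * x) * cmod (h x))"])
    finally show "(\<integral>\<^sup>+x. ennreal (exp (s * x) * cmod (cx (c w) * h (x + Y w))) \<partial>lborel) = ennreal (exp (- (s * Y w)) * \<bar>c w\<bar>) * wn1 s h" .
  qed
  also have "\<dots> = kmass s M c Y * wn1 s h"
    unfolding kmass_def by (rule nn_integral_multc) measurable
  finally show ?thesis .
qed

text \<open>Young's inequality for an L1 kernel acting on L2: the kernel weight is split into two
  square roots, Cauchy-Schwarz turns one of them into the total mass, and Fubini integrates the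
  other together with the square of \<open>h\<close>.\<close>

lemma akop_wn2:
  assumes [measurable]: "h \<in> borel_measurable borel"
  shows "(\<integral>\<^sup>+x. (ennreal (exp (s * x)) * akop M c Y h x)\<^sup>2 \<partial>lborel) \<le> (kmass s M c Y)\<^sup>2 * wn2 s h"
proof -
  interpret P: pair_sigma_finite lborel M ..
  let ?a = "\<lambda>w. exp (- (s * Y w)) * \<bar>c w\<bar>"
  let ?u = "\<lambda>x. exp (s * x) * cmod (h x)"
  have pt: "(ennreal (exp (s * x)) * akop M c Y h x)\<^sup>2 \<le> kmass s M c Y * (\<integral>\<^sup>+w. ennreal (?a w) * ennreal ((?u (x + Y w))\<^sup>2) \<partial>M)" for x
  proof -
    have "ennreal (exp (s * x)) * akop M c Y h x
       = (\<integral>\<^sup>+w. ennreal (exp (s * x) * cmod (cx (c w) * h (x + Y w))) \<partial>M)"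
      unfolding akop_def by (subst nn_integral_cmult[symmetric]) (auto simp: ennreal_mult')
    also have "\<dots> = (\<integral>\<^sup>+w. ennreal (sqrt (?a w)) * ennreal (sqrt (?a w) * ?u (x + Y w)) \<partial>M)"
    proof (rule nn_integral_cong)
      fix w
      have "exp (s * x) * cmod (cx (c w) * h (x + Y w)) = ?a w * ?u (x + Y w)"
        by (simp add: norm_mult exp_minus distrib_left exp_add)
      also have "\<dots> = sqrt (?a w) * (sqrt (?a w) * ?u (x + Y w))"
        by (subst mult.assoc[symmetric], subst real_sqrt_mult_self) auto
      finally show "ennreal (exp (s * x) * cmod (cx (c w) * h (x + Y w))) = ennreal (sqrt (?a w)) * ennreal (sqrt (?a w) * ?u (x + Y w))"
        by (simp only:) (subst ennreal_mult, auto)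
    qed
    finally have "(ennreal (exp (s * x)) * akop M c Y h x)\<^sup>2 = (\<integral>\<^sup>+w. ennreal (sqrt (?a w)) * ennreal (sqrt (?a w) * ?u (x + Y w)) \<partial>M)\<^sup>2"
      by simp
    also have "\<dots> \<le> (\<integral>\<^sup>+w. (ennreal (sqrt (?a w)))\<^sup>2 \<partial>M) * (\<integral>\<^sup>+w. (ennreal (sqrt (?a w) * ?u (x + Y w)))\<^sup>2 \<partial>M)"
      by (rule Cauchy_Schwarz_nn_integral) measurable
    also have "(\<integral>\<^sup>+w. (ennreal (sqrt (?a w)))\<^sup>2 \<partial>M) = kmass s M c Y"
      unfolding kmass_def by (intro nn_integral_cong) (auto simp: ennreal_power)
    also have "(\<integral>\<^sup>+w. (ennreal (sqrt (?a w) * ?u (x + Y w)))\<^sup>2 \<partial>M) = (\<integral>\<^sup>+w. ennreal (?a w) * ennreal ((?u (x + Y w))\<^sup>2) \<partial>M)"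
    proof (rule nn_integral_cong)
      fix w
      have "(sqrt (?a w) * ?u (x + Y w))\<^sup>2 = ?a w * (?u (x + Y w))\<^sup>2"
        unfolding power_mult_distrib[of "sqrt (?a w)"] by simp
      then show "(ennreal (sqrt (?a w) * ?u (x + Y w)))\<^sup>2 = ennreal (?a w) * ennreal ((?u (x + Y w))\<^sup>2)"
        by (subst ennreal_power) (auto simp only: ennreal_mult' mult_nonneg_nonneg real_sqrt_ge_zero exp_ge_zero abs_ge_zero norm_ge_zero)
    qed
    finally show ?thesis .
  qed
  have "(\<integral>\<^sup>+x. (ennreal (exp (s * x)) * akop M c Y h x)\<^sup>2 \<partial>lborel)
      \<le> (\<integral>\<^sup>+x. kmass s M c Y * (\<integral>\<^sup>+w. ennreal (?a w) * ennreal ((?u (x + Y w))\<^sup>2) \<partial>M) \<partial>lborel)"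
    by (intro nn_integral_mono pt)
  also have "\<dots> = kmass s M c Y * (\<integral>\<^sup>+x. \<integral>\<^sup>+w. ennreal (?a w) * ennreal ((?u (x + Y w))\<^sup>2) \<partial>M \<partial>lborel)"
    by (rule nn_integral_cmult) measurable
  also have "(\<integral>\<^sup>+x. \<integral>\<^sup>+w. ennreal (?a w) * ennreal ((?u (x + Y w))\<^sup>2) \<partial>M \<partial>lborel)
      = (\<integral>\<^sup>+w. \<integral>\<^sup>+x. ennreal (?a w) * ennreal ((?u (x + Y w))\<^sup>2) \<partial>lborel \<partial>M)"
    by (rule P.Fubini'[symmetric]) measurable
  also have "\<dots> = (\<integral>\<^sup>+w. ennreal (?a w) * wn2 s h \<partial>M)"
  proof (rule nn_integral_cong)
    fix w
    show "(\<integral>\<^sup>+x. ennreal (?a w) * ennreal ((?u (x + Y w))\<^sup>2) \<partial>lborel) = ennreal (?a w) * wn2 s h"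
      unfolding wn2_def by (subst nn_integral_cmult) (auto simp: nn_integral_lborel_shift[of "\<lambda>x. ennreal ((?u x)\<^sup>2)"])
  qed
  also have "\<dots> = kmass s M c Y * wn2 s h"
    unfolding kmass_def by (rule nn_integral_multc) measurable
  finally show ?thesis by (simp add: power2_eq_square mult.assoc)
qed

text \<open>The squared absolute kernel integral has a finite weighted integral, hence is finite
  almost everywhere.\<close>

lemma AE_kop_integrable:
  assumes [measurable]: "h \<in> borel_measurable borel" and m: "kmass s M c Y < \<infinity>" and "wn2 s h < \<infinity>"
  shows "AE x in lborel. integrable M (\<lambda>w. cx (c w) * h (x + Y w))"
proof -
  have "(\<integral>\<^sup>+x. (ennreal (exp (s * x)) * akop M c Y h x)\<^sup>2 \<partial>lborel) < \<infinity>"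
    using assms by (intro le_less_trans[OF akop_wn2]) (auto simp: ennreal_mult_less_top power2_eq_square)
  then have "AE x in lborel. (ennreal (exp (s * x)) * akop M c Y h x)\<^sup>2 \<noteq> \<infinity>"
    by (intro nn_integral_PInf_AE) auto
  then show ?thesis
  proof eventually_elim
    case (elim x)
    then have "akop M c Y h x \<noteq> \<infinity>"
      by (auto simp: ennreal_mult_eq_top_iff power2_eq_square)
    then show ?case
      unfolding akop_def by (intro integrableI_bounded) (auto simp: top.not_eq_extremum)
  qed
qed

lemma norm_kop_le: "ennreal (cmod (kop M c Y h x)) \<le> akop M c Y h x"
  unfolding kop_def akop_def by (rule ennreal_norm_integral_le)

lemma kop_L1L2:
  assumes m: "kmass s M c Y < \<infinity>" and h: "h \<in> L1L2 s"
  shows "kop M c Y h \<in> L1L2 s"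
proof -
  note [measurable] = L1L2_borel[OF h]
  have "wn1 s (kop M c Y h) \<le> (\<integral>\<^sup>+x. ennreal (exp (s * x)) * akop M c Y h x \<partial>lborel)"
    unfolding wn1_def by (intro nn_integral_mono) (auto simp: ennreal_mult' intro!: mult_left_mono norm_kop_le)
  moreover have "wn2 s (kop M c Y h) \<le> (\<integral>\<^sup>+x. (ennreal (exp (s * x)) * akop M c Y h x)\<^sup>2 \<partial>lborel)"
    unfolding wn2_def by (intro nn_integral_mono)
      (auto simp: ennreal_mult' simp flip: ennreal_power intro!: mult_left_mono norm_kop_le power_mono)
  moreover have "kmass s M c Y * wn1 s h < \<infinity>" "(kmass s M c Y)\<^sup>2 * wn2 s h < \<infinity>"
    using h m by (auto simp: L1L2_def ennreal_mult_less_top power2_eq_square)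
  ultimately have "wn1 s (kop M c Y h) < \<infinity>" "wn2 s (kop M c Y h) < \<infinity>"
    using akop_wn2[of h s] akop_wn1[of h s] by (simp, meson L1L2_borel h le_less_trans order_trans)
  then show ?thesis by (simp add: L1L2_def)
qed

lemma laplace_kop:
  assumes m: "kmass (Re z) M c Y < \<infinity>" and h: "h \<in> L1L2 (Re z)"
  shows "laplace (kop M c Y h) z = ksymb M c Y z * laplace h z"
proof -
  note [measurable] = L1L2_borel[OF h]
  interpret P: pair_sigma_finite lborel M ..
  let ?F = "\<lambda>x w. exp (z * cx x) * (cx (c w) * h (x + Y w))"
  have "(\<integral>\<^sup>+p. ennreal (norm (case_prod ?F p)) \<partial>(lborel \<Otimes>\<^sub>M M)) = (\<integral>\<^sup>+x. \<integral>\<^sup>+w. ennreal (norm (?F x w)) \<partial>M \<partial>lborel)"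
    by (subst nn_integral_fst[symmetric]) auto
  also have "\<dots> = (\<integral>\<^sup>+x. ennreal (exp (Re z * x)) * akop M c Y h x \<partial>lborel)"
    unfolding akop_def by (subst nn_integral_cmult[symmetric]) (auto simp: norm_mult ennreal_mult')
  also have "\<dots> < \<infinity>"
    unfolding akop_wn1[OF L1L2_borel[OF h]] using m h by (auto simp: L1L2_def ennreal_mult_less_top)
  finally have F: "integrable (lborel \<Otimes>\<^sub>M M) (case_prod ?F)"
    by (intro integrableI_bounded) auto
  have "laplace (kop M c Y h) z = (\<integral>x. \<integral>w. ?F x w \<partial>M \<partial>lborel)"
    unfolding laplace_def kop_def by simp
  also have "\<dots> = (\<integral>w. \<integral>x. ?F x w \<partial>lborel \<partial>M)"
    by (rule P.Fubini_integral[OF F, symmetric])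
  also have "\<dots> = (\<integral>w. (cx (c w) * exp (- z * cx (Y w))) * laplace h z \<partial>M)"
  proof (rule Bochner_Integration.integral_cong[OF refl])
    fix w
    have "(\<integral>x. ?F x w \<partial>lborel) = (\<integral>x. (cx (c w) * exp (- z * cx (Y w))) * (exp (z * cx (x + Y w)) * h (x + Y w)) \<partial>lborel)"
      by (intro Bochner_Integration.integral_cong) (auto simp: exp_add exp_minus ring_distribs)
    also have "\<dots> = (cx (c w) * exp (- z * cx (Y w))) * (\<integral>x. exp (z * cx (x + Y w)) * h (x + Y w) \<partial>lborel)"
      by (rule integral_mult_right_zero)
    finally show "(\<integral>x. ?F x w \<partial>lborel) = (cx (c w) * exp (- z * cx (Y w))) * laplace h z"
      unfolding laplace_def lborel_integral_shift[of "\<lambda>x. exp (z * cx x) * h x"] .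
  qed
  also have "\<dots> = ksymb M c Y z * laplace h z"
    unfolding ksymb_def by (rule integral_mult_left_zero)
  finally show ?thesis .
qed

lemma multiplier_kop:
  assumes "kmass s M c Y < \<infinity>"
  shows "multiplier s (kop M c Y) (ksymb M c Y)"
  using assms unfolding multiplier_def by (auto intro!: kop_L1L2 laplace_kop)

end

section \<open>Transfer of a bound between weights\<close>

text \<open>The iterates \<open>u N\<close> of f -> B f + H, started at 0, stay bounded at weight -g
  because \<open>B\<close> contracts there. At weight g they converge to \<open>w\<close>, whose
  transform solves the fixed point equation. The two weights are comparable on bounded windows, so
  this convergence carries the bound at -g over to \<open>w\<close>; that \<open>w\<close> has
  finite norm at -g is thus a conclusion.\<close>

lemma neumann_transfer:
  fixes t :: real
  assumes B: "multiplier g B \<beta>" "multiplier (- g) B \<beta>"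
    and \<beta>: "\<And>b. cmod (\<beta> (Complex g b)) \<le> t" "\<And>b. cmod (\<beta> (Complex (- g) b)) \<le> t"
    and t: "0 < t" "t < 1" and g: "0 < g"
    and H: "H \<in> L1L2 g" "H \<in> L1L2 (- g)" and w: "w \<in> L1L2 g"
    and eq: "\<And>b. laplace w (Complex g b) = \<beta> (Complex g b) * laplace w (Complex g b) + laplace H (Complex g b)"
  shows "wn2 (- g) w \<le> ennreal (2 / (1 - t)\<^sup>2) * wn2 (- g) H"
proof -
  define u where "u N = ((\<lambda>f x. B f x + H x) ^^ N) (\<lambda>x. 0)" for N
  have u_Suc: "u (Suc N) = (\<lambda>x. B (u N) x + H x)" for N
    by (simp add: u_def)
  have zV: "(\<lambda>x. 0) \<in> L1L2 s" for s
    by (simp add: L1L2_def wn1_def wn2_def)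
  have uV: "u N \<in> L1L2 g" "u N \<in> L1L2 (- g)" for N
    by (induction N) (auto simp: u_Suc intro!: L1L2_add H multiplierD(1)[OF B(1)] multiplierD(1)[OF B(2)] simp: zV u_def)
  note [measurable] = L1L2_borel[OF uV(1)] L1L2_borel[OF w] L1L2_borel[OF H(1)]
  have laplace_err: "laplace (\<lambda>x. w x - u N x) (Complex g b) = \<beta> (Complex g b) ^ N * laplace w (Complex g b)" for N b
  proof (induction N)
    case 0
    then show ?case by (simp add: u_def)
  next
    case (Suc N)
    have "laplace (\<lambda>x. w x - u (Suc N) x) (Complex g b)
      = laplace w (Complex g b) - (\<beta> (Complex g b) * laplace (u N) (Complex g b) + laplace H (Complex g b))"
      using uV(1)[of "Suc N"] unfolding u_Suc
      by (simp add: laplace_diff[OF w] laplace_add multiplierD[OF B(1)] uV H)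
    also have "\<dots> = \<beta> (Complex g b) * (laplace w (Complex g b) - laplace (u N) (Complex g b))"
      by (subst eq) (simp add: ring_distribs)
    also have "\<dots> = \<beta> (Complex g b) * laplace (\<lambda>x. w x - u N x) (Complex g b)"
      by (simp add: laplace_diff w uV)
    finally show ?case using Suc by simp
  qed
  have err: "wn2 g (\<lambda>x. w x - u N x) \<le> ennreal ((t ^ N)\<^sup>2) * wn2 g w" for N
    by (rule wn2_le_of_laplace[OF L1L2_diff[OF w uV(1)] w])
       (auto simp: laplace_err norm_mult norm_power intro!: mult_right_mono power_mono \<beta>)
  let ?X = "wn2 (- g) H"
  have combine: "ennreal p * (ennreal q * (ennreal r * X)) + ennreal d * X = ennreal (p * q * r + d) * X"
    if "p \<ge> 0" "q \<ge> 0" "r \<ge> 0" "d \<ge> 0" for p q r d X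
    using that by (simp add: ennreal_mult ennreal_plus distrib_right mult.assoc)
  have bound: "wn2 (- g) (u N) \<le> ennreal (1 / (1 - t)\<^sup>2) * ?X" for N
  proof (induction N)
    case 0
    then show ?case by (simp add: u_def wn2_def)
  next
    case (Suc N)
    \<comment> \<open>With this choice 1 + e = 1 / t and 1 + 1 / e = 1 / (1 - t), and the constant 1
      / (1 - t)^2 is exactly the fixed point of c = t c + 1 / (1 - t).\<close>
    let ?e = "(1 - t) / t"
    have [measurable]: "B (u N) \<in> borel_measurable borel"
      using multiplierD(1)[OF B(1) uV(1)] by (rule L1L2_borel)
    have "wn2 (- g) (u (Suc N)) \<le> ennreal (1 + ?e) * wn2 (- g) (B (u N)) + ennreal (1 + 1 / ?e) * ?X"
      unfolding u_Suc using t by (intro wn2_add_weighted) auto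
    also have "\<dots> \<le> ennreal (1 + ?e) * (ennreal (t\<^sup>2) * (ennreal (1 / (1 - t)\<^sup>2) * ?X)) + ennreal (1 + 1 / ?e) * ?X"
      by (intro add_mono mult_left_mono order_trans[OF multiplier_wn2_le[OF B(2) uV(2) \<beta>(2)]] Suc) auto
    also have "\<dots> = ennreal ((1 + ?e) * t\<^sup>2 * (1 / (1 - t)\<^sup>2) + (1 + 1 / ?e)) * ?X"
      using t by (intro combine) auto
    also have "(1 + ?e) * t\<^sup>2 * (1 / (1 - t)\<^sup>2) + (1 + 1 / ?e) = 1 / (1 - t)\<^sup>2"
      using t by (simp add: divide_simps) (simp add: power2_eq_square algebra_simps)
    finally show ?case .
  qed
  \<comment> \<open>The limit in \<open>N\<close> is taken for a fixed window, where comparing the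
    weights costs the factor exp (4 g m); only afterwards does m tend to infinity.\<close>
  have win: "(\<integral>\<^sup>+x. ennreal ((exp (- g * x) * cmod (w x))\<^sup>2) * indicator {-m..m} x \<partial>lborel)
      \<le> ennreal (2 / (1 - t)\<^sup>2) * ?X" for m
  proof -
    have le: "(\<integral>\<^sup>+x. ennreal ((exp (- g * x) * cmod (w x))\<^sup>2) * indicator {-m..m} x \<partial>lborel)
        \<le> ennreal (2 / (1 - t)\<^sup>2) * ?X + ennreal (2 * exp (4 * g * m)) * wn2 g w * ennreal ((t ^ N)\<^sup>2)" for N
    proof -
      have "(\<integral>\<^sup>+x. ennreal ((exp (- g * x) * cmod (w x))\<^sup>2) * indicator {-m..m} x \<partial>lborel)
        \<le> (\<integral>\<^sup>+x. ennreal 2 * ennreal ((exp (- g * x) * cmod (u N x))\<^sup>2)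
           + ennreal (2 * exp (4 * g * m)) * ennreal ((exp (g * x) * cmod (w x - u N x))\<^sup>2) \<partial>lborel)"
      proof (rule nn_integral_mono)
        fix x
        let ?a = "exp (- g * x) * cmod (u N x)" and ?d = "exp (- g * x) * cmod (w x - u N x)"
        have "exp (- g * x) * cmod (w x) \<le> ?a + ?d"
          using norm_triangle_ineq[of "u N x" "w x - u N x"] by (simp flip: distrib_left)
        then have "(exp (- g * x) * cmod (w x))\<^sup>2 \<le> (?a + ?d)\<^sup>2"
          by (intro power_mono) auto
        also have "\<dots> \<le> 2 * ?a\<^sup>2 + 2 * ?d\<^sup>2"
          using zero_le_power2[of "?a - ?d"] by (simp add: power2_sum power2_diff del: zero_le_power2)
        finally have 1: "(exp (- g * x) * cmod (w x))\<^sup>2 \<le> 2 * ?a\<^sup>2 + 2 * ?d\<^sup>2" .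
        have 2: "2 * ?d\<^sup>2 \<le> 2 * exp (4 * g * m) * (exp (g * x) * cmod (w x - u N x))\<^sup>2" if "x \<in> {-m..m}"
        proof -
          have "exp (- g * x) \<le> exp (2 * g * m) * exp (g * x)"
            using that g mult_left_mono[of "-x" m "2 * g"] by (simp add: exp_add[symmetric])
          then have "?d \<le> exp (2 * g * m) * (exp (g * x) * cmod (w x - u N x))"
            by (simp add: mult.assoc[symmetric] mult_right_mono)
          then have "?d\<^sup>2 \<le> (exp (2 * g * m) * (exp (g * x) * cmod (w x - u N x)))\<^sup>2"
            by (intro power_mono) auto
          also have "\<dots> = exp (4 * g * m) * (exp (g * x) * cmod (w x - u N x))\<^sup>2"
            unfolding power_mult_distrib[of "exp (2 * g * m)"] by (simp add: exp_double[symmetric])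
          finally show ?thesis by simp
        qed
        show "ennreal ((exp (- g * x) * cmod (w x))\<^sup>2) * indicator {-m..m} x
          \<le> ennreal 2 * ennreal (?a\<^sup>2) + ennreal (2 * exp (4 * g * m)) * ennreal ((exp (g * x) * cmod (w x - u N x))\<^sup>2)"
        proof (cases "x \<in> {-m..m}")
          case True
          have "ennreal ((exp (- g * x) * cmod (w x))\<^sup>2) \<le> ennreal (2 * ?a\<^sup>2 + 2 * exp (4 * g * m) * (exp (g * x) * cmod (w x - u N x))\<^sup>2)"
            using 1 2[OF True] by (intro ennreal_leI) linarith
          also have "\<dots> = ennreal (2 * ?a\<^sup>2) + ennreal (2 * exp (4 * g * m) * (exp (g * x) * cmod (w x - u N x))\<^sup>2)"
            by (rule ennreal_plus) auto
          finally show ?thesis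
            using True by (simp add: ennreal_mult)
        qed simp
      qed
      also have "\<dots> = ennreal 2 * wn2 (- g) (u N) + ennreal (2 * exp (4 * g * m)) * wn2 g (\<lambda>x. w x - u N x)"
        unfolding wn2_def by (subst nn_integral_add) (auto simp: nn_integral_cmult)
      also have "\<dots> \<le> ennreal 2 * (ennreal (1 / (1 - t)\<^sup>2) * ?X) + ennreal (2 * exp (4 * g * m)) * (ennreal ((t ^ N)\<^sup>2) * wn2 g w)"
        by (intro add_mono mult_left_mono bound err) auto
      also have "ennreal 2 * (ennreal (1 / (1 - t)\<^sup>2) * ?X) = ennreal (2 / (1 - t)\<^sup>2) * ?X"
        by (subst mult.assoc[symmetric], subst ennreal_mult[symmetric]) auto
      finally show ?thesis by (simp only: mult_ac)
    qed
    have fin: "ennreal (2 * exp (4 * g * m)) * wn2 g w < \<infinity>"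
      using w by (auto simp: L1L2_def ennreal_mult_less_top)
    have "(\<lambda>N. ennreal ((t ^ N)\<^sup>2)) \<longlonglongrightarrow> ennreal (0\<^sup>2)"
      using t by (intro tendsto_ennrealI tendsto_power LIMSEQ_power_zero) auto
    then have "(\<lambda>N. ennreal (2 / (1 - t)\<^sup>2) * ?X + ennreal (2 * exp (4 * g * m)) * wn2 g w * ennreal ((t ^ N)\<^sup>2))
       \<longlonglongrightarrow> ennreal (2 / (1 - t)\<^sup>2) * ?X + ennreal (2 * exp (4 * g * m)) * wn2 g w * ennreal (0\<^sup>2)"
      using fin by (intro tendsto_add tendsto_const tendsto_mult_ennreal) auto
    from LIMSEQ_le_const[OF this] le show ?thesis by auto
  qed
  show ?thesis
    unfolding wn2_def[of "- g" w]
  proof (rule nn_integral_le_tendsto)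
    show "AE x in lborel. (\<lambda>n. ennreal ((exp (- g * x) * cmod (w x))\<^sup>2) * indicator {-real n..real n} x)
        \<longlonglongrightarrow> ennreal ((exp (- g * x) * cmod (w x))\<^sup>2)"
    proof (intro AE_I2 tendsto_eventually)
      show "\<forall>\<^sub>F n in sequentially. ennreal ((exp (- g * x) * cmod (w x))\<^sup>2) * indicator {-real n..real n} x
          = ennreal ((exp (- g * x) * cmod (w x))\<^sup>2)" for x
        using eventually_abs_le_nat[of x] by eventually_elim (auto simp: indicator_def)
    qed
  qed (measurable, rule win)
qed

section \<open>The symbols attached to the law\<close>

text \<open>Mean value inequality on the half-plane Re z \<le> m, which is convex and on which exp,
  its own derivative, has modulus at most exp m.\<close>

lemma norm_exp_diff_le:
  fixes a b :: complex
  assumes "Re a \<le> m" "Re b \<le> m"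
  shows "cmod (exp a - exp b) \<le> exp m * cmod (a - b)"
proof (rule field_differentiable_bound[where f=exp and f'=exp and S="{z. Re z \<le> m}"])
  show "convex {z. Re z \<le> m}"
    by (rule convex_halfspace_Re_le)
qed (use assms in \<open>auto intro: DERIV_exp[THEN has_field_derivative_at_within]\<close>)

text \<open>The extra uniform variable turns oriented integrals from 0 to y, for y of either sign,
  into ordinary integrals over a probability space, so that integrated tails become kernel
  operators.\<close>

definition unit_measure :: "real measure" where
  "unit_measure = density lborel (indicator {0..1})"

lemma sets_unit_measure [simp, measurable_cong]: "sets unit_measure = sets borel"
  by (simp add: unit_measure_def)

lemma space_unit_measure [simp]: "space unit_measure = UNIV"
  by (simp add: unit_measure_def)

lemma prob_space_unit_measure: "prob_space unit_measure"
  by (rule prob_spaceI) (simp add: unit_measure_def emeasure_density)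

lemma AE_unit_measure: "AE t in unit_measure. 0 \<le> t \<and> t \<le> 1"
  unfolding unit_measure_def by (subst AE_density) (auto simp: indicator_def)

lemma integral_unit_measure_FTC:
  fixes f F :: "real \<Rightarrow> complex"
  assumes "continuous_on UNIV f" "\<And>x. (F has_vector_derivative f x) (at x)"
  shows "integrable unit_measure f" "(\<integral>t. f t \<partial>unit_measure) = F 1 - F 0"
proof -
  have [measurable]: "f \<in> borel_measurable borel"
    by (rule borel_measurable_continuous_onI[OF assms(1)])
  have eq: "unit_measure = density lborel (\<lambda>x. ennreal (indicator {0..1} x))"
    unfolding unit_measure_def by (intro density_cong) (auto simp: indicator_def)
  have "set_integrable lborel {0..1} f"
    by (rule borel_integrable_atLeastAtMost') (rule continuous_on_subset[OF assms(1)], simp)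
  then show "integrable unit_measure f"
    unfolding eq set_integrable_def by (subst integrable_density) auto
  have "(\<integral>t. f t \<partial>unit_measure) = (\<integral>t. indicator {0..1} t *\<^sub>R f t \<partial>lborel)"
    unfolding eq by (subst integral_density) auto
  also have "\<dots> = F 1 - F 0"
    by (rule integral_FTC_atLeastAtMost)
       (auto intro: has_vector_derivative_at_within[OF assms(2)] continuous_on_subset[OF assms(1)])
  finally show "(\<integral>t. f t \<partial>unit_measure) = F 1 - F 0" .
qed

text \<open>Fundamental theorem of calculus for exp (- a t) and for -(1 - t) exp (- a t).
  Multiplying by \<open>a\<close> instead of dividing keeps a = 0 within the statement.\<close>

lemma unit_measure_exp_integrals:
  fixes a :: complex
  shows "a * (\<integral>t. exp (- a * cx t) \<partial>unit_measure) = 1 - exp (- a)"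
    and "a * (\<integral>t. cx (1 - t) * exp (- a * cx t) \<partial>unit_measure)
      = 1 - (\<integral>t. exp (- a * cx t) \<partial>unit_measure)"
proof -
  have d: "((\<lambda>t. exp (- a * cx t)) has_vector_derivative - a * exp (- a * cx x)) (at x)" for x
    by (rule has_vector_derivative_eq_rhs, rule field_vector_diff_chain_at[where g="exp" and f="\<lambda>t. - a * cx t", unfolded o_def])
       (auto intro!: derivative_eq_intros)
  have i0: "integrable unit_measure (\<lambda>t. exp (- a * cx t))"

  proof -
    interpret prob_space unit_measure by (rule prob_space_unit_measure)
    show ?thesis
    proof (rule integrable_const_bound[where B="exp \<bar>Re a\<bar>"])
      show "AE t in unit_measure. norm (exp (- a * cx t)) \<le> exp \<bar>Re a\<bar>"
        using AE_unit_measure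
      proof eventually_elim
        case (elim t)
        have "- (Re a * t) \<le> \<bar>Re a\<bar> * 1"
          by (rule order_trans[OF abs_ge_minus_self]) (use elim in \<open>auto simp: abs_mult intro: mult_left_le\<close>)
        then show ?case by simp
      qed
    qed measurable
  qed
  have "(\<integral>t. - a * exp (- a * cx t) \<partial>unit_measure) = exp (- a) - 1"
    by (subst integral_unit_measure_FTC(2)[OF _ d]) (auto intro!: continuous_intros)
  then show 1: "a * (\<integral>t. exp (- a * cx t) \<partial>unit_measure) = 1 - exp (- a)"
    by (simp add: algebra_simps)
  let ?g = "\<lambda>t. exp (- a * cx t) + a * (cx (1 - t) * exp (- a * cx t))"
  have D: "((\<lambda>t. - (cx (1 - t) * exp (- a * cx t))) has_vector_derivative ?g x) (at x)" for x
  proof -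
    have "((\<lambda>t. cx (1 - t)) has_vector_derivative - 1) (at x)"
      by (rule has_vector_derivative_eq_rhs, rule has_vector_derivative_of_real) (auto intro!: derivative_eq_intros)
    from has_vector_derivative_minus[OF has_vector_derivative_mult[OF this d]]
    show ?thesis by (rule has_vector_derivative_eq_rhs) (simp add: algebra_simps)
  qed
  have I: "integrable unit_measure ?g" "(\<integral>t. ?g t \<partial>unit_measure) = 1"
  proof -
    have c: "continuous_on UNIV ?g"
      by (intro continuous_intros)
    show "integrable unit_measure ?g"
      by (rule integral_unit_measure_FTC(1)[OF c D])
    show "(\<integral>t. ?g t \<partial>unit_measure) = 1"
      by (subst integral_unit_measure_FTC(2)[OF c D]) simp
  qed
  have "a * (\<integral>t. cx (1 - t) * exp (- a * cx t) \<partial>unit_measure)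
      = (\<integral>t. ?g t - exp (- a * cx t) \<partial>unit_measure)"
    by simp
  also have "\<dots> = (\<integral>t. ?g t \<partial>unit_measure) - (\<integral>t. exp (- a * cx t) \<partial>unit_measure)"
    by (intro Bochner_Integration.integral_diff I i0)
  finally show "a * (\<integral>t. cx (1 - t) * exp (- a * cx t) \<partial>unit_measure)
      = 1 - (\<integral>t. exp (- a * cx t) \<partial>unit_measure)"
    using I by simp
qed

text \<open>The factor 4 leaves room for the polynomial weights in \<open>y\<^sup>2 * exp (e * \<bar>y\<bar>)\<close>.\<close>

locale drift_law = prob_space \<rho> for \<rho> :: "real measure" +
  fixes l e :: real
  assumes sets_rho [simp, measurable_cong]: "sets \<rho> = sets borel"
    and e: "e > 0" and exp_moment: "integrable \<rho> (\<lambda>y. exp (4 * e * \<bar>y\<bar>))"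
    and l_eq: "l = (LINT y|\<rho>. y)" and l_pos: "l > 0"
    and dioph: "weakly_diophantine_0 \<rho>"
begin

lemma space_rho [simp]: "space \<rho> = UNIV"
  using sets_eq_imp_space_eq[OF sets_rho] by simp

lemma prob_UNIV [simp]: "measure \<rho> UNIV = 1"
  using prob_space by simp

abbreviation \<rho>U :: "(real \<times> real) measure" where "\<rho>U \<equiv> \<rho> \<Otimes>\<^sub>M unit_measure"

sublocale U: prob_space unit_measure by (rule prob_space_unit_measure)
sublocale \<rho>U: pair_prob_space \<rho> unit_measure ..

lemma U_prob_UNIV [simp]: "measure unit_measure UNIV = 1"
  using U.prob_space by simp

lemma moment_integrable:
  "integrable \<rho> (\<lambda>y. exp (e * \<bar>y\<bar>))"
  "integrable \<rho> (\<lambda>y. \<bar>y\<bar> * exp (e * \<bar>y\<bar>))"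
  "integrable \<rho> (\<lambda>y. y\<^sup>2 * exp (e * \<bar>y\<bar>))"
  "integrable \<rho> (\<lambda>y. y)"
proof -
  \<comment> \<open>Each power of |y| is traded for one more factor exp (e |y|).\<close>
  have le: "\<bar>y\<bar> \<le> inverse e * exp (e * \<bar>y\<bar>)" for y
  proof -
    have "e * \<bar>y\<bar> \<le> exp (e * \<bar>y\<bar>)" using exp_ge_add_one_self[of "e * \<bar>y\<bar>"] by linarith
    then show ?thesis using e by (simp add: field_simps)
  qed
  have dom: "integrable \<rho> f"
    if "f \<in> borel_measurable borel" and f: "\<And>y. \<bar>f y\<bar> \<le> c * exp (k * e * \<bar>y\<bar>)" "k \<le> 4" "0 \<le> c" for f c k
  proof (rule Bochner_Integration.integrable_bound[OF integrable_mult_right[OF exp_moment, of c]])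
    have "c * exp (k * e * \<bar>y\<bar>) \<le> c * exp (4 * e * \<bar>y\<bar>)" for y
      using f e by (intro mult_left_mono) (auto intro!: mult_right_mono)
    from order_trans[OF f(1) this]
    show "AE y in \<rho>. norm (f y) \<le> norm (c * exp (4 * e * \<bar>y\<bar>))"
      using f by (simp add: abs_mult)
  qed (use that in simp)
  show "integrable \<rho> (\<lambda>y. exp (e * \<bar>y\<bar>))"
    by (rule dom[of _ 1 1]) auto
  show "integrable \<rho> (\<lambda>y. y)"
    using le e by (intro dom[of _ "inverse e" 1]) auto
  have E: "exp (2 * e * \<bar>y\<bar>) = exp (e * \<bar>y\<bar>) * exp (e * \<bar>y\<bar>)"
    "exp (3 * e * \<bar>y\<bar>) = exp (e * \<bar>y\<bar>) * exp (e * \<bar>y\<bar>) * exp (e * \<bar>y\<bar>)" for y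
    by (simp_all flip: exp_add)
  have 1: "\<bar>y\<bar> * exp (e * \<bar>y\<bar>) \<le> inverse e * exp (2 * e * \<bar>y\<bar>)" for y
    using mult_right_mono[OF le[of y], of "exp (e * \<bar>y\<bar>)"] unfolding E by (simp only: mult.assoc exp_ge_zero)
  then show "integrable \<rho> (\<lambda>y. \<bar>y\<bar> * exp (e * \<bar>y\<bar>))"
    using e by (intro dom[of _ "inverse e" 2]) (auto simp: abs_mult)
  have "y\<^sup>2 * exp (e * \<bar>y\<bar>) \<le> (inverse e)\<^sup>2 * exp (3 * e * \<bar>y\<bar>)" for y
    using mult_mono[OF le[of y] 1[of y]] e unfolding E by (simp add: power2_eq_square mult_ac)
  then show "integrable \<rho> (\<lambda>y. y\<^sup>2 * exp (e * \<bar>y\<bar>))"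
    by (intro dom[of _ "(inverse e)\<^sup>2" 3]) (auto simp: abs_mult)
qed

text \<open>Moments that control the symbols on the strip |Re z| \<le> e: \<open>A0\<close> bounds
  \<open>rho_hat\<close>, \<open>A1\<close> its Lipschitz constant and, up to powers of
  \<open>l\<close>, also \<open>rs\<close>; \<open>A2\<close> likewise bounds the Lipschitz constant
  of \<open>rs\<close> and the size of \<open>qs\<close>.\<close>

definition A0 where "A0 = (LINT y|\<rho>. exp (e * \<bar>y\<bar>))"
definition A1 where "A1 = (LINT y|\<rho>. \<bar>y\<bar> * exp (e * \<bar>y\<bar>))"
definition A2 where "A2 = (LINT y|\<rho>. y\<^sup>2 * exp (e * \<bar>y\<bar>))"

lemma A_nonneg: "A0 \<ge> 0" "A1 \<ge> 0" "A2 \<ge> 0"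
  by (auto simp: A0_def A1_def A2_def)

text \<open>The kernels of the integrated tail of \<open>\<rho>\<close> and of its second iterate: for \<open>t\<close> uniform on
  \<open>[0,1]\<close>, the mean of \<open>y * f (x + y * t)\<close> is the integral of \<open>f (x + v)\<close> over \<open>v\<close> from \<open>0\<close> to \<open>y\<close>.\<close>

definition rw :: "real \<times> real \<Rightarrow> real" where "rw p = fst p / l"
definition qw :: "real \<times> real \<Rightarrow> real" where "qw p = (fst p)\<^sup>2 * (1 - snd p) / l\<^sup>2"
definition ry :: "real \<times> real \<Rightarrow> real" where "ry p = fst p * snd p"

text \<open>These are (1 - rho_hat z) / (l z) and (1 - rs z) / (l z) with the singularity at 0
  removed: the integral formulas make sense there too.\<close>

definition rs :: "complex \<Rightarrow> complex" where "rs = ksymb \<rho>U rw ry"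
definition qs :: "complex \<Rightarrow> complex" where "qs = ksymb \<rho>U qw ry"

lemma rw_measurable [measurable]: "rw \<in> borel_measurable (borel \<Otimes>\<^sub>M borel)" unfolding rw_def by measurable
lemma qw_measurable [measurable]: "qw \<in> borel_measurable (borel \<Otimes>\<^sub>M borel)" unfolding qw_def by measurable
lemma ry_measurable [measurable]: "ry \<in> borel_measurable (borel \<Otimes>\<^sub>M borel)" unfolding ry_def by measurable

lemma sets_rhoU [simp, measurable_cong]: "sets \<rho>U = sets (borel \<Otimes>\<^sub>M borel)"
  by (rule sets_pair_measure_cong) auto

lemma exp_ry_le:
  assumes "\<bar>Re z\<bar> \<le> e" "0 \<le> t" "t \<le> 1"
  shows "Re (- z * cx (ry (y, t))) \<le> e * \<bar>y\<bar>"
proof -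
  have "- (Re z * (y * t)) \<le> \<bar>Re z\<bar> * (\<bar>y\<bar> * \<bar>t\<bar>)"
    by (rule order_trans[OF abs_ge_minus_self]) (simp add: abs_mult)
  also have "\<dots> \<le> e * (\<bar>y\<bar> * 1)"
    using assms by (intro mult_mono) auto
  finally show ?thesis by (simp add: ry_def)
qed

lemma AE_rhoU: "AE p in \<rho>U. 0 \<le> snd p \<and> snd p \<le> 1"
proof -
  have "AE x in \<rho>. AE y in unit_measure. 0 \<le> snd (x, y) \<and> snd (x, y) \<le> 1"
    using AE_unit_measure by simp
  then show ?thesis
    by (rule \<rho>U.AE_pair_measure[rotated]) measurable
qed

lemma integrable_rhoU_fst:
  fixes f :: "real \<Rightarrow> real"
  assumes "integrable \<rho> f"
  shows "integrable \<rho>U (\<lambda>p. f (fst p))" "(\<integral>p. f (fst p) \<partial>\<rho>U) = (\<integral>y. f y \<partial>\<rho>)"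
proof -
  have [measurable]: "f \<in> borel_measurable borel" using assms by (simp cong: measurable_cong_sets)
  show 1: "integrable \<rho>U (\<lambda>p. f (fst p))"
    using assms by (intro \<rho>U.Fubini_integrable) auto
  show "(\<integral>p. f (fst p) \<partial>\<rho>U) = (\<integral>y. f y \<partial>\<rho>)"
    by (subst \<rho>U.integral_fst'[OF 1, symmetric]) auto
qed

text \<open>The uniform variable lies in [0,1] almost surely and carries total mass 1, so a bound
  depending on \<open>y\<close> alone integrates to its mean under \<rho>.\<close>

lemma norm_rhoU_integral_le:
  assumes [measurable]: "F \<in> borel_measurable (borel \<Otimes>\<^sub>M borel)" and g: "integrable \<rho> g"
    and le: "\<And>y t. 0 \<le> t \<Longrightarrow> t \<le> 1 \<Longrightarrow> cmod (F (y, t)) \<le> g y"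
  shows "integrable \<rho>U F" "cmod (\<integral>p. F p \<partial>\<rho>U) \<le> (\<integral>y. g y \<partial>\<rho>)"
proof -
  have AE: "AE p in \<rho>U. cmod (F p) \<le> g (fst p)"
    using AE_rhoU by eventually_elim (use le in auto)
  show 1: "integrable \<rho>U F"
    by (rule Bochner_Integration.integrable_bound[OF integrable_rhoU_fst(1)[OF g]])
       (use AE in \<open>auto elim!: eventually_mono intro: order_trans[OF _ abs_ge_self]\<close>)
  have "cmod (\<integral>p. F p \<partial>\<rho>U) \<le> (\<integral>p. cmod (F p) \<partial>\<rho>U)"
    by (rule integral_norm_bound)
  also have "\<dots> \<le> (\<integral>p. g (fst p) \<partial>\<rho>U)"
    using 1 AE integrable_rhoU_fst(1)[OF g] by (intro integral_mono_AE) auto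
  finally show "cmod (\<integral>p. F p \<partial>\<rho>U) \<le> (\<integral>y. g y \<partial>\<rho>)"
    using integrable_rhoU_fst(2)[OF g] by simp
qed

lemma rw_term_le:
  assumes "\<bar>Re z\<bar> \<le> e" "0 \<le> t" "t \<le> 1"
  shows "cmod (cx (rw (y, t)) * exp (- z * cx (ry (y, t)))) \<le> 1 / l * (\<bar>y\<bar> * exp (e * \<bar>y\<bar>))"
proof -
  have "\<bar>rw (y, t)\<bar> * exp (Re (- z * cx (ry (y, t)))) \<le> \<bar>rw (y, t)\<bar> * exp (e * \<bar>y\<bar>)"
    by (intro mult_left_mono) (use exp_ry_le[OF assms, of y] in auto)
  then show ?thesis
    unfolding norm_mult norm_of_real norm_exp_eq_Re using l_pos by (simp add: rw_def)
qed

lemma qw_term_le: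
  assumes "\<bar>Re z\<bar> \<le> e" "0 \<le> t" "t \<le> 1"
  shows "cmod (cx (qw (y, t)) * exp (- z * cx (ry (y, t)))) \<le> 1 / l\<^sup>2 * (y\<^sup>2 * exp (e * \<bar>y\<bar>))"
proof -
  have "cmod (cx (qw (y, t)) * exp (- z * cx (ry (y, t))))
     = (y\<^sup>2 * (1 - t) / l\<^sup>2) * exp (Re (- z * cx (ry (y, t))))"
    unfolding norm_mult norm_of_real norm_exp_eq_Re using assms by (simp add: qw_def abs_mult)
  also have "\<dots> \<le> (y\<^sup>2 * 1 / l\<^sup>2) * exp (e * \<bar>y\<bar>)"
    using assms exp_ry_le[OF assms, of y] by (intro mult_mono divide_right_mono mult_left_mono) auto
  finally show ?thesis by simp
qed

lemma integrable_rs: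
  assumes "\<bar>Re z\<bar> \<le> e"
  shows "integrable \<rho>U (\<lambda>p. cx (rw p) * exp (- z * cx (ry p)))"
    and "cmod (rs z) \<le> A1 / l"
  using norm_rhoU_integral_le[OF _ integrable_mult_right[OF moment_integrable(2), of "1 / l"] rw_term_le[OF assms]]
  unfolding rs_def ksymb_def A1_def by simp_all

lemma integrable_qs:
  assumes "\<bar>Re z\<bar> \<le> e"
  shows "integrable \<rho>U (\<lambda>p. cx (qw p) * exp (- z * cx (ry p)))"
    and "cmod (qs z) \<le> A2 / l\<^sup>2"
  using norm_rhoU_integral_le[OF _ integrable_mult_right[OF moment_integrable(3), of "1 / l\<^sup>2"] qw_term_le[OF assms]]
  unfolding qs_def ksymb_def A2_def by simp_all

text \<open>Varying z in the kernel brings down one more factor \<open>y * t\<close>, which is why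
  the second moment \<open>A2\<close> appears.\<close>

lemma rs_diff_le:
  assumes z: "\<bar>Re z\<bar> \<le> e" "\<bar>Re z'\<bar> \<le> e"
  shows "cmod (rs z - rs z') \<le> cmod (z - z') * (A2 / l)"
proof -
  let ?F = "\<lambda>p. cx (rw p) * exp (- z * cx (ry p)) - cx (rw p) * exp (- z' * cx (ry p))"
  have "rs z - rs z' = (\<integral>p. ?F p \<partial>\<rho>U)"
    unfolding rs_def ksymb_def using integrable_rs(1) z by (intro Bochner_Integration.integral_diff[symmetric]) auto
  also have "cmod \<dots> \<le> (\<integral>y. cmod (z - z') / l * (y\<^sup>2 * exp (e * \<bar>y\<bar>)) \<partial>\<rho>)"
  proof (rule norm_rhoU_integral_le(2))
    fix y t :: real assume t: "0 \<le> t" "t \<le> 1"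
    have "cmod (?F (y, t)) = \<bar>y\<bar> / l * cmod (exp (- z * cx (ry (y, t))) - exp (- z' * cx (ry (y, t))))"
      unfolding right_diff_distrib[symmetric] norm_mult norm_of_real using l_pos by (simp add: rw_def)
    also have "\<dots> \<le> \<bar>y\<bar> / l * (exp (e * \<bar>y\<bar>) * cmod (- z * cx (ry (y, t)) - (- z' * cx (ry (y, t)))))"
      using l_pos by (intro mult_left_mono norm_exp_diff_le exp_ry_le z t) auto
    also have "cmod (- z * cx (ry (y, t)) - (- z' * cx (ry (y, t)))) = cmod (z - z') * (\<bar>y\<bar> * t)"
    proof -
      have "- z * cx (ry (y, t)) - (- z' * cx (ry (y, t))) = - ((z - z') * cx (y * t))"
        by (simp add: ry_def algebra_simps)
      then show ?thesis using t by (simp only: norm_minus_cancel norm_mult norm_of_real abs_mult abs_of_nonneg)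
    qed
    also have "\<bar>y\<bar> / l * (exp (e * \<bar>y\<bar>) * (cmod (z - z') * (\<bar>y\<bar> * t))) \<le> \<bar>y\<bar> / l * (exp (e * \<bar>y\<bar>) * (cmod (z - z') * (\<bar>y\<bar> * 1)))"
      using l_pos t by (intro mult_left_mono) auto
    also have "\<dots> = cmod (z - z') / l * (y\<^sup>2 * exp (e * \<bar>y\<bar>))"
      by (simp add: power2_eq_square)
    finally show "cmod (?F (y, t)) \<le> cmod (z - z') / l * (y\<^sup>2 * exp (e * \<bar>y\<bar>))" .
  qed (auto intro!: integrable_mult_right moment_integrable)
  finally show ?thesis by (simp add: A2_def)
qed

lemma exp_y_le:
  assumes "\<bar>Re z\<bar> \<le> e"
  shows "Re (- z * cx y) \<le> e * \<bar>y\<bar>"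
  using exp_ry_le[OF assms, of 1 y] by (simp add: ry_def)

lemma integrable_rho_hat:
  assumes "\<bar>Re z\<bar> \<le> e"
  shows "integrable \<rho> (\<lambda>y. exp (- z * cx y))"
  by (rule Bochner_Integration.integrable_bound[OF moment_integrable(1)])
     (use exp_y_le[OF assms] in auto)

lemma rho_hat_le:
  assumes "\<bar>Re z\<bar> \<le> e"
  shows "cmod (rho_hat \<rho> z) \<le> A0"
  unfolding rho_hat_def A0_def
proof (rule order_trans[OF integral_norm_bound], rule integral_mono)
  show "cmod (exp (- z * cx y)) \<le> exp (e * \<bar>y\<bar>)" for y
    unfolding norm_exp_eq_Re using exp_y_le[OF assms] by simp
qed (intro integrable_norm integrable_rho_hat assms moment_integrable)+

lemma rho_hat_diff_le:
  assumes z: "\<bar>Re z\<bar> \<le> e" "\<bar>Re z'\<bar> \<le> e"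
  shows "cmod (rho_hat \<rho> z - rho_hat \<rho> z') \<le> cmod (z - z') * A1"
proof -
  have "rho_hat \<rho> z - rho_hat \<rho> z' = (\<integral>y. exp (- z * cx y) - exp (- z' * cx y) \<partial>\<rho>)"
    unfolding rho_hat_def using integrable_rho_hat z by (intro Bochner_Integration.integral_diff[symmetric]) auto
  also have "cmod \<dots> \<le> (\<integral>y. cmod (exp (- z * cx y) - exp (- z' * cx y)) \<partial>\<rho>)"
    by (rule integral_norm_bound)
  also have "\<dots> \<le> (\<integral>y. cmod (z - z') * (\<bar>y\<bar> * exp (e * \<bar>y\<bar>)) \<partial>\<rho>)"
  proof (rule integral_mono)
    fix y
    have "cmod (exp (- z * cx y) - exp (- z' * cx y)) \<le> exp (e * \<bar>y\<bar>) * cmod (- z * cx y - (- z' * cx y))"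
      by (intro norm_exp_diff_le exp_y_le z)
    also have "- z * cx y - (- z' * cx y) = - ((z - z') * cx y)"
      by (simp add: algebra_simps)
    finally show "cmod (exp (- z * cx y) - exp (- z' * cx y)) \<le> cmod (z - z') * (\<bar>y\<bar> * exp (e * \<bar>y\<bar>))"
      by (simp only: norm_minus_cancel norm_mult norm_of_real mult_ac)
  qed (intro integrable_mult_right moment_integrable integrable_rho_hat integrable_norm Bochner_Integration.integrable_diff z)+
  finally show ?thesis by (simp add: A1_def)
qed

text \<open>For fixed \<open>y\<close>, the uniform integral of y exp (- z y t), multiplied by z, is
  1 - exp (- z y); averaging over \<rho> gives the claim without a division by z.\<close>

lemma rs_identity:
  assumes "\<bar>Re z\<bar> \<le> e"
  shows "cx l * z * rs z = 1 - rho_hat \<rho> z"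
proof -
  have "rs z = (\<integral>y. \<integral>t. cx (rw (y, t)) * exp (- z * cx (ry (y, t))) \<partial>unit_measure \<partial>\<rho>)"
    unfolding rs_def ksymb_def by (rule \<rho>U.integral_fst'[OF integrable_rs(1)[OF assms], symmetric])
  then have "cx l * z * rs z = (\<integral>y. cx l * z * (\<integral>t. cx (rw (y, t)) * exp (- z * cx (ry (y, t))) \<partial>unit_measure) \<partial>\<rho>)"
    by simp
  also have "\<dots> = (\<integral>y. 1 - exp (- z * cx y) \<partial>\<rho>)"
  proof (rule Bochner_Integration.integral_cong[OF refl])
    fix y
    have "cx l * z * (\<integral>t. cx (rw (y, t)) * exp (- z * cx (ry (y, t))) \<partial>unit_measure)
      = (z * cx y) * (\<integral>t. exp (- (z * cx y) * cx t) \<partial>unit_measure)"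
      using l_pos by (simp add: rw_def ry_def mult_ac)
    then show "cx l * z * (\<integral>t. cx (rw (y, t)) * exp (- z * cx (ry (y, t))) \<partial>unit_measure)
       = 1 - exp (- z * cx y)"
      unfolding unit_measure_exp_integrals(1) by simp
  qed
  also have "\<dots> = 1 - rho_hat \<rho> z"
    unfolding rho_hat_def using integrable_rho_hat[OF assms]
    by (subst Bochner_Integration.integral_diff) auto
  finally show ?thesis .
qed

lemma integral_y: "(\<integral>y. cx y \<partial>\<rho>) = cx l"
  by (simp add: l_eq)

lemma rs_0: "rs 0 = 1"
proof -
  have "rs 0 = (\<integral>y. \<integral>t. cx (rw (y, t)) * exp (- 0 * cx (ry (y, t))) \<partial>unit_measure \<partial>\<rho>)"
    unfolding rs_def ksymb_def using e by (intro \<rho>U.integral_fst'[OF integrable_rs(1), symmetric]) auto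
  also have "\<dots> = 1"
    using l_pos integral_y by (simp add: rw_def)
  finally show ?thesis .
qed

text \<open>Integrating the kernel of \<open>rs\<close> once more produces the tail probability 1 -
  t of the uniform variable, which is the origin of the weight in \<open>qw\<close>. The 1 on the
  right is the mean of y / l.\<close>

lemma qs_identity:
  assumes "\<bar>Re z\<bar> \<le> e"
  shows "cx l * z * qs z = 1 - rs z"
proof -
  let ?r = "\<lambda>y. \<integral>t. cx (rw (y, t)) * exp (- z * cx (ry (y, t))) \<partial>unit_measure"
  have r: "rs z = (\<integral>y. ?r y \<partial>\<rho>)"
    unfolding rs_def ksymb_def by (rule \<rho>U.integral_fst'[OF integrable_rs(1)[OF assms], symmetric])
  have ir: "integrable \<rho> ?r"
    using \<rho>U.integrable_fst'[OF integrable_rs(1)[OF assms]] by simp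
  have "qs z = (\<integral>y. \<integral>t. cx (qw (y, t)) * exp (- z * cx (ry (y, t))) \<partial>unit_measure \<partial>\<rho>)"
    unfolding qs_def ksymb_def by (rule \<rho>U.integral_fst'[OF integrable_qs(1)[OF assms], symmetric])
  then have "cx l * z * qs z = (\<integral>y. cx l * z * (\<integral>t. cx (qw (y, t)) * exp (- z * cx (ry (y, t))) \<partial>unit_measure) \<partial>\<rho>)"
    by simp
  also have "\<dots> = (\<integral>y. cx (1 / l) * cx y - ?r y \<partial>\<rho>)"
  proof (rule Bochner_Integration.integral_cong[OF refl])
    fix y
    let ?a = "z * cx y"
    have "cx l * z * (\<integral>t. cx (qw (y, t)) * exp (- z * cx (ry (y, t))) \<partial>unit_measure)
      = cx l * z * (\<integral>t. cx (y\<^sup>2 / l\<^sup>2) * (cx (1 - t) * exp (- ?a * cx t)) \<partial>unit_measure)"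
      by (simp add: qw_def ry_def mult_ac)
    also have "\<dots> = cx (y / l) * (?a * (\<integral>t. cx (1 - t) * exp (- ?a * cx t) \<partial>unit_measure))"
      unfolding integral_mult_right_zero using l_pos by (simp add: power2_eq_square)
    also have "\<dots> = cx (1 / l) * cx y - ?r y"
      unfolding unit_measure_exp_integrals(2) rw_def ry_def fst_conv snd_conv integral_mult_right_zero
      by (simp add: right_diff_distrib mult.assoc)
    finally show "cx l * z * (\<integral>t. cx (qw (y, t)) * exp (- z * cx (ry (y, t))) \<partial>unit_measure)
      = cx (1 / l) * cx y - ?r y" .
  qed
  also have "\<dots> = cx (1 / l) * (\<integral>y. cx y \<partial>\<rho>) - rs z"
    unfolding r using moment_integrable(4) ir
    by (subst Bochner_Integration.integral_diff) (auto intro!: integrable_mult_right simp del: integral_complex_of_real)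
  also have "\<dots> = 1 - rs z"
    using l_pos by (simp only: integral_y) simp
  finally show ?thesis .
qed

end

section \<open>Lower bound of the symbol and choice of the strip\<close>

context drift_law begin

lemma rho_hat_far:
  obtains c B where "c > 0" "\<And>b. B \<le> \<bar>b\<bar> \<Longrightarrow> c \<le> cmod (1 - rho_hat \<rho> (\<i> * cx b))"
proof -
  let ?f = "\<lambda>b::real. ereal (cmod (1 - rho_hat \<rho> (\<i> * cx b)))"
  obtain c where c: "0 < ereal c" "ereal c < Liminf at_infinity ?f"
    using dioph ereal_dense2[of 0 "Liminf at_infinity ?f"] by (auto simp: weakly_diophantine_0_def)
  then have "\<forall>\<^sub>F b in at_infinity. ereal c < ?f b"
    by (intro less_LiminfD)
  then obtain B where "\<And>b. B \<le> norm b \<Longrightarrow> ereal c < ?f b"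
    unfolding eventually_at_infinity by blast
  with c that[of c B] show ?thesis by (auto intro: less_imp_le)
qed

text \<open>Equality with 1 forces the nonnegative function 1 - cos (b y) to have mean 0. Hence b y
  is almost surely a multiple of 2 pi, and then so is k b y.\<close>

lemma rho_hat_multiple:
  assumes "rho_hat \<rho> (\<i> * cx b) = 1"
  shows "rho_hat \<rho> (\<i> * cx (real k * b)) = 1"
proof -
  have i: "integrable \<rho> (\<lambda>y. exp (- (\<i> * cx b) * cx y))"
    using e by (intro integrable_rho_hat) auto
  have "(\<integral>y. 1 - cos (b * y) \<partial>\<rho>) = Re (1 - rho_hat \<rho> (\<i> * cx b))"
    unfolding rho_hat_def using integral_Re[OF i] integrable_Re[OF i]
    by (simp add: Re_exp Bochner_Integration.integral_diff)
  then have 0: "(\<integral>y. 1 - cos (b * y) \<partial>\<rho>) = 0"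
    using assms by simp
  have "\<bar>1 - cos (b * y)\<bar> \<le> 2" for y
    using cos_ge_minus_one[of "b * y"] cos_le_one[of "b * y"] by linarith
  then have "integrable \<rho> (\<lambda>y. 1 - cos (b * y))"
    by (intro integrable_const_bound[where B=2]) auto
  then have "AE y in \<rho>. 1 - cos (b * y) = 0"
    using 0 by (subst (asm) integral_nonneg_eq_0_iff_AE) auto
  then have AE: "AE y in \<rho>. exp (- (\<i> * cx (real k * b)) * cx y) = 1"
  proof eventually_elim
    case (elim y)
    then have c: "cos (b * y) = 1" by simp
    then have "sin (b * y) = 0"
      using sin_cos_squared_add[of "b * y"] by simp
    with c have "cis (- (b * y)) = 1"
      by (simp add: complex_eq_iff)
    moreover have "cis (real k * (- (b * y))) = cis (- (b * y)) ^ k"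
      by (rule Complex.DeMoivre[symmetric])
    ultimately have "cis (real k * (- (b * y))) = 1"
      by (simp only: power_one)
    then show ?case
      by (simp add: cis_conv_exp mult_ac)
  qed
  have "rho_hat \<rho> (\<i> * cx (real k * b)) = (\<integral>y. 1 \<partial>\<rho>)"
    unfolding rho_hat_def by (rule integral_cong_AE) (use AE in auto)
  then show ?thesis by simp
qed

text \<open>A zero of 1 - rho_hat on the imaginary axis off the origin would recur at all its
  multiples, so at arbitrarily high frequencies, where the diophantine condition keeps this function
  away from 0.\<close>

lemma rho_hat_neq_1:
  assumes "b \<noteq> 0"
  shows "rho_hat \<rho> (\<i> * cx b) \<noteq> 1"
proof
  assume *: "rho_hat \<rho> (\<i> * cx b) = 1"
  obtain c B where c: "c > 0" "\<And>b. B \<le> \<bar>b\<bar> \<Longrightarrow> c \<le> cmod (1 - rho_hat \<rho> (\<i> * cx b))"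
    by (rule rho_hat_far) blast
  obtain k where "B < real k * \<bar>b\<bar>"
    using reals_Archimedean3[of "\<bar>b\<bar>"] assms by auto
  then have "c \<le> cmod (1 - rho_hat \<rho> (\<i> * cx (real k * b)))"
    by (intro c) (auto simp: abs_mult)
  with c(1) rho_hat_multiple[OF *, of k] show False by simp
qed

text \<open>Compactness handles |b| \<le> |B|: the continuous sum attains its minimum, which is
  positive through \<open>rs\<close> if attained at 0 and through the lattice argument otherwise.
  Beyond, the diophantine bound applies. \<open>B\<close> may be negative, whence its absolute
  value.\<close>

lemma symbol_lower_bound:
  obtains c where "c > 0"
    "\<And>b. c \<le> (cmod (1 - rho_hat \<rho> (\<i> * cx b)))\<^sup>2 + (cmod (rs (\<i> * cx b)))\<^sup>2"
proof -
  let ?f = "\<lambda>b. (cmod (1 - rho_hat \<rho> (\<i> * cx b)))\<^sup>2 + (cmod (rs (\<i> * cx b)))\<^sup>2"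
  obtain c B where c: "c > 0" "\<And>b. B \<le> \<bar>b\<bar> \<Longrightarrow> c \<le> cmod (1 - rho_hat \<rho> (\<i> * cx b))"
    by (rule rho_hat_far) blast
  have lip: "cmod (\<i> * cx b - \<i> * cx b') = \<bar>b - b'\<bar>" for b b'
    unfolding right_diff_distrib[symmetric] norm_mult of_real_diff[symmetric] norm_of_real by simp
  have "continuous_on UNIV (\<lambda>b. rho_hat \<rho> (\<i> * cx b))"
  proof (rule lipschitz_on_continuous_on)
    show "A1-lipschitz_on UNIV (\<lambda>b. rho_hat \<rho> (\<i> * cx b))"
      using rho_hat_diff_le[of "\<i> * cx _" "\<i> * cx _"] e A_nonneg
      by (intro lipschitz_onI) (auto simp: dist_norm lip mult.commute)
  qed
  moreover have "continuous_on UNIV (\<lambda>b. rs (\<i> * cx b))"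
  proof (rule lipschitz_on_continuous_on)
    show "(A2/l)-lipschitz_on UNIV (\<lambda>b. rs (\<i> * cx b))"
      using rs_diff_le[of "\<i> * cx _" "\<i> * cx _"] e A_nonneg l_pos
      by (intro lipschitz_onI) (auto simp: dist_norm lip mult.commute)
  qed
  ultimately have cont: "continuous_on {-\<bar>B\<bar>..\<bar>B\<bar>} ?f"
    by (intro continuous_intros; blast intro: continuous_on_subset)
  have "\<exists>b0\<in>{-\<bar>B\<bar>..\<bar>B\<bar>}. \<forall>b\<in>{-\<bar>B\<bar>..\<bar>B\<bar>}. ?f b0 \<le> ?f b"
    by (rule continuous_attains_inf[OF _ _ cont]) auto
  then obtain b0 where b0: "\<forall>b\<in>{-\<bar>B\<bar>..\<bar>B\<bar>}. ?f b0 \<le> ?f b"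
    by blast
  have "?f b0 > 0"
  proof (cases "b0 = 0")
    case True
    then show ?thesis by (simp add: rs_0 add_nonneg_pos)
  next
    case False
    then show ?thesis using rho_hat_neq_1[of b0] by (auto intro!: add_pos_nonneg)
  qed
  moreover have "min (c\<^sup>2) (?f b0) \<le> ?f b" for b
  proof (cases "b \<in> {-\<bar>B\<bar>..\<bar>B\<bar>}")
    case True
    then show ?thesis using b0[rule_format, OF True] by linarith
  next
    case False
    then have "B \<le> \<bar>b\<bar>" by auto
    then have "c\<^sup>2 \<le> (cmod (1 - rho_hat \<rho> (\<i> * cx b)))\<^sup>2"
      using c by (intro power_mono) auto
    moreover have "0 \<le> (cmod (rs (\<i> * cx b)))\<^sup>2" by simp
    ultimately show ?thesis by linarith
  qed
  ultimately show ?thesis using c(1) by (intro that[of "min (c\<^sup>2) (?f b0)"]) auto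
qed

lemma rho_hat_cnj: "rho_hat \<rho> (cnj z) = cnj (rho_hat \<rho> z)"
  unfolding rho_hat_def by (subst Bochner_Integration.integral_cnj[symmetric]) (simp add: exp_cnj)

lemma rs_cnj: "rs (cnj z) = cnj (rs z)"
  unfolding rs_def ksymb_def by (subst Bochner_Integration.integral_cnj[symmetric]) (simp add: exp_cnj)

text \<open>Continuation of |1 - rho_hat|^2 + |rs|^2 off the imaginary axis, on which
  \<open>- z\<close> is the conjugate of \<open>z\<close>.\<close>

definition psi :: "complex \<Rightarrow> complex" where
  "psi z = (1 - rho_hat \<rho> (- z)) * (1 - rho_hat \<rho> z) + rs (- z) * rs z"

text \<open>One crude constant for the sizes of \<open>1 - rho_hat\<close> and \<open>rs\<close> on
  the strip and for their Lipschitz constants.\<close>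

definition L where "L = 1 + A0 + A1 + A1 / l + A2 / l"

lemma L_bounds:
  "L \<ge> 1" "A1 \<le> L" "A2 / l \<le> L"
  "\<bar>Re z\<bar> \<le> e \<Longrightarrow> cmod (1 - rho_hat \<rho> z) \<le> L"
  "\<bar>Re z\<bar> \<le> e \<Longrightarrow> cmod (rs z) \<le> L"
proof -
  have *: "0 \<le> A0" "0 \<le> A1" "0 \<le> A2 / l" "0 \<le> A1 / l"
    using A_nonneg l_pos by auto
  show "L \<ge> 1" "A1 \<le> L" "A2 / l \<le> L"
    using * by (simp_all add: L_def)
  show "cmod (1 - rho_hat \<rho> z) \<le> L" if "\<bar>Re z\<bar> \<le> e"
    using norm_triangle_ineq4[of 1 "rho_hat \<rho> z"] rho_hat_le[OF that] * by (simp add: L_def)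
  show "cmod (rs z) \<le> L" if "\<bar>Re z\<bar> \<le> e"
    using integrable_rs(2)[OF that] * by (simp add: L_def)
qed

text \<open>Two products, each with two factors of size and Lipschitz constant at most
  \<open>L\<close>, contribute 2 L^2 each.\<close>

lemma psi_diff_le:
  assumes "\<bar>Re z\<bar> \<le> e" "\<bar>Re z'\<bar> \<le> e"
  shows "cmod (psi z - psi z') \<le> 4 * L\<^sup>2 * cmod (z - z')"
proof -
  have L0: "0 \<le> L" using L_bounds(1) by linarith
  have prod: "cmod (a * b - a' * b') \<le> 2 * L\<^sup>2 * cmod (z - z')"
    if "cmod a \<le> L" "cmod b' \<le> L" "cmod (a - a') \<le> L * cmod (z - z')" "cmod (b - b') \<le> L * cmod (z - z')" for a b a' b'
  proof -
    have "a * b - a' * b' = a * (b - b') + (a - a') * b'"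
      by (simp add: algebra_simps)
    then have "cmod (a * b - a' * b') \<le> cmod a * cmod (b - b') + cmod (a - a') * cmod b'"
      by (metis norm_mult norm_triangle_ineq)
    also have "\<dots> \<le> L * (L * cmod (z - z')) + (L * cmod (z - z')) * L"
      using that L0 by (intro add_mono mult_mono) auto
    finally show ?thesis by (simp add: power2_eq_square mult_ac)
  qed
  have r: "cmod ((1 - rho_hat \<rho> u) - (1 - rho_hat \<rho> u')) \<le> L * cmod (u - u')"
       "cmod (rs u - rs u') \<le> L * cmod (u - u')" if "\<bar>Re u\<bar> \<le> e" "\<bar>Re u'\<bar> \<le> e" for u u'
  proof -
    have "cmod ((1 - rho_hat \<rho> u) - (1 - rho_hat \<rho> u')) \<le> cmod (u - u') * A1"
      using rho_hat_diff_le[OF that] by (simp add: norm_minus_commute)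
    also have "\<dots> \<le> cmod (u - u') * L"
      by (intro mult_left_mono L_bounds) auto
    finally show "cmod ((1 - rho_hat \<rho> u) - (1 - rho_hat \<rho> u')) \<le> L * cmod (u - u')"
      by (simp only: mult.commute)
    have "cmod (rs u - rs u') \<le> cmod (u - u') * (A2 / l)"
      by (rule rs_diff_le[OF that])
    also have "\<dots> \<le> cmod (u - u') * L"
      by (intro mult_left_mono L_bounds) auto
    finally show "cmod (rs u - rs u') \<le> L * cmod (u - u')"
      by (simp only: mult.commute)
  qed
  have n: "cmod (- z - - z') = cmod (z - z')"
    by (simp add: norm_minus_commute)
  have "psi z - psi z' = ((1 - rho_hat \<rho> (- z)) * (1 - rho_hat \<rho> z) - (1 - rho_hat \<rho> (- z')) * (1 - rho_hat \<rho> z'))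
      + (rs (- z) * rs z - rs (- z') * rs z')"
    by (simp add: psi_def)
  also have "cmod \<dots> \<le> 2 * L\<^sup>2 * cmod (z - z') + 2 * L\<^sup>2 * cmod (z - z')"
    using r[of z z'] r[of "-z" "-z'"] assms unfolding n
    by (intro norm_triangle_le add_mono prod L_bounds) auto
  finally show ?thesis by (simp add: mult_ac)
qed

lemma psi_imaginary:
  "psi (\<i> * cx b) = cx ((cmod (1 - rho_hat \<rho> (\<i> * cx b)))\<^sup>2 + (cmod (rs (\<i> * cx b)))\<^sup>2)"
proof -
  have "- (\<i> * cx b) = cnj (\<i> * cx b)" by simp
  then have "psi (\<i> * cx b)
     = cnj (1 - rho_hat \<rho> (\<i> * cx b)) * (1 - rho_hat \<rho> (\<i> * cx b)) + cnj (rs (\<i> * cx b)) * rs (\<i> * cx b)"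
    unfolding psi_def by (simp only: rho_hat_cnj rs_cnj complex_cnj_diff complex_cnj_one)
  then show ?thesis
    unfolding of_real_add complex_norm_square by (simp only: mult.commute)
qed

text \<open>Second-order expansion at 0: the mean of exp (- s y) is at most 1 - s l + s^2 A2, and
  the linear term wins for small s because the drift is positive.\<close>

lemma laplace_less_1:
  assumes s: "0 < s" "s \<le> e" "s * A2 < l"
  shows "(LINT y|\<rho>. exp (- s * y)) < 1"
proof -
  have pt: "exp (- s * y) \<le> 1 - s * y + s\<^sup>2 * (y\<^sup>2 * exp (e * \<bar>y\<bar>))" for y
  proof -
    let ?x = "- s * y"
    have "cmod (exp (cx ?x) - exp 0) \<le> exp \<bar>?x\<bar> * cmod (cx ?x - 0)"
      by (rule norm_exp_diff_le) auto
    then have 1: "\<bar>exp ?x - 1\<bar> \<le> exp \<bar>?x\<bar> * \<bar>?x\<bar>"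
      by (metis exp_of_real exp_zero norm_of_real of_real_1 of_real_diff diff_zero)
    \<comment> \<open>Multiplied by exp x this gives exp x \<le> 1 + x exp x = 1 + x + x (exp x -
      1), whose last term is quadratic by the preceding bound.\<close>
    have "1 - ?x \<le> exp (- ?x)"
      using exp_ge_add_one_self[of "- ?x"] by simp
    then have "exp ?x * (1 - ?x) \<le> exp ?x * exp (- ?x)"
      by (intro mult_left_mono) auto
    then have "exp ?x * (1 - ?x) \<le> 1"
      by (simp add: exp_add[symmetric])
    then have "exp ?x \<le> 1 + ?x + ?x * (exp ?x - 1)"
      by (simp add: algebra_simps)
    also have "?x * (exp ?x - 1) \<le> \<bar>?x\<bar> * (exp \<bar>?x\<bar> * \<bar>?x\<bar>)"
      by (rule order_trans[OF abs_ge_self]) (simp only: abs_mult[of ?x], rule mult_left_mono[OF 1 abs_ge_zero])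
    also have "\<bar>?x\<bar> * (exp \<bar>?x\<bar> * \<bar>?x\<bar>) = s\<^sup>2 * (y\<^sup>2 * exp (s * \<bar>y\<bar>))"
      using s by (simp add: abs_mult power2_eq_square)
    also have "\<dots> \<le> s\<^sup>2 * (y\<^sup>2 * exp (e * \<bar>y\<bar>))"
      using s by (intro mult_left_mono) (auto intro: mult_right_mono)
    finally show ?thesis by simp
  qed
  have ie: "integrable \<rho> (\<lambda>y. exp (- s * y))"
  proof (rule Bochner_Integration.integrable_bound[OF moment_integrable(1)])
    have "- s * y \<le> e * \<bar>y\<bar>" for y
      using exp_y_le[of "cx s" y] s by simp
    then show "AE y in \<rho>. norm (exp (- s * y)) \<le> norm (exp (e * \<bar>y\<bar>))" by auto
  qed measurable
  have i1: "integrable \<rho> (\<lambda>y. 1 - s * y)"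
    by (intro Bochner_Integration.integrable_diff integrable_mult_right moment_integrable(4)) auto
  have i2: "integrable \<rho> (\<lambda>y. s\<^sup>2 * (y\<^sup>2 * exp (e * \<bar>y\<bar>)))"
    by (intro integrable_mult_right moment_integrable(3))
  have "(LINT y|\<rho>. exp (- s * y)) \<le> (LINT y|\<rho>. (1 - s * y) + s\<^sup>2 * (y\<^sup>2 * exp (e * \<bar>y\<bar>)))"
    by (intro integral_mono ie pt Bochner_Integration.integrable_add i1 i2)
  also have "\<dots> = (LINT y|\<rho>. 1 - s * y) + s\<^sup>2 * A2"
    unfolding A2_def by (subst Bochner_Integration.integral_add[OF i1 i2]) simp
  also have "(LINT y|\<rho>. 1 - s * y) = 1 - s * l"
    unfolding l_eq using moment_integrable(4) by (subst Bochner_Integration.integral_diff) auto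
  also have "1 - s * l + s\<^sup>2 * A2 = 1 - s * (l - s * A2)"
    by (simp add: power2_eq_square algebra_simps)
  also have "\<dots> < 1" using s by simp
  finally show ?thesis .
qed

text \<open>\<open>t\<close> is the contraction ratio of the operator with symbol 1 - psi / K,
  uniform over the closed strip; the last condition makes the renewal series converge geometrically
  at every positive weight up to \<open>s0\<close>.\<close>

definition good_strip :: "real \<Rightarrow> real \<Rightarrow> real \<Rightarrow> bool" where
  "good_strip s0 K t \<longleftrightarrow> 0 < s0 \<and> s0 \<le> e \<and> 0 < K \<and> 0 < t \<and> t < 1 \<and>
    (\<forall>z. \<bar>Re z\<bar> \<le> s0 \<longrightarrow> cmod (1 - psi z / cx K) \<le> t) \<and>
    (\<forall>s. 0 < s \<and> s \<le> s0 \<longrightarrow> (LINT y|\<rho>. exp (- s * y)) < 1)"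

lemma good_strip_exists: "\<exists>s0 K t. good_strip s0 K t"
proof -
  obtain c where c: "c > 0"
    "\<And>b. c \<le> (cmod (1 - rho_hat \<rho> (\<i> * cx b)))\<^sup>2 + (cmod (rs (\<i> * cx b)))\<^sup>2"
    by (rule symbol_lower_bound) blast
  let ?f = "\<lambda>b. (cmod (1 - rho_hat \<rho> (\<i> * cx b)))\<^sup>2 + (cmod (rs (\<i> * cx b)))\<^sup>2"
  \<comment> \<open>An upper bound of the symbol on the imaginary axis, so that 1 - f / K lies
    between 0 and 1 - c / K there.\<close>
  define K where "K = 2 * L\<^sup>2"
  have K: "K > 0" using L_bounds(1) by (simp add: K_def)
  have fK: "?f b \<le> K" for b
  proof -
    have "?f b \<le> L\<^sup>2 + L\<^sup>2"
      using e by (intro add_mono power_mono L_bounds) auto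
    then show ?thesis by (simp add: K_def)
  qed
  have cK: "c \<le> K" using c(2)[of 0] fK[of 0] by linarith
  \<comment> \<open>The second bound limits the change of \<open>psi\<close> from the axis to any
    point of the strip to c / 2, which leaves the ratio 1 - c / (2 K). The third ensures s A2 < l;
    A2 + 1 guards against a zero denominator.\<close>
  define s0 where "s0 = min e (min (c / (8 * L\<^sup>2)) (l / (2 * (A2 + 1))))"
  define t where "t = 1 - c / (2 * K)"
  have L2: "L\<^sup>2 > 0" using L_bounds(1) by simp
  have s0: "0 < s0" "s0 \<le> e"
    using e c L2 l_pos A_nonneg by (auto simp: s0_def)
  have s1: "4 * L\<^sup>2 * s0 \<le> c / 2"
  proof -
    have "s0 \<le> c / (8 * L\<^sup>2)" by (simp add: s0_def)
    then show ?thesis using L2 by (simp add: field_simps)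
  qed
  have t: "0 < t" "t < 1"
    using c K cK by (auto simp: t_def field_simps)
  have "cmod (1 - psi z / cx K) \<le> t" if z: "\<bar>Re z\<bar> \<le> s0" for z
  proof -
    let ?z' = "\<i> * cx (Im z)"
    have "cmod (psi z - psi ?z') \<le> 4 * L\<^sup>2 * cmod (z - ?z')"
      using z s0 by (intro psi_diff_le) auto
    also have "z - ?z' = cx (Re z)"
      by (simp add: complex_eq_iff)
    also have "4 * L\<^sup>2 * cmod (cx (Re z)) \<le> 4 * L\<^sup>2 * s0"
      using z L2 by (intro mult_left_mono) auto
    finally have d: "cmod (psi z - psi ?z') \<le> c / 2" using s1 by linarith
    have "1 - psi z / cx K = cx (1 - ?f (Im z) / K) - (psi z - psi ?z') / cx K"
      unfolding psi_imaginary using K by (simp add: field_simps)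
    also have "cmod \<dots> \<le> cmod (cx (1 - ?f (Im z) / K)) + cmod ((psi z - psi ?z') / cx K)"
      by (rule norm_triangle_ineq4)
    also have "\<dots> \<le> (1 - c / K) + (c / 2) / K"
    proof (rule add_mono)
      have "0 \<le> 1 - ?f (Im z) / K" using fK[of "Im z"] K by simp
      moreover have "c / K \<le> ?f (Im z) / K" using c(2)[of "Im z"] K by (intro divide_right_mono) auto
      ultimately show "cmod (cx (1 - ?f (Im z) / K)) \<le> 1 - c / K"
        unfolding norm_of_real by linarith
      show "cmod ((psi z - psi ?z') / cx K) \<le> (c / 2) / K"
        unfolding norm_divide norm_of_real abs_of_pos[OF K] using K by (intro divide_right_mono d) auto
    qed
    also have "\<dots> = t" using K by (simp add: t_def field_simps)
    finally show ?thesis .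
  qed
  moreover have "(LINT y|\<rho>. exp (- s * y)) < 1" if s: "0 < s" "s \<le> s0" for s
  proof (rule laplace_less_1)
    show "s \<le> e" using s s0 by linarith
    have "s \<le> l / (2 * (A2 + 1))" using s by (simp add: s0_def)
    then have "s * (2 * (A2 + 1)) \<le> l"
      using A_nonneg by (simp add: field_simps)
    moreover have "s * A2 < s * (2 * (A2 + 1))"
      using s A_nonneg by (intro mult_strict_left_mono) auto
    ultimately show "s * A2 < l" by linarith
  qed (use s in auto)
  ultimately have "good_strip s0 K t"
    using s0 K t by (auto simp: good_strip_def)
  then show ?thesis by blast
qed

end

section \<open>Exponential kernels on a half-line\<close>

lemma nn_integral_exp_half_line:
  fixes c :: real
  assumes "c > 0"
  shows "(\<integral>\<^sup>+x. ennreal (exp (- c * x)) * indicator {0..} x \<partial>lborel) = ennreal (1 / c)"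
proof -
  have "(\<integral>\<^sup>+x. ennreal (exp (- c * x)) * indicator {0..} x \<partial>lborel) = ennreal (0 - (- (1 / c) * exp (- c * 0)))"
  proof (rule nn_integral_FTC_atLeast)
    show "((\<lambda>y. - (1 / c) * exp (- c * y)) has_real_derivative exp (- c * y)) (at y)" for y
      using assms by (auto intro!: derivative_eq_intros)
    have "filterlim (\<lambda>y. - c * y) at_bot at_top"
      using assms by (intro filterlim_tendsto_neg_mult_at_bot[OF tendsto_const] filterlim_ident) auto
    from tendsto_mult_right_zero[OF filterlim_compose[OF exp_at_bot this], of "- (1 / c)"]
    show "((\<lambda>y. - (1 / c) * exp (- c * y)) \<longlongrightarrow> 0) at_top" by simp
  qed auto
  then show ?thesis by simp
qed

lemma nn_integral_exp_abs_finite: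
  fixes c :: real
  assumes "c > 0"
  shows "(\<integral>\<^sup>+x. ennreal (exp (- c * \<bar>x\<bar>)) \<partial>lborel) < \<infinity>"
proof -
  let ?h = "\<lambda>x. ennreal (exp (- c * x)) * indicator {0..} x :: ennreal"
  have r: "(\<integral>\<^sup>+x. ?h (- x) \<partial>lborel) = ennreal (1 / c)"
    using nn_integral_real_affine[of ?h "-1" 0] nn_integral_exp_half_line[OF assms] by simp
  have "(\<integral>\<^sup>+x. ennreal (exp (- c * \<bar>x\<bar>)) \<partial>lborel) \<le> (\<integral>\<^sup>+x. ?h x + ?h (- x) \<partial>lborel)"
    by (intro nn_integral_mono) (auto simp: indicator_def)
  also have "\<dots> = ennreal (1 / c) + ennreal (1 / c)"
    using nn_integral_exp_half_line[OF assms] r by (subst nn_integral_add) auto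
  finally show ?thesis by (rule le_less_trans) simp
qed

definition expo :: "real \<Rightarrow> real \<Rightarrow> complex" where
  "expo a x = cx (indicator {0<..} x * exp (- a * x))"

lemma borel_measurable_expo [measurable]: "expo a \<in> borel_measurable borel"
  unfolding expo_def[abs_def] by measurable

lemma norm_expo: "cmod (expo a x) = indicator {0<..} x * exp (- a * x)"
  by (simp add: expo_def indicator_def)

lemma wn1_expo:
  assumes "s < a"
  shows "wn1 s (expo a) \<le> ennreal (1 / (a - s))"
proof -
  have "wn1 s (expo a) \<le> (\<integral>\<^sup>+x. ennreal (exp (- (a - s) * x)) * indicator {0..} x \<partial>lborel)"
    unfolding wn1_def norm_expo by (intro nn_integral_mono) (auto simp: indicator_def exp_add[symmetric] algebra_simps)
  also have "\<dots> = ennreal (1 / (a - s))"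
    using assms by (intro nn_integral_exp_half_line) simp
  finally show ?thesis .
qed

lemma expo_L1L2:
  assumes "s < a"
  shows "expo a \<in> L1L2 s"
proof -
  have "wn2 s (expo a) \<le> (\<integral>\<^sup>+x. ennreal (exp (- (2 * (a - s)) * x)) * indicator {0..} x \<partial>lborel)"
    unfolding wn2_def norm_expo by (intro nn_integral_mono) (auto simp: indicator_def exp_add[symmetric] exp_double[symmetric] algebra_simps)
  also have "\<dots> = ennreal (1 / (2 * (a - s)))"
    using assms by (intro nn_integral_exp_half_line) simp
  finally have "wn2 s (expo a) < \<infinity>" by (rule le_less_trans) simp
  moreover have "wn1 s (expo a) < \<infinity>" using wn1_expo[OF assms] by (rule le_less_trans) simp
  ultimately show ?thesis by (simp add: L1L2_def)
qed

text \<open>The function \<open>expo a\<close> is the fundamental solution of \<open>f' + a f = g\<close>.\<close>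

lemma expo_representation:
  fixes f f' :: "real \<Rightarrow> complex"
  assumes a: "a > 0"
    and der: "\<And>x. (f has_vector_derivative f' x) (at x)" and cont: "continuous_on UNIV f'"
    and bf: "\<And>x. cmod (f x) \<le> A" and bf': "\<And>x. cmod (f' x) \<le> A"
  shows "f x = (\<integral>t. expo a t * (f' (x - t) + a * f (x - t)) \<partial>lborel)"
proof -
  let ?g = "\<lambda>x. f' x + a * f x"
  have cf: "continuous_on UNIV f"
    using der by (intro continuous_at_imp_continuous_on ballI has_vector_derivative_continuous) auto
  have cg: "continuous_on UNIV ?g" by (intro continuous_intros cf cont)
  have [measurable]: "f \<in> borel_measurable borel" "f' \<in> borel_measurable borel"
    by (rule borel_measurable_continuous_onI[OF cf] borel_measurable_continuous_onI[OF cont])+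
  have gb: "cmod (?g x) \<le> A + a * A" for x
    using bf[of x] bf'[of x] a by (intro norm_triangle_le add_mono) (auto simp: norm_mult)
  have A: "A \<ge> 0" using bf[of 0] norm_ge_zero[of "f 0"] by linarith
  let ?u = "\<lambda>t. exp (- cx a * cx t) * ?g (x - t)"
  have ein: "einterval 0 \<infinity> = {0<..}" by (auto simp: einterval_def zero_ereal_def)
  have ind: "indicator {0<..} t *\<^sub>R ?u t = expo a t * ?g (x - t)" for t
    by (simp add: expo_def indicator_def exp_of_real[symmetric])
  have ie: "integrable lborel (expo a)"
    using L1L2_integrable_weight[OF expo_L1L2[of 0 a]] a by simp
  have i: "integrable lborel (\<lambda>t. expo a t * ?g (x - t))"
  proof (rule Bochner_Integration.integrable_bound)
    show "integrable lborel (\<lambda>t. cmod (expo a t) * (A + a * A))"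
      using ie by auto
    show "AE t in lborel. norm (expo a t * ?g (x - t)) \<le> norm (cmod (expo a t) * (A + a * A))"
    proof (rule AE_I2)
      fix t
      have "cmod (expo a t) * cmod (?g (x - t)) \<le> cmod (expo a t) * (A + a * A)"
        by (rule mult_left_mono[OF gb]) simp
      then show "norm (expo a t * ?g (x - t)) \<le> norm (cmod (expo a t) * (A + a * A))"
        unfolding norm_mult real_norm_def abs_mult using A a by simp
    qed
  qed measurable
  have "(LBINT t=0..\<infinity>. ?u t) = 0 - (- f x)"
  proof (rule interval_integral_FTC_integrable[where F="\<lambda>t. - (exp (- cx a * cx t) * f (x - t))"])
    show "((\<lambda>t. - (exp (- cx a * cx t) * f (x - t))) has_vector_derivative ?u t) (at t)" for t
    proof -
      have d1: "((\<lambda>t. exp (- cx a * cx t)) has_vector_derivative - cx a * exp (- cx a * cx t)) (at t)"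
        by (rule has_vector_derivative_eq_rhs, rule field_vector_diff_chain_at[where g="exp" and f="\<lambda>t. - cx a * cx t", unfolded o_def])
          (auto intro!: derivative_eq_intros)
      have "((\<lambda>t. x - t) has_vector_derivative - 1) (at t)"
        by (auto intro!: derivative_eq_intros)
      from vector_diff_chain_at[OF this der]
      have d2: "((\<lambda>t. f (x - t)) has_vector_derivative - f' (x - t)) (at t)"
        by (simp add: o_def)
      show ?thesis
        by (rule has_vector_derivative_eq_rhs[OF has_vector_derivative_minus[OF has_vector_derivative_mult[OF d1 d2]]])
           (simp add: algebra_simps)
    qed
    show "isCont ?u t" for t
    proof -
      have "continuous_on UNIV (\<lambda>t. ?g (x - t))"
        by (rule continuous_on_compose2[OF cg]) (auto intro!: continuous_intros)
      then have "continuous_on UNIV ?u" by (rule continuous_on_mult[rotated]) (intro continuous_intros)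
      then show ?thesis by (simp add: continuous_on_eq_continuous_at)
    qed
    show "set_integrable lborel (einterval 0 \<infinity>) ?u"
      unfolding set_integrable_def ein ind by (rule i)
    have "((\<lambda>t. - (exp (- cx a * cx t) * f (x - t))) \<longlongrightarrow> - (exp (- cx a * cx 0) * f (x - 0))) (at_right 0)"
      using cf by (intro tendsto_intros isCont_tendsto_compose[of _ f]) (auto simp: continuous_on_eq_continuous_at)
    then show "(((\<lambda>t. - (exp (- cx a * cx t) * f (x - t))) \<circ> real_of_ereal) \<longlongrightarrow> - f x) (at_right 0)"
      by (simp add: zero_ereal_def ereal_tendsto_simps)
    have "((\<lambda>t. - (exp (- cx a * cx t) * f (x - t))) \<longlongrightarrow> 0) at_top"
    proof (rule Lim_null_comparison)
      show "\<forall>\<^sub>F t in at_top. norm (- (exp (- cx a * cx t) * f (x - t))) \<le> exp (- a * t) * A"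
        using bf by (auto simp: norm_mult intro!: mult_left_mono)
      have "filterlim (\<lambda>y. - a * y) at_bot at_top"
        using a by (intro filterlim_tendsto_neg_mult_at_bot[OF tendsto_const] filterlim_ident) auto
      from tendsto_mult_left_zero[OF filterlim_compose[OF exp_at_bot this]]
      show "((\<lambda>t. exp (- a * t) * A) \<longlongrightarrow> 0) at_top" .
    qed
    then show "(((\<lambda>t. - (exp (- cx a * cx t) * f (x - t))) \<circ> real_of_ereal) \<longlongrightarrow> 0) (at_left \<infinity>)"
      by (simp add: ereal_tendsto_simps)
  qed simp
  then show ?thesis
    unfolding interval_lebesgue_integral_def ein set_lebesgue_integral_def ind by simp
qed

section \<open>The renewal measure\<close>

text \<open>The measure is given through its values on sets, hence an induction over nonnegative
  Borel functions; its monotone step exchanges a supremum with the series.\<close>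

lemma nn_integral_renewal_measure:
  assumes "f \<in> borel_measurable borel"
  shows "(\<integral>\<^sup>+x. f x \<partial>renewal_measure \<rho>) = (\<Sum>n. \<integral>\<^sup>+x. f x \<partial>conv_power (reflect \<rho>) n)"
  using assms
proof (induction f rule: borel_measurable_induct)
  case (cong f g)
  then show ?case by (simp cong: nn_integral_cong)
next
  case (set A)
  then show ?case by (simp add: emeasure_renewal_measure)
next
  case (mult u c)
  then show ?case by (simp add: nn_integral_cmult cong: measurable_cong_sets)
next
  case (add u v)
  then show ?case by (simp add: nn_integral_add suminf_add cong: measurable_cong_sets)
next
  case (seq U)
  have sup: "(\<integral>\<^sup>+x. (SUP i. U i) x \<partial>M) = (SUP i. \<integral>\<^sup>+x. U i x \<partial>M)" if "sets M = sets borel" for M :: "real measure"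
    unfolding SUP_apply using seq that
    by (intro nn_integral_monotone_convergence_SUP) (auto cong: measurable_cong_sets)
  have "(\<Sum>n. \<integral>\<^sup>+x. (SUP i. U i) x \<partial>conv_power (reflect \<rho>) n)
     = (\<Sum>n. SUP i. \<integral>\<^sup>+x. U i x \<partial>conv_power (reflect \<rho>) n)"
    by (subst sup) auto
  also have "\<dots> = (SUP i. \<Sum>n. \<integral>\<^sup>+x. U i x \<partial>conv_power (reflect \<rho>) n)"
    by (rule ennreal_suminf_SUP_eq) (use seq in \<open>auto simp: incseq_def le_fun_def intro!: nn_integral_mono\<close>)
  also have "\<dots> = (SUP i. \<integral>\<^sup>+x. U i x \<partial>renewal_measure \<rho>)"
    by (simp add: seq)
  also have "\<dots> = (\<integral>\<^sup>+x. (SUP i. U i) x \<partial>renewal_measure \<rho>)"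
    by (rule sup[symmetric]) simp
  finally show ?case by (rule sym)
qed

text \<open>Each convolution power is dominated by the renewal measure, so integrability passes to
  it. The series is obtained for nonnegative functions and extended through positive, negative, real
  and imaginary parts.\<close>

lemma integral_renewal_measure_sums:
  fixes f :: "real \<Rightarrow> complex"
  assumes "integrable (renewal_measure \<rho>) f"
  shows "(\<lambda>n. \<integral>x. f x \<partial>conv_power (reflect \<rho>) n) sums (\<integral>x. f x \<partial>renewal_measure \<rho>)"
proof -
  let ?G = "renewal_measure \<rho>" and ?P = "conv_power (reflect \<rho>)"
  have meas: "g \<in> borel_measurable borel" if "integrable ?G g" for g :: "real \<Rightarrow> 'b::{banach,second_countable_topology}"
    using borel_measurable_integrable[OF that] by (simp cong: measurable_cong_sets)
  have intP: "integrable (?P n) g" if "integrable ?G g" for n and g :: "real \<Rightarrow> 'b::{banach,second_countable_topology}"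
  proof (rule integrableI_bounded)
    show "g \<in> borel_measurable (?P n)" using meas[OF that] by (simp cong: measurable_cong_sets)
    have "(\<integral>\<^sup>+x. norm (g x) \<partial>?P n) \<le> (\<Sum>n. \<integral>\<^sup>+x. norm (g x) \<partial>?P n)"
      using sum_le_suminf[of "\<lambda>n. \<integral>\<^sup>+x. norm (g x) \<partial>?P n" "{n}"] by auto
    also have "\<dots> = (\<integral>\<^sup>+x. norm (g x) \<partial>?G)"
      using meas[OF that] by (intro nn_integral_renewal_measure[symmetric]) measurable
    also have "\<dots> < \<infinity>" using that by (simp add: integrable_iff_bounded)
    finally show "(\<integral>\<^sup>+x. norm (g x) \<partial>?P n) < \<infinity>" .
  qed
  have nonneg: "(\<lambda>n. \<integral>x. g x \<partial>?P n) sums (\<integral>x. g x \<partial>?G)"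
    if g: "integrable ?G g" "\<And>x. 0 \<le> g x" for g :: "real \<Rightarrow> real"
  proof -
    have "(\<Sum>n. ennreal (\<integral>x. g x \<partial>?P n)) = (\<Sum>n. \<integral>\<^sup>+x. g x \<partial>?P n)"
      using intP[OF g(1)] g(2) by (simp add: nn_integral_eq_integral)
    also have "\<dots> = (\<integral>\<^sup>+x. g x \<partial>?G)"
      using meas[OF g(1)] by (intro nn_integral_renewal_measure[symmetric]) measurable
    also have "\<dots> = ennreal (\<integral>x. g x \<partial>?G)"
      using g by (simp add: nn_integral_eq_integral)
    finally have "(\<lambda>n. ennreal (\<integral>x. g x \<partial>?P n)) sums ennreal (\<integral>x. g x \<partial>?G)"
      by (metis summable_sums summableI)
    then show ?thesis
      using g(2) by (subst (asm) sums_ennreal) (auto intro!: integral_nonneg_AE)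
  qed
  have real: "(\<lambda>n. \<integral>x. g x \<partial>?P n) sums (\<integral>x. g x \<partial>?G)" if g: "integrable ?G g" for g :: "real \<Rightarrow> real"
  proof -
    have i: "integrable ?G (\<lambda>x. max 0 (g x))" "integrable ?G (\<lambda>x. max 0 (- g x))"
      using g by auto
    have eq: "g x = max 0 (g x) - max 0 (- g x)" for x by (simp add: max_def)
    have eqP: "(\<integral>x. g x \<partial>?P n) = (\<integral>x. max 0 (g x) \<partial>?P n) - (\<integral>x. max 0 (- g x) \<partial>?P n)" for n
      by (subst eq, rule Bochner_Integration.integral_diff) (intro intP i)+
    have eqG: "(\<integral>x. g x \<partial>?G) = (\<integral>x. max 0 (g x) \<partial>?G) - (\<integral>x. max 0 (- g x) \<partial>?G)"
      by (subst eq, rule Bochner_Integration.integral_diff) (intro i)+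
    show ?thesis
      unfolding eqP eqG by (intro sums_diff nonneg i) auto
  qed
  show ?thesis
    unfolding sums_complex_iff
    using real[OF integrable_Re[OF assms]] real[OF integrable_Im[OF assms]]
    by (simp add: integral_Re integral_Im assms intP)
qed

text \<open>On a bounded interval exp (s y) is bounded below, so a finite exponential moment bounds
  the mass there even if the total mass is infinite. Sigma-finiteness is what Fubini's theorem asks
  for later.\<close>

lemma exp_moment_finite_imp:
  assumes M: "sets M = sets (borel :: real measure)" and fin: "(\<integral>\<^sup>+y. ennreal (exp (s * y)) \<partial>M) < \<infinity>"
  shows "locally_finite M" "sigma_finite_measure M"
proof -
  note [measurable_cong] = M
  have ball: "emeasure M {-m..m} < \<infinity>" for m :: real
  proof -
    have "emeasure M {-m..m} = (\<integral>\<^sup>+y. indicator {-m..m} y \<partial>M)"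
      using M by (intro nn_integral_indicator[symmetric]) simp
    also have "\<dots> \<le> (\<integral>\<^sup>+y. ennreal (exp (\<bar>s\<bar> * m)) * ennreal (exp (s * y)) \<partial>M)"
    proof (rule nn_integral_mono)
      fix y
      have "1 \<le> exp (\<bar>s\<bar> * m) * exp (s * y)" if "\<bar>y\<bar> \<le> m"
      proof -
        have "- (s * y) \<le> \<bar>s\<bar> * \<bar>y\<bar>" by (metis abs_ge_minus_self abs_mult)
        also have "\<dots> \<le> \<bar>s\<bar> * m" using that by (intro mult_left_mono) auto
        finally show ?thesis by (simp add: exp_add[symmetric])
      qed
      then show "indicator {-m..m} y \<le> ennreal (exp (\<bar>s\<bar> * m)) * ennreal (exp (s * y))"
        by (auto simp: indicator_def simp flip: ennreal_mult)
    qed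
    also have "\<dots> = ennreal (exp (\<bar>s\<bar> * m)) * (\<integral>\<^sup>+y. ennreal (exp (s * y)) \<partial>M)"
      by (rule nn_integral_cmult) measurable
    also have "\<dots> < \<infinity>" using fin by (simp add: ennreal_mult_less_top)
    finally show ?thesis .
  qed
  show "locally_finite M"
    unfolding locally_finite_def
  proof (intro conjI M allI impI)
    fix K :: "real set" assume "compact K"
    then obtain m where "\<And>x. x \<in> K \<Longrightarrow> \<bar>x\<bar> \<le> m"
      using compact_imp_bounded bounded_iff by (metis real_norm_def)
    then have "K \<subseteq> {-m..m}" by (auto simp only: abs_le_iff atLeastAtMost_iff subset_iff minus_le_iff)
    then have "emeasure M K \<le> emeasure M {-m..m}"
      using M by (intro emeasure_mono) auto
    then show "emeasure M K < \<infinity>" using ball[of m] by (rule le_less_trans)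
  qed
  show "sigma_finite_measure M"
  proof
    have sp: "space M = UNIV" using sets_eq_imp_space_eq[OF M] by simp
    show "\<exists>A. countable A \<and> A \<subseteq> sets M \<and> \<Union> A = space M \<and> (\<forall>a\<in>A. emeasure M a \<noteq> \<infinity>)"
    proof (intro exI[of _ "range (\<lambda>n::nat. {- real n..real n})"] conjI)
      show "\<Union> (range (\<lambda>n::nat. {- real n..real n})) = space M"
        unfolding sp
      proof safe
        fix x :: real
        obtain n where "\<bar>x\<bar> \<le> real n" using real_arch_simple by blast
        then show "x \<in> (\<Union>n. {- real n..real n})" by (auto intro!: exI[of _ n])
      qed auto
    qed (use M ball in \<open>auto simp: less_top\<close>)
  qed
qed

section \<open>Exponential moments and transforms of the two measures\<close>

lemma T_measure_eq:
  assumes "l > 0"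
  shows "T_measure l = density lborel (\<lambda>y. ennreal (1 / l * indicator {..0} y))"
  unfolding T_measure_def by (intro density_cong) (auto simp: indicator_def)

lemma T_exp_moment:
  assumes "s > 0" "l > 0"
  shows "(\<integral>\<^sup>+y. ennreal (exp (s * y)) \<partial>T_measure l) < \<infinity>"
proof -
  have "(\<integral>\<^sup>+y. ennreal (exp (s * y)) \<partial>T_measure l) = (\<integral>\<^sup>+y. ennreal (1 / l) * (indicator {..0} y * ennreal (exp (s * y))) \<partial>lborel)"
    unfolding T_measure_def by (subst nn_integral_density) (auto simp: mult.assoc)
  also have "\<dots> = ennreal (1 / l) * (\<integral>\<^sup>+y. indicator {..0} y * ennreal (exp (s * y)) \<partial>lborel)"
    by (rule nn_integral_cmult) measurable
  also have "(\<integral>\<^sup>+y. indicator {..0} y * ennreal (exp (s * y)) \<partial>lborel) \<le> (\<integral>\<^sup>+x. ennreal (exp (- s * \<bar>x\<bar>)) \<partial>lborel)"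
    by (intro nn_integral_mono) (auto simp: indicator_def)
  finally show ?thesis
    using nn_integral_exp_abs_finite[OF assms(1)] by (auto simp: ennreal_mult_less_top mult_left_mono intro: le_less_trans)
qed

text \<open>The representation formula for the bounded function exp (i Im z y), taken at y = 0 with
  a = Re z, says that z times the integral of exp (- z t) over t > 0 is 1.\<close>

lemma T_symbol:
  assumes z: "Re z > 0" and l: "l > 0"
  shows "(\<integral>y. exp (z * cx y) \<partial>T_measure l) = 1 / (cx l * z)"
proof -
  let ?f = "\<lambda>y. exp (\<i> * cx (Im z) * cx y)"
  have z0: "z \<noteq> 0" using z by auto
  have "?f 0 = (\<integral>t. expo (Re z) t * (\<i> * cx (Im z) * ?f (0 - t) + cx (Re z) * ?f (0 - t)) \<partial>lborel)"
  proof (rule expo_representation[OF z, where A="1 + \<bar>Im z\<bar>"])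
    show "(?f has_vector_derivative \<i> * cx (Im z) * ?f x) (at x)" for x
      by (rule has_vector_derivative_eq_rhs, rule field_vector_diff_chain_at[where g="exp" and f="\<lambda>y. \<i> * cx (Im z) * cx y", unfolded o_def])
        (auto intro!: derivative_eq_intros)
  qed (auto intro!: continuous_intros simp: norm_mult)
  also have "\<dots> = (\<integral>t. z * (indicator {0<..} t *\<^sub>R exp (z * cx (- t))) \<partial>lborel)"
  proof (intro Bochner_Integration.integral_cong refl)
    fix t
    have "z * exp (z * cx (- t)) = cx (exp (- Re z * t)) * ((\<i> * cx (Im z) + cx (Re z)) * ?f (0 - t))"
    proof -
      have "z * cx (- t) = cx (- Re z * t) + \<i> * cx (Im z) * cx (0 - t)"
        by (simp add: complex_eq_iff)
      moreover have "\<i> * cx (Im z) + cx (Re z) = z" by (simp add: complex_eq_iff)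
      ultimately show ?thesis by (simp only: exp_add exp_of_real mult_ac)
    qed
    then show "expo (Re z) t * (\<i> * cx (Im z) * ?f (0 - t) + cx (Re z) * ?f (0 - t))
        = z * (indicator {0<..} t *\<^sub>R exp (z * cx (- t)))"
      by (simp add: expo_def indicator_def distrib_right)
  qed
  also have "\<dots> = z * (\<integral>t. indicator {0<..} t *\<^sub>R exp (z * cx (- t)) \<partial>lborel)"
    by (rule integral_mult_right_zero)
  \<comment> \<open>\<open>expo\<close> lives on t > 0 whereas \<open>T_measure\<close> includes the
    endpoint 0; the difference is a null set.\<close>
  also have "(\<integral>t. indicator {0<..} t *\<^sub>R exp (z * cx (- t)) \<partial>lborel) = (\<integral>t. indicator {..0} (- t) *\<^sub>R exp (z * cx (- t)) \<partial>lborel)"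
    by (rule integral_cong_AE) (use AE_lborel_singleton[of "0::real"] in \<open>auto elim!: eventually_mono simp: indicator_def\<close>)
  also have "\<dots> = (\<integral>y. indicator {..0} y *\<^sub>R exp (z * cx y) \<partial>lborel)"
    using lborel_integral_real_affine[of "-1" "\<lambda>y. indicator {..0} y *\<^sub>R exp (z * cx y)" 0] by simp
  finally have 1: "1 = z * (\<integral>y. indicator {..0} y *\<^sub>R exp (z * cx y) \<partial>lborel)"
    by simp
  have "(\<integral>y. exp (z * cx y) \<partial>T_measure l) = (\<integral>y. (1 / l) *\<^sub>R (indicator {..0} y *\<^sub>R exp (z * cx y)) \<partial>lborel)"
    unfolding T_measure_eq[OF l] using l by (subst integral_density) auto
  also have "\<dots> = (1 / l) *\<^sub>R (1 / z)"
  proof -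
    have "J = 1 / z" if "1 = z * J" for J using that z0 by (simp add: field_simps)
    from this[OF 1] show ?thesis by (simp only: integral_scaleR_right)
  qed
  finally show ?thesis by (simp add: scaleR_conv_of_real)
qed

context drift_law begin

abbreviation "P \<equiv> conv_power (reflect \<rho>)"

lemma prob_space_reflect: "prob_space (reflect \<rho>)"
  unfolding reflect_def by (rule prob_space_distr) simp

lemma sets_reflect [simp, measurable_cong]: "sets (reflect \<rho>) = sets borel"
  by (simp add: reflect_def)

lemma prob_space_conv_power: "prob_space (P n)"
proof (induction n)
  case 0
  then show ?case by (simp add: prob_space_return)
next
  case (Suc n)
  interpret R: prob_space "reflect \<rho>" by (rule prob_space_reflect)
  interpret Pn: prob_space "P n" by (rule Suc)
  interpret PP: pair_prob_space "reflect \<rho>" "P n" ..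
  have m: "sets (reflect \<rho> \<Otimes>\<^sub>M P n) = sets (borel \<Otimes>\<^sub>M borel)"
    by (rule sets_pair_measure_cong) auto
  note [measurable_cong] = m
  show ?case
    unfolding conv_power.simps convolution_def
    by (rule PP.prob_space_distr) measurable
qed

lemma exp_s_le:
  assumes "\<bar>s\<bar> \<le> e"
  shows "integrable \<rho> (\<lambda>y. exp (- s * y))"
proof (rule Bochner_Integration.integrable_bound[OF moment_integrable(1)])
  have "- s * y \<le> e * \<bar>y\<bar>" for y
    using exp_y_le[of "cx s" y] assms by simp
  then show "AE y in \<rho>. norm (exp (- s * y)) \<le> norm (exp (e * \<bar>y\<bar>))" by auto
qed measurable

text \<open>Convolution turns exp (s y) into a product; the passage to the reflected law is what
  changes the sign of s under \<rho>.\<close>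

lemma nn_integral_exp_conv_power:
  assumes "\<bar>s\<bar> \<le> e"
  shows "(\<integral>\<^sup>+y. ennreal (exp (s * y)) \<partial>P n) = ennreal ((LINT y|\<rho>. exp (- s * y)) ^ n)"
proof (induction n)
  case 0
  then show ?case by (simp add: nn_integral_return)
next
  case (Suc n)
  let ?m = "LINT y|\<rho>. exp (- s * y)"
  interpret R: prob_space "reflect \<rho>" by (rule prob_space_reflect)
  interpret Pn: prob_space "P n" by (rule prob_space_conv_power)
  have m: "0 \<le> ?m" by (rule integral_nonneg_AE) auto
  have "(\<integral>\<^sup>+y. ennreal (exp (s * y)) \<partial>P (Suc n)) = (\<integral>\<^sup>+x. \<integral>\<^sup>+y. ennreal (exp (s * (x + y))) \<partial>P n \<partial>reflect \<rho>)"
    unfolding conv_power.simps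
    by (rule nn_integral_convolution) (auto intro: R.finite_measure_axioms Pn.finite_measure_axioms)
  also have "\<dots> = (\<integral>\<^sup>+x. ennreal (exp (s * x)) * (\<integral>\<^sup>+y. ennreal (exp (s * y)) \<partial>P n) \<partial>reflect \<rho>)"
    by (intro nn_integral_cong) (simp add: distrib_left exp_add ennreal_mult nn_integral_cmult cong: measurable_cong_sets)
  also have "\<dots> = (\<integral>\<^sup>+x. ennreal (exp (s * x)) \<partial>reflect \<rho>) * ennreal (?m ^ n)"
    unfolding Suc by (rule nn_integral_multc) measurable
  also have "(\<integral>\<^sup>+x. ennreal (exp (s * x)) \<partial>reflect \<rho>) = (\<integral>\<^sup>+x. ennreal (exp (- s * x)) \<partial>\<rho>)"
    unfolding reflect_def by (subst nn_integral_distr) auto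
  also have "\<dots> = ennreal ?m"
    using exp_s_le[OF assms] by (intro nn_integral_eq_integral) auto
  finally show ?case using m by (simp add: ennreal_mult)
qed

lemma integral_exp_conv_power:
  assumes z: "\<bar>Re z\<bar> \<le> e"
  shows "(\<integral>y. exp (z * cx y) \<partial>P n) = rho_hat \<rho> z ^ n"
proof (induction n)
  case 0
  have "(\<integral>y. exp (z * cx y) \<partial>return borel 0) = exp (z * cx 0)"
    by (rule integral_return) auto
  then show ?case by simp
next
  case (Suc n)
  interpret R: prob_space "reflect \<rho>" by (rule prob_space_reflect)
  interpret Pn: prob_space "P n" by (rule prob_space_conv_power)
  interpret PP: pair_prob_space "reflect \<rho>" "P n" ..
  have m: "sets (reflect \<rho> \<Otimes>\<^sub>M P n) = sets (borel \<Otimes>\<^sub>M borel)"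
    by (rule sets_pair_measure_cong) auto
  note [measurable_cong] = m
  have "integrable (P (Suc n)) (\<lambda>y. exp (z * cx y))"
  proof (rule integrableI_bounded)
    show "(\<integral>\<^sup>+y. ennreal (norm (exp (z * cx y))) \<partial>P (Suc n)) < \<infinity>"
      using nn_integral_exp_conv_power[OF z, of "Suc n"] by simp
  qed (simp cong: measurable_cong_sets)
  then have i: "integrable (reflect \<rho> \<Otimes>\<^sub>M P n) (\<lambda>p. exp (z * cx (fst p + snd p)))"
    unfolding conv_power.simps convolution_def by (subst (asm) integrable_distr_eq) (auto simp: split_beta')
  have "(\<integral>y. exp (z * cx y) \<partial>P (Suc n)) = (\<integral>p. exp (z * cx (fst p + snd p)) \<partial>(reflect \<rho> \<Otimes>\<^sub>M P n))"
    unfolding conv_power.simps convolution_def by (subst integral_distr) (auto simp: split_beta')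
  also have "\<dots> = (\<integral>x. \<integral>y. exp (z * cx (x + y)) \<partial>P n \<partial>reflect \<rho>)"
    using PP.integral_fst'[OF i] by simp
  also have "\<dots> = (\<integral>x. exp (z * cx x) * rho_hat \<rho> z ^ n \<partial>reflect \<rho>)"
    by (intro Bochner_Integration.integral_cong refl) (simp add: distrib_left exp_add Suc)
  also have "\<dots> = (\<integral>x. exp (z * cx x) \<partial>reflect \<rho>) * rho_hat \<rho> z ^ n"
    by (rule integral_mult_left_zero)
  also have "(\<integral>x. exp (z * cx x) \<partial>reflect \<rho>) = rho_hat \<rho> z"
    unfolding reflect_def rho_hat_def by (subst integral_distr) auto
  finally show ?case by simp
qed

lemma renewal_exp_moment:
  assumes s: "good_strip s0 K t" "0 < s" "s \<le> s0"
  shows "(\<integral>\<^sup>+y. ennreal (exp (s * y)) \<partial>renewal_measure \<rho>) < \<infinity>"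
proof -
  let ?m = "LINT y|\<rho>. exp (- s * y)"
  have m: "0 \<le> ?m" "?m < 1" and se: "\<bar>s\<bar> \<le> e"
    using s by (auto simp: good_strip_def intro!: integral_nonneg_AE)
  have "(\<integral>\<^sup>+y. ennreal (exp (s * y)) \<partial>renewal_measure \<rho>) = (\<Sum>n. ennreal (?m ^ n))"
    by (subst nn_integral_renewal_measure) (auto simp: nn_integral_exp_conv_power[OF se])
  also have "\<dots> = ennreal (\<Sum>n. ?m ^ n)"
    using m by (intro suminf_ennreal2 summable_geometric) auto
  finally show ?thesis by simp
qed

text \<open>Geometric series in \<open>rho_hat\<close>: its modulus at z is at most the real
  transform at Re z, which is below 1 on the positive side of a good strip.\<close>

lemma renewal_symbol:
  assumes z: "good_strip s0 K t" "0 < Re z" "Re z \<le> s0"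
  shows "rho_hat \<rho> z \<noteq> 1" "(\<integral>y. exp (z * cx y) \<partial>renewal_measure \<rho>) = 1 / (1 - rho_hat \<rho> z)"
    "cmod (1 / (1 - rho_hat \<rho> z)) \<le> 1 / (1 - (LINT y|\<rho>. exp (- Re z * y)))"
proof -
  let ?m = "LINT y|\<rho>. exp (- Re z * y)"
  have ze: "\<bar>Re z\<bar> \<le> e" and m1: "?m < 1" using z by (auto simp: good_strip_def)
  have le: "cmod (rho_hat \<rho> z) \<le> ?m"
    unfolding rho_hat_def by (rule order_trans[OF integral_norm_bound]) simp
  then show n: "rho_hat \<rho> z \<noteq> 1" using m1 by auto
  have "1 - ?m \<le> 1 - cmod (rho_hat \<rho> z)" using le by simp
  also have "\<dots> \<le> cmod (1 - rho_hat \<rho> z)"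
    using norm_triangle_ineq2[of 1 "rho_hat \<rho> z"] by simp
  finally show "cmod (1 / (1 - rho_hat \<rho> z)) \<le> 1 / (1 - ?m)"
    using m1 by (simp add: norm_divide frac_le)
  have "integrable (renewal_measure \<rho>) (\<lambda>y. exp (z * cx y))"
    by (rule integrableI_bounded) (use renewal_exp_moment[OF z] in \<open>auto cong: measurable_cong_sets\<close>)
  from integral_renewal_measure_sums[OF this]
  have "(\<lambda>n. rho_hat \<rho> z ^ n) sums (\<integral>y. exp (z * cx y) \<partial>renewal_measure \<rho>)"
    by (simp add: integral_exp_conv_power[OF ze])
  moreover have "(\<lambda>n. rho_hat \<rho> z ^ n) sums (1 / (1 - rho_hat \<rho> z))"
    using le m1 by (intro geometric_sums) auto
  ultimately show "(\<integral>y. exp (z * cx y) \<partial>renewal_measure \<rho>) = 1 / (1 - rho_hat \<rho> z)"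
    by (rule sums_unique2)
qed

end

section \<open>Bounds in weighted \<open>L\<^sup>2\<close> spaces\<close>

lemma kmass_eq: "kmass s M c Y = (\<integral>\<^sup>+w. ennreal (norm (cx (c w) * exp (- cx s * cx (Y w)))) \<partial>M)"
  unfolding kmass_def norm_mult norm_of_real norm_exp_eq_Re by (simp add: mult.commute)

lemma kmass_finite:
  assumes "integrable M (\<lambda>w. cx (c w) * exp (- cx s * cx (Y w)))"
  shows "kmass s M c Y < \<infinity>"
  using assms unfolding kmass_eq integrable_iff_bounded by simp

lemma kmass_uminus: "kmass s M c (\<lambda>w. - Y w) = kmass (- s) M c Y"
  by (simp add: kmass_def)

lemma ksymb_uminus: "ksymb M c (\<lambda>w. - Y w) z = ksymb M c Y (- z)"
  by (simp add: ksymb_def)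

text \<open>On a bounded interval a \<le> 1 + a^2 turns square-integrability into integrability, so
  truncations provide approximants inside \<open>L1L2\<close>.\<close>

lemma L1L2_restrict:
  assumes [measurable]: "f \<in> borel_measurable borel" and f: "wn2 s f < \<infinity>"
  shows "(\<lambda>x. indicator {-m..m} x * f x) \<in> L1L2 s" "wn2 s (\<lambda>x. indicator {-m..m} x * f x) \<le> wn2 s f"
proof -
  show le: "wn2 s (\<lambda>x. indicator {-m..m} x * f x) \<le> wn2 s f"
    unfolding wn2_def by (intro nn_integral_mono) (auto simp: indicator_def)
  have "wn1 s (\<lambda>x. indicator {-m..m} x * f x) \<le> (\<integral>\<^sup>+x. indicator {-m..m} x + ennreal ((exp (s * x) * cmod (f x))\<^sup>2) \<partial>lborel)"
    unfolding wn1_def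
  proof (rule nn_integral_mono)
    fix x
    let ?a = "exp (s * x) * cmod (f x)"
    have "a \<le> 1 + a\<^sup>2" for a :: real
      using zero_le_power2[of "a - 1 / 2"] by (simp add: power2_diff power_divide)
    from this[of ?a]
    have "ennreal ?a \<le> ennreal (1 + ?a\<^sup>2)" by (rule ennreal_leI)
    then show "ennreal (exp (s * x) * cmod (indicator {-m..m} x * f x)) \<le> indicator {-m..m} x + ennreal (?a\<^sup>2)"
      by (auto simp: indicator_def)
  qed
  also have "\<dots> = emeasure lborel {-m..m} + wn2 s f"
    unfolding wn2_def by (subst nn_integral_add) auto
  also have "\<dots> < \<infinity>" using f by (simp add: emeasure_lborel_Icc_eq)
  finally show "(\<lambda>x. indicator {-m..m} x * f x) \<in> L1L2 s"
    using le f by (auto simp: L1L2_def)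
qed

lemma convolve_eq_kop: "convolve \<mu> f = kop \<mu> (\<lambda>_. 1) uminus f"
  by (auto simp: convolve_def kop_def)

context drift_law begin

abbreviation "G \<equiv> renewal_measure \<rho>"
abbreviation "T \<equiv> T_measure l"
text \<open>\<open>dP\<close>, \<open>Rop\<close> and \<open>Qop\<close> are the operators I - P, R
  and Q; \<open>dPs\<close> and \<open>Rsop\<close> are the adjoints of the first two with respect
  to Lebesgue measure, obtained by reflecting the translations.\<close>

abbreviation "dP \<equiv> \<lambda>h x. h x - kop \<rho> (\<lambda>_. 1) (\<lambda>y. y) h x"
abbreviation "dPs \<equiv> \<lambda>h x. h x - kop \<rho> (\<lambda>_. 1) uminus h x"
abbreviation "Rop \<equiv> kop \<rho>U rw ry"
abbreviation "Rsop \<equiv> kop \<rho>U rw (\<lambda>w. - ry w)"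
abbreviation "Qop \<equiv> kop \<rho>U qw ry"
abbreviation "W \<equiv> convolve_diff G T"

text \<open>Reflecting a kernel exchanges the weights s and -s, so the adjoints rely on the mass
  bounds at -s; the symmetric strip supplies both.\<close>

lemma multipliers:
  assumes s: "\<bar>s\<bar> \<le> e"
  shows "multiplier s dP (\<lambda>z. 1 - rho_hat \<rho> z)" "multiplier s dPs (\<lambda>z. 1 - rho_hat \<rho> (- z))"
    "multiplier s Rop rs" "multiplier s Rsop (\<lambda>z. rs (- z))" "multiplier s Qop qs"
proof -
  interpret K1: kernel \<rho> "\<lambda>_. 1" "\<lambda>y. y" by unfold_locales auto
  interpret K2: kernel \<rho> "\<lambda>_. 1" "\<lambda>y. - y" by unfold_locales auto
  interpret K3: kernel \<rho>U rw ry by unfold_locales auto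
  interpret K4: kernel \<rho>U rw "\<lambda>w. - ry w" by unfold_locales auto
  interpret K5: kernel \<rho>U qw ry by unfold_locales auto
  have k1: "kmass s' \<rho> (\<lambda>_. 1) (\<lambda>y. y) < \<infinity>" if "\<bar>s'\<bar> \<le> e" for s'
    using integrable_rho_hat[of "cx s'"] that by (intro kmass_finite) simp
  have k3: "kmass s' \<rho>U rw ry < \<infinity>" if "\<bar>s'\<bar> \<le> e" for s'
    using integrable_rs(1)[of "cx s'"] that by (intro kmass_finite) simp
  have k5: "kmass s \<rho>U qw ry < \<infinity>"
    using integrable_qs(1)[of "cx s"] s by (intro kmass_finite) simp
  have sy: "ksymb \<rho> (\<lambda>_. 1) (\<lambda>y. y) = rho_hat \<rho>" "ksymb \<rho> (\<lambda>_. 1) (\<lambda>y. - y) = (\<lambda>z. rho_hat \<rho> (- z))"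
    "ksymb \<rho>U rw (\<lambda>w. - ry w) = (\<lambda>z. rs (- z))"
    by (auto simp: ksymb_uminus rs_def) (auto simp: ksymb_def rho_hat_def)
  show "multiplier s dP (\<lambda>z. 1 - rho_hat \<rho> z)"
    using multiplier_diff[OF multiplier_id K1.multiplier_kop[OF k1[OF s]]] unfolding sy .
  have "kmass s \<rho> (\<lambda>_. 1) (\<lambda>y. - y) < \<infinity>"
    unfolding kmass_uminus[of s \<rho> "\<lambda>_. 1" "\<lambda>y. y"] using k1[of "-s"] s by simp
  from multiplier_diff[OF multiplier_id K2.multiplier_kop[OF this]]
  show "multiplier s dPs (\<lambda>z. 1 - rho_hat \<rho> (- z))" unfolding sy .
  show "multiplier s Rop rs"
    unfolding rs_def by (rule K3.multiplier_kop[OF k3[OF s]])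
  have "kmass s \<rho>U rw (\<lambda>w. - ry w) < \<infinity>"
    unfolding kmass_uminus using k3[of "-s"] s by simp
  from K4.multiplier_kop[OF this] show "multiplier s Rsop (\<lambda>z. rs (- z))" unfolding sy .
  show "multiplier s Qop qs"
    unfolding qs_def by (rule K5.multiplier_kop[OF k5])
qed

lemma kernels_GT:
  assumes "good_strip s0 K t" "0 < g" "g \<le> s0"
  shows "kernel G (\<lambda>_. 1) uminus" "kernel T (\<lambda>_. 1) uminus"
    "kmass g G (\<lambda>_. 1) uminus < \<infinity>" "kmass g T (\<lambda>_. 1) uminus < \<infinity>"
    "locally_finite G" "locally_finite T"
proof -
  have sT: "sets T = sets borel" by (simp add: T_measure_def)
  note mG = renewal_exp_moment[OF assms]
  have mT: "(\<integral>\<^sup>+y. ennreal (exp (g * y)) \<partial>T) < \<infinity>"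
    by (rule T_exp_moment[OF assms(2) l_pos])
  note G = exp_moment_finite_imp[OF sets_renewal_measure mG]
  note T = exp_moment_finite_imp[OF sT mT]
  show "locally_finite G" "locally_finite T"
    by (fact G T)+
  show "kernel G (\<lambda>_. 1) uminus"
    using G(2) by (auto simp: kernel_def kernel_axioms_def cong: measurable_cong_sets)
  show "kernel T (\<lambda>_. 1) uminus"
    using T(2) by (auto simp: kernel_def kernel_axioms_def T_measure_def)
  show "kmass g G (\<lambda>_. 1) uminus < \<infinity>" "kmass g T (\<lambda>_. 1) uminus < \<infinity>"
    using mG mT by (simp_all add: kmass_def)
qed

text \<open>At a positive weight both measures have finite exponential mass, so W is a difference of
  two kernel operators. The opposite weight has to be reached by the transfer argument.\<close>

lemma multiplier_W:
  assumes gs: "good_strip s0 K t" "0 < g" "g \<le> s0"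
  shows "multiplier g W (\<lambda>z. ksymb G (\<lambda>_. 1) uminus z - ksymb T (\<lambda>_. 1) uminus z)"
    and "ksymb G (\<lambda>_. 1) uminus (Complex g b) = 1 / (1 - rho_hat \<rho> (Complex g b))"
    and "ksymb T (\<lambda>_. 1) uminus (Complex g b) = 1 / (cx l * Complex g b)"
proof -
  note k = kernels_GT[OF gs]
  have "W = (\<lambda>h x. kop G (\<lambda>_. 1) uminus h x - kop T (\<lambda>_. 1) uminus h x)"
    by (simp add: convolve_diff_def convolve_eq_kop fun_eq_iff)
  then show "multiplier g W (\<lambda>z. ksymb G (\<lambda>_. 1) uminus z - ksymb T (\<lambda>_. 1) uminus z)"
    by (simp only:) (intro multiplier_diff kernel.multiplier_kop k)
  show "ksymb G (\<lambda>_. 1) uminus (Complex g b) = 1 / (1 - rho_hat \<rho> (Complex g b))"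
    using renewal_symbol(2)[OF gs(1), of "Complex g b"] gs by (simp add: ksymb_def)
  show "ksymb T (\<lambda>_. 1) uminus (Complex g b) = 1 / (cx l * Complex g b)"
    using T_symbol[of "Complex g b" l] gs l_pos by (simp add: ksymb_def)
qed

text \<open>At weight g the symbol of W is bounded on the line Re z = g. At weight -g the estimate
  is \<open>neumann_transfer\<close> followed by the boundedness of the right-hand side
  \<open>H\<close>. The constant refers to squared norms and is common to both weights.\<close>

lemma W_bound_L1L2:
  assumes gs: "good_strip s0 K t" "0 < g" "g \<le> s0"
  obtains C where "C \<ge> 0"
    "\<And>f. f \<in> L1L2 g \<Longrightarrow> f \<in> L1L2 (- g) \<Longrightarrow> W f \<in> L1L2 g"
    "\<And>f. f \<in> L1L2 g \<Longrightarrow> f \<in> L1L2 (- g) \<Longrightarrow> wn2 g (W f) \<le> ennreal C * wn2 g f"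
    "\<And>f. f \<in> L1L2 g \<Longrightarrow> f \<in> L1L2 (- g) \<Longrightarrow> wn2 (- g) (W f) \<le> ennreal C * wn2 (- g) f"
proof -
  have g: "g \<le> e" "K > 0" "0 < t" "t < 1" using gs by (auto simp: good_strip_def)
  let ?k = "LINT y|\<rho>. exp (- g * y)"
  have k: "?k < 1" using gs by (auto simp: good_strip_def)
  let ?m = "\<lambda>z. ksymb G (\<lambda>_. 1) uminus z - ksymb T (\<lambda>_. 1) uminus z"
  \<comment> \<open>\<open>B\<close> is I - A / K and \<open>H\<close> the matching right-hand side,
    so that W f and B (W f) + H f have the same transform; \<open>\<beta>\<close> and
    \<open>\<eta>\<close> are their symbols.\<close>
  define B where "B h x = h x - cx (1 / K) * (dPs (dP h) x + Rsop (Rop h) x)" for h x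
  define \<beta> where "\<beta> z = 1 - cx (1 / K) * psi z" for z
  define H where "H h x = cx (1 / K) * (dPs (\<lambda>x. h x - Rop h x) x + Rsop (Qop h) x)" for h x
  define \<eta> where "\<eta> z = cx (1 / K) * ((1 - rho_hat \<rho> (- z)) * (1 - rs z) + rs (- z) * qs z)" for z
  have mB: "multiplier s B \<beta>" if s: "\<bar>s\<bar> \<le> e" for s
    unfolding B_def[abs_def] \<beta>_def[abs_def] psi_def
    by (intro multiplier_diff multiplier_id multiplier_scale multiplier_add
        multiplier_comp[OF multipliers(2)[OF s] multipliers(1)[OF s]] multiplier_comp[OF multipliers(4)[OF s] multipliers(3)[OF s]])
  have mH: "multiplier s H \<eta>" if s: "\<bar>s\<bar> \<le> e" for s
    unfolding H_def[abs_def] \<eta>_def[abs_def]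
    by (intro multiplier_scale multiplier_add
        multiplier_comp[OF multipliers(2)[OF s] multiplier_diff[OF multiplier_id multipliers(3)[OF s]]]
        multiplier_comp[OF multipliers(4)[OF s] multipliers(5)[OF s]])
  have \<beta>: "cmod (\<beta> (Complex s b)) \<le> t" if "\<bar>s\<bar> \<le> s0" for s b
    using gs(1) that unfolding good_strip_def \<beta>_def by (simp add: divide_inverse mult.commute)
  have L0: "0 \<le> L" using L_bounds(1) by linarith
  define C1 where "C1 = 1 / K * (L * (1 + L) + L * (A2 / l\<^sup>2))"
  have \<eta>: "cmod (\<eta> (Complex (- g) b)) \<le> C1" for b
  proof -
    let ?z = "Complex (- g) b"
    have z: "\<bar>Re ?z\<bar> \<le> e" "\<bar>Re (- ?z)\<bar> \<le> e" using g gs(2) by auto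
    have "cmod (1 - rs ?z) \<le> 1 + L"
      using norm_triangle_ineq4[of 1 "rs ?z"] L_bounds(5)[OF z(1)] by simp
    then have "cmod ((1 - rho_hat \<rho> (- ?z)) * (1 - rs ?z) + rs (- ?z) * qs ?z) \<le> L * (1 + L) + L * (A2 / l\<^sup>2)"
      using L_bounds(4)[OF z(2)] L_bounds(5)[OF z(2)] integrable_qs(2)[OF z(1)] L0
      by (intro norm_triangle_le add_mono) (auto simp only: norm_mult norm_ge_zero intro!: mult_mono)
    then show ?thesis
      unfolding \<eta>_def C1_def norm_mult[of "cx (1 / K)"] norm_of_real using g
      by (intro mult_mono) auto
  qed
  \<comment> \<open>Sum of the bounds of the two terms of the symbol on Re z = g. It blows up as g
    tends to 0, which is harmless for a fixed weight.\<close>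
  define C2 where "C2 = 1 / (1 - ?k) + 1 / (l * g)"
  have m: "cmod (?m (Complex g b)) \<le> C2" for b
  proof -
    have "cmod (?m (Complex g b)) \<le> cmod (1 / (1 - rho_hat \<rho> (Complex g b))) + cmod (1 / (cx l * Complex g b))"
      unfolding multiplier_W(2,3)[OF gs] by (rule norm_triangle_ineq4)
    also have "\<dots> \<le> C2"
      unfolding C2_def
    proof (rule add_mono)
      show "cmod (1 / (1 - rho_hat \<rho> (Complex g b))) \<le> 1 / (1 - ?k)"
        using renewal_symbol(3)[OF gs(1), of "Complex g b"] gs by simp
      have "g \<le> cmod (Complex g b)"
        using abs_Re_le_cmod[of "Complex g b"] by simp
      then have "l * g \<le> l * cmod (Complex g b)" using l_pos by (intro mult_left_mono) auto
      then show "cmod (1 / (cx l * Complex g b)) \<le> 1 / (l * g)"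
        unfolding norm_divide norm_mult norm_of_real using l_pos gs by (auto intro!: frac_le)
    qed
    finally show ?thesis .
  qed
  let ?C = "max (C2\<^sup>2) (2 / (1 - t)\<^sup>2 * C1\<^sup>2)"
  show ?thesis
  proof
    show "0 \<le> ?C" by (simp add: max_def)
    fix f assume f: "f \<in> L1L2 g" "f \<in> L1L2 (- g)"
    show WV: "W f \<in> L1L2 g" by (rule multiplierD(1)[OF multiplier_W(1)[OF gs] f(1)])
    have "wn2 g (W f) \<le> ennreal (C2\<^sup>2) * wn2 g f"
      by (rule multiplier_wn2_le[OF multiplier_W(1)[OF gs] f(1) m])
    also have "\<dots> \<le> ennreal ?C * wn2 g f"
      by (intro mult_right_mono ennreal_leI) auto
    finally show "wn2 g (W f) \<le> ennreal ?C * wn2 g f" .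
    have ge: "\<bar>g\<bar> \<le> e" "\<bar>-g\<bar> \<le> e" using g gs by auto
    have "wn2 (- g) (W f) \<le> ennreal (2 / (1 - t)\<^sup>2) * wn2 (- g) (H f)"
    proof (rule neumann_transfer[OF mB[OF ge(1)] mB[OF ge(2)] \<beta> \<beta>])
      show "H f \<in> L1L2 g" "H f \<in> L1L2 (- g)"
        by (rule multiplierD(1)[OF mH[OF ge(1)] f(1)] multiplierD(1)[OF mH[OF ge(2)] f(2)])+
      fix b
      let ?z = "Complex g b"
      have z: "\<bar>Re ?z\<bar> \<le> e" "?z \<noteq> 0" using ge gs by (auto simp: complex_eq_iff)
      note rsi = rs_identity[OF z(1)] and qsi = qs_identity[OF z(1)]
      have ne: "1 - rho_hat \<rho> ?z \<noteq> 0"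
        using renewal_symbol(1)[OF gs(1), of ?z] gs by auto
      have lz: "cx l * ?z \<noteq> 0" using l_pos z by simp
      \<comment> \<open>The identity (I - P) W = I - R on the symbol side.\<close>
      have e1: "(1 - rho_hat \<rho> ?z) * ?m ?z = 1 - rs ?z"
      proof -
        have alg: "N * (1 / N - 1 / D) = 1 - r" if "N \<noteq> 0" "D \<noteq> 0" "D * r = N" for N D r :: complex
          using that by (auto simp: right_diff_distrib)
        show ?thesis
          unfolding multiplier_W(2,3)[OF gs] by (rule alg[OF ne lz rsi])
      qed
      \<comment> \<open>Multiplying by l z turns \<open>rs\<close> into 1 - rho_hat, so R W = Q
        follows from the previous identity and the one for \<open>qs\<close>.\<close>
      have "cx l * ?z * (rs ?z * ?m ?z) = cx l * ?z * qs ?z"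
        using e1 unfolding rsi[symmetric] qsi by (simp add: mult.assoc)
      then have e2: "rs ?z * ?m ?z = qs ?z" using lz by (metis mult_cancel_left)
      have "psi ?z * ?m ?z = (1 - rho_hat \<rho> (- ?z)) * (1 - rs ?z) + rs (- ?z) * qs ?z"
        unfolding psi_def distrib_right mult.assoc e1 e2 ..
      then have "?m ?z = \<beta> ?z * ?m ?z + \<eta> ?z"
        unfolding \<beta>_def \<eta>_def by (simp add: left_diff_distrib mult.assoc)
      then have "?m ?z * laplace f ?z = (\<beta> ?z * ?m ?z + \<eta> ?z) * laplace f ?z" by simp
      then show "laplace (W f) ?z = \<beta> ?z * laplace (W f) ?z + laplace (H f) ?z"
        unfolding multiplierD(2)[OF multiplier_W(1)[OF gs] f(1)] multiplierD(2)[OF mH[OF ge(1)] f(1)]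
        by (simp add: distrib_right mult.assoc)
    qed (use gs g WV in auto)
    also have "\<dots> \<le> ennreal (2 / (1 - t)\<^sup>2) * (ennreal (C1\<^sup>2) * wn2 (- g) f)"
      by (intro mult_left_mono multiplier_wn2_le[OF mH[OF ge(2)] f(2) \<eta>]) auto
    also have "\<dots> = ennreal (2 / (1 - t)\<^sup>2 * C1\<^sup>2) * wn2 (- g) f"
      by (subst mult.assoc[symmetric], subst ennreal_mult[symmetric]) auto
    also have "\<dots> \<le> ennreal ?C * wn2 (- g) f"
      by (intro mult_right_mono ennreal_leI) auto
    finally show "wn2 (- g) (W f) \<le> ennreal ?C * wn2 (- g) f" .
  qed
qed

section \<open>Extension to the full weighted L2 space\<close>

lemma AE_convolvable:
  assumes gs: "good_strip s0 K t" "0 < g" "g \<le> s0"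
    and f: "f \<in> borel_measurable borel" "wn2 g f < \<infinity>"
  shows "AE x in lborel. convolvable_at G f x \<and> convolvable_at T f x"
proof -
  note k = kernels_GT[OF gs]
  have "AE x in lborel. convolvable_at G f x"
    using kernel.AE_kop_integrable[OF k(1) f(1) k(3) f(2)] by (simp add: convolvable_at_def)
  moreover have "AE x in lborel. convolvable_at T f x"
    using kernel.AE_kop_integrable[OF k(2) f(1) k(4) f(2)] by (simp add: convolvable_at_def)
  ultimately show ?thesis by eventually_elim simp
qed

lemma convolve_restrict_tendsto:
  assumes "convolvable_at \<mu> f x" and [measurable_cong]: "sets \<mu> = sets borel"
  shows "(\<lambda>n. convolve \<mu> (\<lambda>x. indicator {-real n..real n} x * f x) x) \<longlonglongrightarrow> convolve \<mu> f x"
  unfolding convolve_def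
proof (rule integral_dominated_convergence)
  have i: "integrable \<mu> (\<lambda>y. f (x - y))" using assms by (simp add: convolvable_at_def)
  then show "integrable \<mu> (\<lambda>y. norm (f (x - y)))" by simp
  show "AE y in \<mu>. (\<lambda>n. indicator {-real n..real n} (x - y) * f (x - y)) \<longlonglongrightarrow> f (x - y)"
  proof (rule AE_I2)
    fix y
    have "\<forall>\<^sub>F n in sequentially. indicator {-real n..real n} (x - y) * f (x - y) = f (x - y)"
      using eventually_abs_le_nat[of "x - y"] by eventually_elim (auto simp: indicator_def)
    then show "(\<lambda>n. indicator {-real n..real n} (x - y) * f (x - y)) \<longlonglongrightarrow> f (x - y)"
      by (rule tendsto_eventually)
  qed
  show "AE y in \<mu>. norm (indicator {-real n..real n} (x - y) * f (x - y)) \<le> norm (f (x - y))" for n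
    by (auto simp: indicator_def)
  show [measurable]: "(\<lambda>y. f (x - y)) \<in> borel_measurable \<mu>" using i by auto
  show "(\<lambda>y. indicator {-real n..real n} (x - y) * f (x - y)) \<in> borel_measurable \<mu>" for n
    by measurable
qed

lemma borel_measurable_W:
  assumes gs: "good_strip s0 K t" "0 < g" "g \<le> s0" and [measurable]: "f \<in> borel_measurable borel"
  shows "W f \<in> borel_measurable borel"
proof -
  note k = kernels_GT[OF gs]
  have [measurable]: "kop G (\<lambda>_. 1) uminus f \<in> borel_measurable borel"
    "kop T (\<lambda>_. 1) uminus f \<in> borel_measurable borel"
    by (rule kernel.borel_measurable_kop[OF k(1) assms(4)] kernel.borel_measurable_kop[OF k(2) assms(4)])+
  show ?thesis
    unfolding convolve_diff_def[abs_def] convolve_eq_kop by measurable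
qed

text \<open>Truncations to [-n, n] lie in \<open>L1L2\<close> for both weights. Their images
  converge almost everywhere by dominated convergence, and Fatou's lemma keeps the bound.\<close>

lemma W_bound:
  assumes gs: "good_strip s0 K t" "0 < g" "g \<le> s0"
  obtains C where "C \<ge> 0"
    "\<And>f. f \<in> borel_measurable borel \<Longrightarrow> wn2 g f < \<infinity> \<Longrightarrow> wn2 (- g) f < \<infinity> \<Longrightarrow> wn2 g (W f) \<le> ennreal C * wn2 g f"
    "\<And>f. f \<in> borel_measurable borel \<Longrightarrow> wn2 g f < \<infinity> \<Longrightarrow> wn2 (- g) f < \<infinity> \<Longrightarrow> wn2 (- g) (W f) \<le> ennreal C * wn2 (- g) f"
proof -
  obtain C where C: "C \<ge> 0"
    "\<And>f. f \<in> L1L2 g \<Longrightarrow> f \<in> L1L2 (- g) \<Longrightarrow> W f \<in> L1L2 g"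
    "\<And>f. f \<in> L1L2 g \<Longrightarrow> f \<in> L1L2 (- g) \<Longrightarrow> wn2 g (W f) \<le> ennreal C * wn2 g f"
    "\<And>f. f \<in> L1L2 g \<Longrightarrow> f \<in> L1L2 (- g) \<Longrightarrow> wn2 (- g) (W f) \<le> ennreal C * wn2 (- g) f"
    by (rule W_bound_L1L2[OF gs]) blast
  have fatou: "wn2 s (W f) \<le> ennreal C * wn2 s f"
    if f: "f \<in> borel_measurable borel" "wn2 g f < \<infinity>" "wn2 (- g) f < \<infinity>" and s: "s = g \<or> s = - g" for f s
  proof -
    note [measurable] = f(1)
    let ?f = "\<lambda>n x. indicator {-real n..real n} x * f x"
    have [measurable]: "W (?f n) \<in> borel_measurable borel" "W f \<in> borel_measurable borel" for n
      by (rule borel_measurable_W[OF gs]; measurable)+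
    have lim: "AE x in lborel. (\<lambda>n. W (?f n) x) \<longlonglongrightarrow> W f x"
      using AE_convolvable[OF gs f(1,2)]
      by eventually_elim (auto simp: convolve_diff_def intro!: tendsto_diff convolve_restrict_tendsto simp: T_measure_def)
    show ?thesis
      unfolding wn2_def[of s "W f"]
    proof (rule nn_integral_le_tendsto)
      show "AE x in lborel. (\<lambda>n. ennreal ((exp (s * x) * cmod (W (?f n) x))\<^sup>2)) \<longlonglongrightarrow> ennreal ((exp (s * x) * cmod (W f x))\<^sup>2)"
        using lim by eventually_elim (intro tendsto_ennrealI tendsto_intros)
      fix n
      have v: "?f n \<in> L1L2 g" "?f n \<in> L1L2 (- g)" "wn2 s (?f n) \<le> wn2 s f"
        using L1L2_restrict[OF f(1), of g n] L1L2_restrict[OF f(1), of "-g" n] f s by auto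
      have "wn2 s (W (?f n)) \<le> ennreal C * wn2 s (?f n)"
        using s C v by auto
      also have "\<dots> \<le> ennreal C * wn2 s f"
        by (intro mult_left_mono v) auto
      finally show "(\<integral>\<^sup>+x. ennreal ((exp (s * x) * cmod (W (?f n) x))\<^sup>2) \<partial>lborel) \<le> ennreal C * wn2 s f"
        unfolding wn2_def .
    qed measurable
  qed
  show ?thesis
    by (rule that[OF C(1)]) (auto intro: fatou)
qed

end

section \<open>Weighted spaces of continuous functions\<close>

text \<open>For f the convolution of \<open>expo a\<close> with \<open>g\<close>, the formula is
  Fubini's theorem. The one-sided bound on \<open>g\<close> makes the double integral absolutely
  convergent for each x, because exp (\<gamma> y) is integrable against \<mu>; hence convolvability
  at every point and not only almost everywhere.\<close>

lemma convolve_expo: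
  fixes f g :: "real \<Rightarrow> complex"
  assumes M: "sets \<mu> = sets borel" "sigma_finite_measure \<mu>" and fin: "(\<integral>\<^sup>+y. ennreal (exp (\<gamma> * y)) \<partial>\<mu>) < \<infinity>"
    and a: "\<bar>\<gamma>\<bar> < a" and [measurable]: "g \<in> borel_measurable borel" and g: "\<And>x. cmod (g x) \<le> A * exp (- \<gamma> * x)"
    and f: "\<And>x. f x = (\<integral>t. expo a t * g (x - t) \<partial>lborel)"
  shows "convolvable_at \<mu> f x" "convolve \<mu> f x = (\<integral>u. g (x - u) * convolve \<mu> (expo a) u \<partial>lborel)"
    "integrable lborel (\<lambda>u. g (x - u) * convolve \<mu> (expo a) u)"
proof -
  note [measurable_cong] = M(1)
  interpret sigma_finite_measure \<mu> by fact
  interpret PS: pair_sigma_finite \<mu> lborel ..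
  have [measurable]: "sets (\<mu> \<Otimes>\<^sub>M lborel) = sets (borel \<Otimes>\<^sub>M borel)"
    using M(1) by (intro sets_pair_measure_cong) auto
  let ?F = "\<lambda>y u. expo a (u - y) * g (x - u)"
  have A: "A \<ge> 0"
    using order_trans[OF norm_ge_zero g[of 0]] by simp
  have inner: "(\<integral>\<^sup>+u. ennreal (cmod (?F y u)) \<partial>lborel) \<le> ennreal (A * exp (- \<gamma> * x) * (1 / (a - \<gamma>))) * ennreal (exp (\<gamma> * y))" for y
  proof -
    have "(\<integral>\<^sup>+u. ennreal (cmod (?F y u)) \<partial>lborel) = (\<integral>\<^sup>+t. ennreal (cmod (?F y (t + y))) \<partial>lborel)"
      by (rule nn_integral_lborel_shift[symmetric]) measurable
    also have "\<dots> \<le> (\<integral>\<^sup>+t. ennreal (A * exp (- \<gamma> * x) * exp (\<gamma> * y)) * ennreal (exp (\<gamma> * t) * cmod (expo a t)) \<partial>lborel)"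
    proof (rule nn_integral_mono)
      fix t
      have "cmod (?F y (t + y)) \<le> cmod (expo a t) * (A * exp (- \<gamma> * (x - (t + y))))"
        unfolding norm_mult add_diff_cancel_right' by (rule mult_left_mono[OF g norm_ge_zero])
      also have "\<dots> = (A * exp (- \<gamma> * x) * exp (\<gamma> * y)) * (exp (\<gamma> * t) * cmod (expo a t))"
        by (simp add: exp_add[symmetric] algebra_simps)
      finally show "ennreal (cmod (?F y (t + y))) \<le> ennreal (A * exp (- \<gamma> * x) * exp (\<gamma> * y)) * ennreal (exp (\<gamma> * t) * cmod (expo a t))"
        using A by (subst ennreal_mult[symmetric]) (auto intro!: ennreal_leI)
    qed
    also have "\<dots> = ennreal (A * exp (- \<gamma> * x) * exp (\<gamma> * y)) * wn1 \<gamma> (expo a)"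
      unfolding wn1_def by (rule nn_integral_cmult) measurable
    also have "\<dots> \<le> ennreal (A * exp (- \<gamma> * x) * exp (\<gamma> * y)) * ennreal (1 / (a - \<gamma>))"
      using a by (intro mult_left_mono wn1_expo) auto
    also have "\<dots> = ennreal (A * exp (- \<gamma> * x) * (1 / (a - \<gamma>))) * ennreal (exp (\<gamma> * y))"
      using A a by (subst (1 2) ennreal_mult[symmetric]) (auto simp: mult_ac)
    finally show ?thesis .
  qed
  have "(\<integral>\<^sup>+p. ennreal (norm (case_prod ?F p)) \<partial>(\<mu> \<Otimes>\<^sub>M lborel)) = (\<integral>\<^sup>+y. \<integral>\<^sup>+u. ennreal (cmod (?F y u)) \<partial>lborel \<partial>\<mu>)"
    by (subst lborel.nn_integral_fst[symmetric]) auto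
  also have "\<dots> \<le> (\<integral>\<^sup>+y. ennreal (A * exp (- \<gamma> * x) * (1 / (a - \<gamma>))) * ennreal (exp (\<gamma> * y)) \<partial>\<mu>)"
    by (intro nn_integral_mono inner)
  also have "\<dots> = ennreal (A * exp (- \<gamma> * x) * (1 / (a - \<gamma>))) * (\<integral>\<^sup>+y. ennreal (exp (\<gamma> * y)) \<partial>\<mu>)"
    by (rule nn_integral_cmult) measurable
  also have "\<dots> < \<infinity>" using fin by (simp add: ennreal_mult_less_top)
  finally have F: "integrable (\<mu> \<Otimes>\<^sub>M lborel) (case_prod ?F)"
    by (intro integrableI_bounded) auto
  have fy: "f (x - y) = (\<integral>u. ?F y u \<partial>lborel)" for y
    unfolding f using lborel_integral_shift[of "?F y" y] by (simp add: algebra_simps)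
  show "convolvable_at \<mu> f x"
    unfolding convolvable_at_def fy by (rule PS.integrable_fst[OF F])
  have eq: "(\<integral>y. ?F y u \<partial>\<mu>) = g (x - u) * convolve \<mu> (expo a) u" for u
    unfolding convolve_def by (simp add: mult.commute)
  show "convolve \<mu> f x = (\<integral>u. g (x - u) * convolve \<mu> (expo a) u \<partial>lborel)"
    unfolding convolve_def[of \<mu> f] fy using PS.Fubini_integral[OF F] unfolding eq by (rule sym)
  show "integrable lborel (\<lambda>u. g (x - u) * convolve \<mu> (expo a) u)"
    using PS.integrable_snd[OF F] unfolding eq .
qed

text \<open>Squared norm for the two-sided weight, kept in \<open>ennreal\<close> like
  \<open>wn2\<close>.\<close>

definition wn2_abs :: "real \<Rightarrow> (real \<Rightarrow> complex) \<Rightarrow> ennreal" where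
  "wn2_abs \<gamma> f = (\<integral>\<^sup>+x. ennreal ((cmod (exp_weight \<gamma> f x))\<^sup>2) \<partial>lborel)"

lemma borel_measurable_exp_weight [measurable]:
  assumes [measurable]: "f \<in> borel_measurable borel"
  shows "exp_weight \<gamma> f \<in> borel_measurable borel"
  unfolding exp_weight_def[abs_def] by measurable

lemma norm_exp_weight: "cmod (exp_weight \<gamma> f x) = exp (\<gamma> * \<bar>x\<bar>) * cmod (f x)"
  by (simp add: exp_weight_def norm_mult)

text \<open>For \<gamma> \<ge> 0 the weight is submultiplicative, exp (\<gamma> |x|) \<le> exp
  (\<gamma> |x - u|) exp (\<gamma> |u|), so it can be distributed over \<open>g\<close> and
  \<open>k\<close>.\<close>

lemma convolution_weighted_bound:
  fixes g k :: "real \<Rightarrow> complex"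
  assumes \<gamma>: "\<gamma> \<ge> 0" and k: "integrable lborel (\<lambda>x. exp (\<gamma> * \<bar>x\<bar>) * cmod (k x))"
    and g: "\<And>x. exp (\<gamma> * \<bar>x\<bar>) * cmod (g x) \<le> A"
  shows "exp (\<gamma> * \<bar>x\<bar>) * cmod (\<integral>u. g (x - u) * k u \<partial>lborel) \<le> A * (LINT u|lborel. exp (\<gamma> * \<bar>u\<bar>) * cmod (k u))"
proof -
  have A: "A \<ge> 0" using order_trans[OF _ g[of 0]] by simp
  have "exp (\<gamma> * \<bar>x\<bar>) * cmod (\<integral>u. g (x - u) * k u \<partial>lborel) \<le> exp (\<gamma> * \<bar>x\<bar>) * (\<integral>u. cmod (g (x - u) * k u) \<partial>lborel)"
    by (intro mult_left_mono integral_norm_bound) auto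
  also have "\<dots> = (\<integral>u. exp (\<gamma> * \<bar>x\<bar>) * cmod (g (x - u) * k u) \<partial>lborel)"
    by simp
  also have "\<dots> \<le> (\<integral>u. A * (exp (\<gamma> * \<bar>u\<bar>) * cmod (k u)) \<partial>lborel)"
  proof (rule integral_mono_AE'[OF integrable_mult_right[OF k]])
    have "exp (\<gamma> * \<bar>x\<bar>) * cmod (g (x - u) * k u) \<le> A * (exp (\<gamma> * \<bar>u\<bar>) * cmod (k u))" for u
    proof -
      have "\<gamma> * \<bar>x\<bar> \<le> \<gamma> * (\<bar>x - u\<bar> + \<bar>u\<bar>)" using \<gamma> by (intro mult_left_mono) auto
      then have "exp (\<gamma> * \<bar>x\<bar>) \<le> exp (\<gamma> * \<bar>x - u\<bar>) * exp (\<gamma> * \<bar>u\<bar>)"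
        by (simp add: exp_add[symmetric] distrib_left)
      then have "exp (\<gamma> * \<bar>x\<bar>) * cmod (g (x - u) * k u) \<le> (exp (\<gamma> * \<bar>x - u\<bar>) * exp (\<gamma> * \<bar>u\<bar>)) * cmod (g (x - u) * k u)"
        by (rule mult_right_mono) simp
      also have "\<dots> = (exp (\<gamma> * \<bar>x - u\<bar>) * cmod (g (x - u))) * (exp (\<gamma> * \<bar>u\<bar>) * cmod (k u))"
        by (simp add: norm_mult)
      also have "\<dots> \<le> A * (exp (\<gamma> * \<bar>u\<bar>) * cmod (k u))"
        by (intro mult_right_mono g) auto
      finally show ?thesis .
    qed
    then show "AE u in lborel. exp (\<gamma> * \<bar>x\<bar>) * cmod (g (x - u) * k u) \<le> A * (exp (\<gamma> * \<bar>u\<bar>) * cmod (k u))"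
      by simp
  qed (use A in simp)
  finally show ?thesis by simp
qed

lemma continuous_on_convolution:
  fixes g k :: "real \<Rightarrow> complex"
  assumes k: "integrable lborel k" and cg: "continuous_on UNIV g" and g: "\<And>x. cmod (g x) \<le> A"
  shows "continuous_on UNIV (\<lambda>x. \<integral>u. g (x - u) * k u \<partial>lborel)"
proof (rule continuous_on_sequentiallyI)
  note [measurable] = borel_measurable_continuous_onI[OF cg] borel_measurable_integrable[OF k]
  fix u :: "nat \<Rightarrow> real" and b assume u: "u \<longlonglongrightarrow> b"
  show "(\<lambda>n. \<integral>v. g (u n - v) * k v \<partial>lborel) \<longlonglongrightarrow> (\<integral>v. g (b - v) * k v \<partial>lborel)"
  proof (rule integral_dominated_convergence)
    show "integrable lborel (\<lambda>v. A * cmod (k v))" using k by auto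
    show "AE v in lborel. norm (g (u n - v) * k v) \<le> A * cmod (k v)" for n
      using g by (auto simp: norm_mult intro!: mult_right_mono)
    have "(\<lambda>n. g (u n - v)) \<longlonglongrightarrow> g (b - v)" for v
      using cg by (intro isCont_tendsto_compose[of "b - v" g] tendsto_intros u) (auto simp: continuous_on_eq_continuous_at)
    then show "AE v in lborel. (\<lambda>n. g (u n - v) * k v) \<longlonglongrightarrow> g (b - v) * k v"
      by (intro AE_I2 tendsto_mult_right)
  qed measurable
qed

text \<open>A strictly larger weight in L2 pays for the passage to L1, since exp (- (s - \<gamma>)
  |x|) is square-integrable.\<close>

lemma integrable_weight_of_wnorm2:
  assumes [measurable]: "k \<in> borel_measurable borel" and "\<gamma> < s" and k: "wn2_abs s k < \<infinity>"
  shows "integrable lborel (\<lambda>x. exp (\<gamma> * \<bar>x\<bar>) * cmod (k x))"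
proof (rule integrableI_bounded)
  have "(\<integral>\<^sup>+x. ennreal (norm (exp (\<gamma> * \<bar>x\<bar>) * cmod (k x))) \<partial>lborel)
    \<le> (\<integral>\<^sup>+x. ennreal (exp (- (2 * (s - \<gamma>)) * \<bar>x\<bar>)) + ennreal ((cmod (exp_weight s k x))\<^sup>2) \<partial>lborel)"
  proof (rule nn_integral_mono)
    fix x
    let ?u = "exp (- (s - \<gamma>) * \<bar>x\<bar>)" and ?v = "exp (s * \<bar>x\<bar>) * cmod (k x)"
    have "u * v \<le> u\<^sup>2 + v\<^sup>2" if "0 \<le> u" "0 \<le> v" for u v :: real
      using zero_le_power2[of "u - v"] mult_nonneg_nonneg[OF that] by (simp add: power2_diff)
    from this[of ?u ?v] have "?u * ?v \<le> ?u\<^sup>2 + ?v\<^sup>2" by simp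
    moreover have "exp (\<gamma> * \<bar>x\<bar>) * cmod (k x) = ?u * ?v"
      by (simp add: mult.assoc[symmetric] exp_add[symmetric] algebra_simps)
    moreover have "?u\<^sup>2 = exp (- (2 * (s - \<gamma>)) * \<bar>x\<bar>)"
      by (simp add: exp_double[symmetric] algebra_simps)
    ultimately have "exp (\<gamma> * \<bar>x\<bar>) * cmod (k x) \<le> exp (- (2 * (s - \<gamma>)) * \<bar>x\<bar>) + ?v\<^sup>2"
      by (simp only:)
    then have "ennreal (norm (exp (\<gamma> * \<bar>x\<bar>) * cmod (k x))) \<le> ennreal (exp (- (2 * (s - \<gamma>)) * \<bar>x\<bar>) + ?v\<^sup>2)"
      by (intro ennreal_leI) simp
    then show "ennreal (norm (exp (\<gamma> * \<bar>x\<bar>) * cmod (k x)))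
        \<le> ennreal (exp (- (2 * (s - \<gamma>)) * \<bar>x\<bar>)) + ennreal ((cmod (exp_weight s k x))\<^sup>2)"
      unfolding norm_exp_weight by (simp only: ennreal_plus exp_ge_zero zero_le_power2)
  qed
  also have "\<dots> = (\<integral>\<^sup>+x. ennreal (exp (- (2 * (s - \<gamma>)) * \<bar>x\<bar>)) \<partial>lborel) + wn2_abs s k"
    unfolding wn2_abs_def by (rule nn_integral_add) measurable
  also have "\<dots> < \<infinity>"
    using nn_integral_exp_abs_finite[of "2 * (s - \<gamma>)"] assms by simp
  finally show "(\<integral>\<^sup>+x. ennreal (norm (exp (\<gamma> * \<bar>x\<bar>) * cmod (k x))) \<partial>lborel) < \<infinity>" .
qed measurable

text \<open>Linearity holds only up to functions on which \<open>q\<close> vanishes, so the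
  compatibility of \<open>q\<close> with differences is a premise of its own; continuity at f is
  then the bound applied to g - f.\<close>

lemma continuous_linear_operatorI:
  assumes maps: "\<And>f. f \<in> X \<Longrightarrow> T f \<in> Y"
    and add: "\<And>f g. f \<in> X \<Longrightarrow> g \<in> X \<Longrightarrow> q (\<lambda>x. T (\<lambda>t. f t + g t) x - (T f x + T g x)) = 0"
    and scale: "\<And>f c. f \<in> X \<Longrightarrow> q (\<lambda>x. T (\<lambda>t. c * f t) x - c * T f x) = 0"
    and diff: "\<And>f g. f \<in> X \<Longrightarrow> g \<in> X \<Longrightarrow> (\<lambda>x. g x - f x) \<in> X"
    and diff_eq: "\<And>f g. f \<in> X \<Longrightarrow> g \<in> X \<Longrightarrow> q (\<lambda>x. T g x - T f x) = q (T (\<lambda>x. g x - f x))"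
    and C: "0 \<le> C" and bound: "\<And>f. f \<in> X \<Longrightarrow> q (T f) \<le> C * p f"
  shows "continuous_linear_operator X p Y q T"
  unfolding continuous_linear_operator_def
proof (intro conjI ballI allI impI maps add scale)
  fix f and \<epsilon> :: real assume f: "f \<in> X" and \<epsilon>: "0 < \<epsilon>"
  show "\<exists>\<delta>>0. \<forall>g\<in>X. p (\<lambda>x. g x - f x) < \<delta> \<longrightarrow> q (\<lambda>x. T g x - T f x) < \<epsilon>"
  \<comment> \<open>C + 1 in place of C allows C = 0 and makes the final inequality strict.\<close>
  proof (intro exI[of _ "\<epsilon> / (C + 1)"] conjI ballI impI)
    show "0 < \<epsilon> / (C + 1)" using \<epsilon> C by simp
    fix g assume g: "g \<in> X" and p: "p (\<lambda>x. g x - f x) < \<epsilon> / (C + 1)"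
    have "q (\<lambda>x. T g x - T f x) \<le> C * p (\<lambda>x. g x - f x)"
      unfolding diff_eq[OF f g] by (rule bound[OF diff[OF f g]])
    also have "\<dots> \<le> C * (\<epsilon> / (C + 1))"
      using p C by (intro mult_left_mono) auto
    also have "\<dots> < \<epsilon>" using C \<epsilon> by (simp add: field_simps)
    finally show "q (\<lambda>x. T g x - T f x) < \<epsilon>" .
  qed
qed

lemma convolve_diff_linear:
  assumes "convolvable_at \<mu> f x \<and> convolvable_at \<nu> f x" "convolvable_at \<mu> g x \<and> convolvable_at \<nu> g x"
  shows "convolve_diff \<mu> \<nu> (\<lambda>t. f t + g t) x = convolve_diff \<mu> \<nu> f x + convolve_diff \<mu> \<nu> g x"
    and "convolve_diff \<mu> \<nu> (\<lambda>t. f t - g t) x = convolve_diff \<mu> \<nu> f x - convolve_diff \<mu> \<nu> g x"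
  using assms by (auto simp: convolve_diff_def convolve_def convolvable_at_def)

lemma convolve_diff_scale: "convolve_diff \<mu> \<nu> (\<lambda>t. c * f t) x = c * convolve_diff \<mu> \<nu> f x"
  by (simp add: convolve_diff_def convolve_def right_diff_distrib)

text \<open>exp (\<gamma> |x|) is the larger of exp (\<gamma> x) and exp (- \<gamma> x), so bounds
  for the two one-sided weights amount to one for the two-sided weight.\<close>

lemma wn2_abs_wn2:
  assumes [measurable]: "f \<in> borel_measurable borel" and \<gamma>: "\<gamma> \<ge> 0"
  shows "wn2 \<gamma> f \<le> wn2_abs \<gamma> f" "wn2 (- \<gamma>) f \<le> wn2_abs \<gamma> f" "wn2_abs \<gamma> f \<le> wn2 \<gamma> f + wn2 (- \<gamma>) f"
proof -
  have 1: "s * x \<le> \<gamma> * \<bar>x\<bar>" if "s = \<gamma> \<or> s = - \<gamma>" for s x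
    using that \<gamma> mult_left_mono[OF abs_ge_self[of x] \<gamma>] mult_left_mono[OF abs_ge_minus_self[of x] \<gamma>] by auto
  have "wn2 s f \<le> wn2_abs \<gamma> f" if "s = \<gamma> \<or> s = - \<gamma>" for s
    unfolding wn2_def wn2_abs_def norm_exp_weight
    using 1[OF that] by (intro nn_integral_mono ennreal_leI power_mono mult_right_mono) auto
  then show "wn2 \<gamma> f \<le> wn2_abs \<gamma> f" "wn2 (- \<gamma>) f \<le> wn2_abs \<gamma> f" by auto
  have "wn2_abs \<gamma> f \<le> (\<integral>\<^sup>+x. ennreal ((exp (\<gamma> * x) * cmod (f x))\<^sup>2) + ennreal ((exp (- \<gamma> * x) * cmod (f x))\<^sup>2) \<partial>lborel)"
    unfolding wn2_abs_def norm_exp_weight by (intro nn_integral_mono) (auto simp: abs_if simp flip: ennreal_plus)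
  also have "\<dots> = wn2 \<gamma> f + wn2 (- \<gamma>) f"
    unfolding wn2_def by (subst nn_integral_add) auto
  finally show "wn2_abs \<gamma> f \<le> wn2 \<gamma> f + wn2 (- \<gamma>) f" .
qed

text \<open>The weight is at least 1, so square-integrability of the weighted function implies that
  of the function itself.\<close>

lemma L2_weighted_iff:
  assumes "\<gamma> \<ge> 0"
  shows "f \<in> L2_weighted \<gamma> \<longleftrightarrow> f \<in> borel_measurable borel \<and> wn2_abs \<gamma> f < \<infinity>"
proof (cases "f \<in> borel_measurable borel")
  case [measurable]: True
  have w: "integrable lborel (\<lambda>x. (cmod (exp_weight \<gamma> f x))\<^sup>2) \<longleftrightarrow> wn2_abs \<gamma> f < \<infinity>"
    unfolding wn2_abs_def integrable_iff_bounded by simp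
  have "integrable lborel (\<lambda>x. (cmod (f x))\<^sup>2)" if "integrable lborel (\<lambda>x. (cmod (exp_weight \<gamma> f x))\<^sup>2)"
  proof (rule Bochner_Integration.integrable_bound[OF that])
    have "cmod (f x) \<le> cmod (exp_weight \<gamma> f x)" for x
      using mult_right_mono[of 1 "exp (\<gamma> * \<bar>x\<bar>)" "cmod (f x)"] assms by (simp add: norm_exp_weight)
    then show "AE x in lborel. norm ((cmod (f x))\<^sup>2) \<le> norm ((cmod (exp_weight \<gamma> f x))\<^sup>2)"
      by (auto intro!: power_mono)
  qed measurable
  then show ?thesis
    using w by (auto simp: L2_weighted_def L2_def)
qed (auto simp: L2_weighted_def L2_def)

lemma L2_weighted_norm_eq:
  assumes [measurable]: "f \<in> borel_measurable borel"
  shows "L2_weighted_norm \<gamma> f = sqrt (enn2real (wn2_abs \<gamma> f))"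
  unfolding L2_weighted_norm_def L2_norm_def wn2_abs_def by (subst integral_eq_nn_integral) auto

lemma L2_weighted_norm_AE_0:
  assumes "AE x in lborel. f x = 0"
  shows "L2_weighted_norm \<gamma> f = 0"
proof -
  have "(LINT x|lborel. (cmod (exp_weight \<gamma> f x))\<^sup>2) = 0"
    by (rule integral_eq_zero_AE) (use assms in eventually_elim, simp add: exp_weight_def)
  then show ?thesis by (simp add: L2_weighted_norm_def L2_norm_def)
qed

lemma L2_weighted_diff:
  assumes "\<gamma> \<ge> 0" "f \<in> L2_weighted \<gamma>" "g \<in> L2_weighted \<gamma>"
  shows "(\<lambda>x. g x - f x) \<in> L2_weighted \<gamma>"
proof -
  have m [measurable]: "f \<in> borel_measurable borel" "g \<in> borel_measurable borel"
    and fin: "wn2_abs \<gamma> f < \<infinity>" "wn2_abs \<gamma> g < \<infinity>"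
    using assms by (auto simp: L2_weighted_iff)
  have fin2: "wn2 s f < \<infinity>" "wn2 s g < \<infinity>" if "s = \<gamma> \<or> s = - \<gamma>" for s
    using that fin wn2_abs_wn2(1,2)[OF m(1) assms(1)] wn2_abs_wn2(1,2)[OF m(2) assms(1)] by (auto intro: le_less_trans)
  have "wn2 s (\<lambda>x. g x + (- 1) * f x) < \<infinity>" if "s = \<gamma> \<or> s = - \<gamma>" for s
    using fin2[OF that] wn2_scale[OF m(1), of s "-1"]
    by (intro le_less_trans[OF wn2_add_weighted[of _ _ 1]]) (auto simp: ennreal_mult_less_top)
  then have "wn2_abs \<gamma> (\<lambda>x. g x - f x) < \<infinity>"
    using wn2_abs_wn2(3)[of "\<lambda>x. g x - f x" \<gamma>] assms(1) by (auto intro: le_less_trans)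
  then show ?thesis
    using assms(1) by (simp add: L2_weighted_iff)
qed

section \<open>Weighted norms of derivatives\<close>

lemma nth_derivative_0 [simp]: "nth_derivative 0 f = f"
  by (simp add: nth_derivative_def)

lemma nth_derivative_Suc: "nth_derivative (Suc k) f = (\<lambda>x. vector_derivative (nth_derivative k f) (at x))"
  by (simp add: nth_derivative_def)

lemma nth_derivative_diff:
  assumes "f \<in> C_class M" "g \<in> C_class M" "k \<le> M"
  shows "nth_derivative k (\<lambda>x. g x - f x) = (\<lambda>x. nth_derivative k g x - nth_derivative k f x)"
  using assms(3)
proof (induction k)
  case (Suc k)
  then have "k < M" by simp
  then have "nth_derivative k f differentiable at x" "nth_derivative k g differentiable at x" for x
    using assms by (auto simp: C_class_def)
  then show ?case
    using Suc by (simp add: nth_derivative_Suc)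
qed simp

lemma C_weighted_norm_upper:
  assumes "f \<in> C_weighted M \<gamma>" "k \<le> M"
  shows "exp (\<gamma> * \<bar>x\<bar>) * cmod (nth_derivative k f x) \<le> C_weighted_norm M \<gamma> f"
proof -
  have "exp (\<gamma> * \<bar>x\<bar>) * cmod (nth_derivative k f x) \<le> (SUP x. exp (\<gamma> * \<bar>x\<bar>) * cmod (nth_derivative k f x))"
    using assms by (intro cSUP_upper) (auto simp: C_weighted_def)
  also have "\<dots> \<le> C_weighted_norm M \<gamma> f"
    unfolding C_weighted_norm_def using assms(2) by (intro Max_ge) auto
  finally show ?thesis .
qed

lemma C_weighted_0_norm_le:
  assumes "\<And>x. exp (\<gamma> * \<bar>x\<bar>) * cmod (f x) \<le> B"
  shows "C_weighted_norm 0 \<gamma> f \<le> B"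
  unfolding C_weighted_norm_def using assms by (auto intro!: cSUP_least)

lemma C_weighted_diff:
  assumes f: "f \<in> C_weighted M \<gamma>" and g: "g \<in> C_weighted M \<gamma>"
  shows "(\<lambda>x. g x - f x) \<in> C_weighted M \<gamma>"
proof -
  have c: "f \<in> C_class M" "g \<in> C_class M" using assms by (auto simp: C_weighted_def)
  note d = nth_derivative_diff[OF c]
  have "(\<lambda>x. g x - f x) \<in> C_class M"
    unfolding C_class_def using c d by (auto simp: C_class_def intro!: differentiable_diff continuous_on_diff)
  moreover have "bdd_above (range (\<lambda>x. exp (\<gamma> * \<bar>x\<bar>) * cmod (nth_derivative k (\<lambda>x. g x - f x) x)))" if "k \<le> M" for k
  proof (rule bdd_aboveI2)
    fix x
    have "exp (\<gamma> * \<bar>x\<bar>) * cmod (nth_derivative k (\<lambda>x. g x - f x) x)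
       \<le> exp (\<gamma> * \<bar>x\<bar>) * (cmod (nth_derivative k g x) + cmod (nth_derivative k f x))"
      unfolding d[OF that] by (intro mult_left_mono norm_triangle_ineq4) auto
    also have "\<dots> \<le> C_weighted_norm M \<gamma> g + C_weighted_norm M \<gamma> f"
      unfolding distrib_left by (intro add_mono C_weighted_norm_upper f g that)
    finally show "exp (\<gamma> * \<bar>x\<bar>) * cmod (nth_derivative k (\<lambda>x. g x - f x) x) \<le> C_weighted_norm M \<gamma> g + C_weighted_norm M \<gamma> f" .
  qed
  ultimately show ?thesis by (auto simp: C_weighted_def)
qed

section \<open>The two boundedness statements\<close>

context drift_law begin

text \<open>Adding the bounds at \<gamma> and -\<gamma> gives the factor 2 C for the two-sided
  squared norm, hence sqrt (2 C) for the norm. Additivity holds wherever the convolutions converge,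
  that is, almost everywhere.\<close>

lemma L2_multiplier:
  assumes gs: "good_strip s0 K t" "0 < \<gamma>" "\<gamma> \<le> s0"
  shows "continuous_fourier_multiplier G T
    (L2_weighted \<gamma>) (L2_weighted_norm \<gamma>) (L2_weighted \<gamma>) (L2_weighted_norm \<gamma>)"
proof -
  have g0: "\<gamma> \<ge> 0" using gs by simp
  obtain C where C: "C \<ge> 0"
    "\<And>f. f \<in> borel_measurable borel \<Longrightarrow> wn2 \<gamma> f < \<infinity> \<Longrightarrow> wn2 (- \<gamma>) f < \<infinity> \<Longrightarrow> wn2 \<gamma> (W f) \<le> ennreal C * wn2 \<gamma> f"
    "\<And>f. f \<in> borel_measurable borel \<Longrightarrow> wn2 \<gamma> f < \<infinity> \<Longrightarrow> wn2 (- \<gamma>) f < \<infinity> \<Longrightarrow> wn2 (- \<gamma>) (W f) \<le> ennreal C * wn2 (- \<gamma>) f"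
    by (rule W_bound[OF gs]) blast
  have X: "f \<in> borel_measurable borel" "wn2 \<gamma> f < \<infinity>" "wn2 (- \<gamma>) f < \<infinity>" "wn2_abs \<gamma> f < \<infinity>" if "f \<in> L2_weighted \<gamma>" for f
  proof -
    show f: "f \<in> borel_measurable borel" "wn2_abs \<gamma> f < \<infinity>"
      using that g0 by (auto simp: L2_weighted_iff)
    show "wn2 \<gamma> f < \<infinity>" "wn2 (- \<gamma>) f < \<infinity>"
      using le_less_trans[OF wn2_abs_wn2(1)[OF f(1) g0] f(2)] le_less_trans[OF wn2_abs_wn2(2)[OF f(1) g0] f(2)] by auto
  qed
  have Wm: "W f \<in> borel_measurable borel" if "f \<in> L2_weighted \<gamma>" for f
    by (rule borel_measurable_W[OF gs X(1)[OF that]])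
  have Wn: "wn2_abs \<gamma> (W f) \<le> ennreal (2 * C) * wn2_abs \<gamma> f" if f: "f \<in> L2_weighted \<gamma>" for f
  proof -
    have "wn2_abs \<gamma> (W f) \<le> wn2 \<gamma> (W f) + wn2 (- \<gamma>) (W f)"
      by (rule wn2_abs_wn2(3)[OF Wm[OF f] g0])
    also have "\<dots> \<le> ennreal C * wn2 \<gamma> f + ennreal C * wn2 (- \<gamma>) f"
      using X[OF f] by (intro add_mono C) auto
    also have "\<dots> \<le> ennreal C * wn2_abs \<gamma> f + ennreal C * wn2_abs \<gamma> f"
      by (intro add_mono mult_left_mono wn2_abs_wn2 X f g0) auto
    also have "\<dots> = ennreal (2 * C) * wn2_abs \<gamma> f"
      unfolding mult_2 ennreal_plus[OF C(1) C(1)] by (rule distrib_right[symmetric])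
    finally show ?thesis .
  qed
  have Wf: "wn2_abs \<gamma> (W f) < \<infinity>" if f: "f \<in> L2_weighted \<gamma>" for f
    by (rule le_less_trans[OF Wn[OF f]]) (use X(4)[OF f] in \<open>simp add: ennreal_mult_less_top\<close>)
  have conv: "AE x in lborel. convolvable_at G f x \<and> convolvable_at T f x"
    if "f \<in> L2_weighted \<gamma>" for f
    by (rule AE_convolvable[OF gs X(1,2)[OF that]])
  have "continuous_linear_operator (L2_weighted \<gamma>) (L2_weighted_norm \<gamma>) (L2_weighted \<gamma>) (L2_weighted_norm \<gamma>) W"
  proof (rule continuous_linear_operatorI[where C="sqrt (2 * C)"])
    show "W f \<in> L2_weighted \<gamma>" if "f \<in> L2_weighted \<gamma>" for f
      using Wm[OF that] Wf[OF that] g0 by (simp add: L2_weighted_iff)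
    show "L2_weighted_norm \<gamma> (\<lambda>x. W (\<lambda>t. f t + g t) x - (W f x + W g x)) = 0"
      if "f \<in> L2_weighted \<gamma>" "g \<in> L2_weighted \<gamma>" for f g
      by (rule L2_weighted_norm_AE_0)
        (use conv[OF that(1)] conv[OF that(2)] in eventually_elim, simp add: convolve_diff_linear)
    show "L2_weighted_norm \<gamma> (\<lambda>x. W (\<lambda>t. c * f t) x - c * W f x) = 0" for f c
      by (rule L2_weighted_norm_AE_0) (simp add: convolve_diff_scale)
    show "(\<lambda>x. g x - f x) \<in> L2_weighted \<gamma>" if "f \<in> L2_weighted \<gamma>" "g \<in> L2_weighted \<gamma>" for f g
      by (rule L2_weighted_diff[OF g0 that])
    show "L2_weighted_norm \<gamma> (\<lambda>x. W g x - W f x) = L2_weighted_norm \<gamma> (W (\<lambda>x. g x - f x))"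
      if fg: "f \<in> L2_weighted \<gamma>" "g \<in> L2_weighted \<gamma>" for f g
    proof -
      note [measurable] = Wm[OF fg(1)] Wm[OF fg(2)] Wm[OF L2_weighted_diff[OF g0 fg]]
      have "AE x in lborel. W (\<lambda>x. g x - f x) x = W g x - W f x"
        using conv[OF fg(1)] conv[OF fg(2)] by eventually_elim (simp add: convolve_diff_linear)
      then have "(LINT x|lborel. (cmod (exp_weight \<gamma> (\<lambda>x. W g x - W f x) x))\<^sup>2) = (LINT x|lborel. (cmod (exp_weight \<gamma> (W (\<lambda>x. g x - f x)) x))\<^sup>2)"
        by (intro integral_cong_AE) (measurable, auto simp: exp_weight_def)
      then show ?thesis by (simp add: L2_weighted_norm_def L2_norm_def)
    qed
    show "L2_weighted_norm \<gamma> (W f) \<le> sqrt (2 * C) * L2_weighted_norm \<gamma> f" if f: "f \<in> L2_weighted \<gamma>" for f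
    proof -
      have "enn2real (wn2_abs \<gamma> (W f)) \<le> enn2real (ennreal (2 * C) * wn2_abs \<gamma> f)"
        using X(4)[OF f] by (intro enn2real_mono Wn f) (auto simp: ennreal_mult_less_top)
      also have "\<dots> = 2 * C * enn2real (wn2_abs \<gamma> f)"
        using C(1) by (simp add: enn2real_mult)
      finally show ?thesis
        unfolding L2_weighted_norm_eq[OF Wm[OF f]] L2_weighted_norm_eq[OF X(1)[OF f]] real_sqrt_mult[symmetric]
        by (rule real_sqrt_le_mono)
    qed
  qed (use C in simp)
  with conv kernels_GT(5,6)[OF gs] show ?thesis
    by (auto simp: continuous_fourier_multiplier_def)
qed

text \<open>\<open>G\<close> and \<open>T\<close> are separated only for Fubini's theorem, where the
  one-sided weight suffices. They are recombined into the kernel \<open>W (expo a)\<close> before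
  the two-sided weight is applied, since it is this difference that is known to decay in both
  directions.\<close>

lemma C_multiplier:
  assumes gs: "good_strip s0 K t" and \<gamma>: "0 < \<gamma>" "\<gamma> < s0"
  shows "\<And>f x. f \<in> C_weighted 2 \<gamma> \<Longrightarrow> convolvable_at G f x \<and> convolvable_at T f x"
    and "continuous_fourier_multiplier G T
      (C_weighted 2 \<gamma>) (C_weighted_norm 2 \<gamma>) (C_weighted 0 \<gamma>) (C_weighted_norm 0 \<gamma>)"
proof -
  \<comment> \<open>Any exponent above \<open>s0\<close> would do: it puts \<open>expo a\<close>
    into \<open>L1L2\<close> at both weights s0 and -s0.\<close>
  define a where "a = s0 + 1"
  have s0: "0 < s0" "s0 \<le> s0" using gs by (auto simp: good_strip_def)
  have a: "0 < a" "\<bar>\<gamma>\<bar> < a" "s0 < a" "- s0 < a" using s0 \<gamma> by (auto simp: a_def)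
  note gs' = gs s0
  note g\<gamma> = gs \<gamma>(1) less_imp_le[OF \<gamma>(2)]
  let ?k = "W (expo a)"
  have eV: "expo a \<in> L1L2 s0" "expo a \<in> L1L2 (- s0)" using a by (auto intro: expo_L1L2)
  have km [measurable]: "?k \<in> borel_measurable borel"
    by (rule borel_measurable_W[OF gs']) measurable
  have kfin: "wn2_abs s0 ?k < \<infinity>"
  proof -
    obtain C where C: "C \<ge> 0"
      "\<And>f. f \<in> borel_measurable borel \<Longrightarrow> wn2 s0 f < \<infinity> \<Longrightarrow> wn2 (- s0) f < \<infinity> \<Longrightarrow> wn2 s0 (W f) \<le> ennreal C * wn2 s0 f"
      "\<And>f. f \<in> borel_measurable borel \<Longrightarrow> wn2 s0 f < \<infinity> \<Longrightarrow> wn2 (- s0) f < \<infinity> \<Longrightarrow> wn2 (- s0) (W f) \<le> ennreal C * wn2 (- s0) f"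
      by (rule W_bound[OF gs']) blast
    have e: "wn2 s0 (expo a) < \<infinity>" "wn2 (- s0) (expo a) < \<infinity>" using eV by (auto simp: L1L2_def)
    have "wn2_abs s0 ?k \<le> wn2 s0 ?k + wn2 (- s0) ?k"
      using s0 by (intro wn2_abs_wn2(3) km) auto
    also have "\<dots> \<le> ennreal C * wn2 s0 (expo a) + ennreal C * wn2 (- s0) (expo a)"
      by (intro add_mono C e borel_measurable_expo)
    also have "\<dots> < \<infinity>" using e by (auto simp: ennreal_mult_less_top)
    finally show ?thesis .
  qed
  note kint = integrable_weight_of_wnorm2[OF km \<gamma>(2) kfin]
  define \<kappa> where "\<kappa> = (LINT x|lborel. exp (\<gamma> * \<bar>x\<bar>) * cmod (?k x))"
  have \<kappa>: "\<kappa> \<ge> 0" by (auto simp: \<kappa>_def intro!: integral_nonneg_AE)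
  have sfT: "sigma_finite_measure T" and sfG: "sigma_finite_measure G"
    using kernels_GT(1,2)[OF gs'] by (auto simp: kernel_def)
  have sT: "sets T = sets borel" by (simp add: T_measure_def)
  have fT: "(\<integral>\<^sup>+y. ennreal (exp (\<gamma> * y)) \<partial>T) < \<infinity>"
    by (rule T_exp_moment[OF \<gamma>(1) l_pos])
  note fG = renewal_exp_moment[OF g\<gamma>]
  note cG = convolve_expo[OF sets_renewal_measure sfG fG a(2)]
  note cT = convolve_expo[OF sT sfT fT a(2)]
  have main: "convolvable_at G f x" "convolvable_at T f x"
    "exp (\<gamma> * \<bar>x\<bar>) * cmod (W f x) \<le> (1 + a) * \<kappa> * C_weighted_norm 2 \<gamma> f"
    "continuous_on UNIV (W f)"
    if f: "f \<in> C_weighted 2 \<gamma>" for f x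
  proof -
    let ?A = "C_weighted_norm 2 \<gamma> f"
    let ?f' = "nth_derivative 1 f"
    let ?g = "\<lambda>x. ?f' x + cx a * f x"
    have fc: "f \<in> C_class 2" using f by (simp add: C_weighted_def)
    then have d: "nth_derivative k f differentiable at x" if "k < 2" for k x
      using that by (auto simp: C_class_def)
    have der: "(f has_vector_derivative ?f' x) (at x)" for x
      using d[of 0 x] by (simp add: nth_derivative_Suc vector_derivative_works)
    have cont': "continuous_on UNIV ?f'"
      using d[of 1] by (intro continuous_at_imp_continuous_on ballI differentiable_imp_continuous_within) auto
    have cf: "continuous_on UNIV f"
      using d[of 0] by (intro continuous_at_imp_continuous_on ballI differentiable_imp_continuous_within) auto
    have cg: "continuous_on UNIV ?g" by (intro continuous_intros cont' cf)
    have gm [measurable]: "?g \<in> borel_measurable borel" by (rule borel_measurable_continuous_onI[OF cg])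
    have b0: "exp (\<gamma> * \<bar>x\<bar>) * cmod (f x) \<le> ?A" for x
      using C_weighted_norm_upper[OF f, of 0 x] by simp
    have b1: "exp (\<gamma> * \<bar>x\<bar>) * cmod (?f' x) \<le> ?A" for x
      using C_weighted_norm_upper[OF f, of 1 x] by simp
    have le_exp: "c \<le> exp (\<gamma> * \<bar>x\<bar>) * c" if "c \<ge> 0" for c x :: real
      using mult_right_mono[of 1 "exp (\<gamma> * \<bar>x\<bar>)" c] that \<gamma> by simp
    have bg: "exp (\<gamma> * \<bar>x\<bar>) * cmod (?g x) \<le> (1 + a) * ?A" for x
    proof -
      have "exp (\<gamma> * \<bar>x\<bar>) * cmod (?g x) \<le> exp (\<gamma> * \<bar>x\<bar>) * (cmod (?f' x) + a * cmod (f x))"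
        using a norm_triangle_ineq[of "?f' x" "cx a * f x"] by (intro mult_left_mono) (auto simp: norm_mult)
      also have "\<dots> = exp (\<gamma> * \<bar>x\<bar>) * cmod (?f' x) + a * (exp (\<gamma> * \<bar>x\<bar>) * cmod (f x))"
        by (simp add: distrib_left)
      also have "\<dots> \<le> ?A + a * ?A"
        using a by (intro add_mono mult_left_mono b0 b1) auto
      finally show ?thesis by (simp add: distrib_right)
    qed
    \<comment> \<open>The one-sided form of the decay of g, matching the exponential moments of the
      two measures at \<gamma>.\<close>
    have bg2: "cmod (?g x) \<le> (1 + a) * ?A * exp (- \<gamma> * x)" for x
    proof -
      have "exp (\<gamma> * x) * cmod (?g x) \<le> exp (\<gamma> * \<bar>x\<bar>) * cmod (?g x)"
        using \<gamma> by (intro mult_right_mono) auto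
      also have "\<dots> \<le> (1 + a) * ?A" by (rule bg)
      finally have "exp (- \<gamma> * x) * (exp (\<gamma> * x) * cmod (?g x)) \<le> exp (- \<gamma> * x) * ((1 + a) * ?A)"
        by (intro mult_left_mono) auto
      moreover have "exp (- \<gamma> * x) * (exp (\<gamma> * x) * c) = c" for c
        by (simp add: mult.assoc[symmetric] exp_add[symmetric])
      ultimately have "cmod (?g x) \<le> exp (- \<gamma> * x) * ((1 + a) * ?A)" by (simp only:)
      then show ?thesis by (simp only: mult.commute[of "exp (- \<gamma> * x)"])
    qed
    have bg3: "cmod (?g x) \<le> (1 + a) * ?A" for x
      by (rule order_trans[OF le_exp bg]) simp
    have rep: "f x = (\<integral>t. expo a t * ?g (x - t) \<partial>lborel)" for x
      by (rule expo_representation[OF a(1) der cont', where A="?A"]) (rule order_trans[OF le_exp b0] order_trans[OF le_exp b1]; simp)+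
    note G = cG[OF gm bg2 rep] and T = cT[OF gm bg2 rep]
    show "convolvable_at G f x" "convolvable_at T f x"
      by (rule G(1) T(1))+
    \<comment> \<open>Both convolutions carry the same factor g (x - u), so subtracting them leaves
      the single kernel \<open>W (expo a)\<close>.\<close>
    have W: "W f x = (\<integral>u. ?g (x - u) * ?k u \<partial>lborel)" for x
      unfolding convolve_diff_def G(2) T(2) right_diff_distrib
      by (rule Bochner_Integration.integral_diff[symmetric]) (rule G(3) T(3))+
    have kint0: "integrable lborel ?k"
      by (rule Bochner_Integration.integrable_bound[OF kint]) (auto intro!: le_exp)
    show "exp (\<gamma> * \<bar>x\<bar>) * cmod (W f x) \<le> (1 + a) * \<kappa> * ?A"
      unfolding W \<kappa>_def using convolution_weighted_bound[OF less_imp_le[OF \<gamma>(1)] kint bg, of x] by (simp only: mult_ac)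
    show "continuous_on UNIV (W f)"
      unfolding W by (rule continuous_on_convolution[OF kint0 cg bg3])
  qed
  show conv: "convolvable_at G f x \<and> convolvable_at T f x" if "f \<in> C_weighted 2 \<gamma>" for f x
    using main(1,2)[OF that] by simp
  have "continuous_linear_operator (C_weighted 2 \<gamma>) (C_weighted_norm 2 \<gamma>) (C_weighted 0 \<gamma>) (C_weighted_norm 0 \<gamma>) W"
  proof (rule continuous_linear_operatorI[where C="(1 + a) * \<kappa>"])
    have zero: "C_weighted_norm 0 \<gamma> (\<lambda>x. 0) = 0"
      by (simp add: C_weighted_norm_def)
    show "W f \<in> C_weighted 0 \<gamma>" if "f \<in> C_weighted 2 \<gamma>" for f
      using main(3,4)[OF that] by (auto simp: C_weighted_def C_class_def intro!: bdd_aboveI2)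
    show "C_weighted_norm 0 \<gamma> (\<lambda>x. W (\<lambda>t. f t + g t) x - (W f x + W g x)) = 0"
      if "f \<in> C_weighted 2 \<gamma>" "g \<in> C_weighted 2 \<gamma>" for f g
      using conv that by (simp add: convolve_diff_linear zero)
    show "C_weighted_norm 0 \<gamma> (\<lambda>x. W (\<lambda>t. c * f t) x - c * W f x) = 0" for f c
      by (simp add: convolve_diff_scale zero)
    show "(\<lambda>x. g x - f x) \<in> C_weighted 2 \<gamma>" if "f \<in> C_weighted 2 \<gamma>" "g \<in> C_weighted 2 \<gamma>" for f g
      by (rule C_weighted_diff[OF that])
    show "C_weighted_norm 0 \<gamma> (\<lambda>x. W g x - W f x) = C_weighted_norm 0 \<gamma> (W (\<lambda>x. g x - f x))"
      if "f \<in> C_weighted 2 \<gamma>" "g \<in> C_weighted 2 \<gamma>" for f g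
    proof -
      have "W (\<lambda>x. g x - f x) = (\<lambda>x. W g x - W f x)"
        using conv that by (intro ext convolve_diff_linear(2))
      then show ?thesis by simp
    qed
    show "C_weighted_norm 0 \<gamma> (W f) \<le> (1 + a) * \<kappa> * C_weighted_norm 2 \<gamma> f" if "f \<in> C_weighted 2 \<gamma>" for f
      by (intro C_weighted_0_norm_le main(3)[OF that])
  qed (use a \<kappa> in auto)
  then show "continuous_fourier_multiplier G T
      (C_weighted 2 \<gamma>) (C_weighted_norm 2 \<gamma>) (C_weighted 0 \<gamma>) (C_weighted_norm 0 \<gamma>)"
    using conv kernels_GT(5,6)[OF gs'] by (auto simp: continuous_fourier_multiplier_def)
qed

end

theorem proposition4p8:
  fixes \<rho> :: "real measure" and l :: real
  assumes "prob_space \<rho>" and "sets \<rho> = sets borel"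
    and "exponential_moment \<rho>"
    and "l = (LINT y|\<rho>. y)" and "l > 0"
    and "weakly_diophantine_0 \<rho>"
  shows "\<exists>\<gamma>\<^sub>0>0. \<forall>\<gamma>\<in>{0<..<\<gamma>\<^sub>0}.
    (\<forall>f\<in>C_weighted 2 \<gamma>. \<forall>x.
       convolvable_at (renewal_measure \<rho>) f x \<and> convolvable_at (T_measure l) f x) \<and>
    continuous_fourier_multiplier (renewal_measure \<rho>) (T_measure l)
      (C_weighted 2 \<gamma>) (C_weighted_norm 2 \<gamma>) (C_weighted 0 \<gamma>) (C_weighted_norm 0 \<gamma>) \<and>
    continuous_fourier_multiplier (renewal_measure \<rho>) (T_measure l)
      (L2_weighted \<gamma>) (L2_weighted_norm \<gamma>) (L2_weighted \<gamma>) (L2_weighted_norm \<gamma>)"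
proof -
  obtain \<eta> where \<eta>: "\<eta> > 0" "integrable \<rho> (\<lambda>y. exp (\<eta> * \<bar>y\<bar>))"
    using assms(3) unfolding exponential_moment_def by blast
  interpret prob_space \<rho> by fact
  \<comment> \<open>The locale asks for the exponential moment at 4 e, whence e = \<eta> /
    4.\<close>
  interpret drift_law \<rho> l "\<eta> / 4"
    using assms \<eta> by unfold_locales auto
  obtain s0 K t where gs: "good_strip s0 K t"
    using good_strip_exists by blast
  show ?thesis
  proof (intro exI[of _ s0] conjI ballI allI)
    show "0 < s0" using gs by (simp add: good_strip_def)
  qed (use C_multiplier[OF gs] L2_multiplier[OF gs] in auto)
qed

end
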